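(* Let $\alpha\geq 1$, let $\vec{a}\in\mathbb{R}^3$ be a unit vector, let $\Gamma\subset\mathbb{R}^3_+(\vec{a})$ be a closed curve, and set $$C=L(\Gamma)\,\sup_{p\in\Gamma}\langle p,\vec{a}\rangle,$$ where $L(\Gamma)$ is the length of $\Gamma$. Then the area $A(M)$ of any compact $\alpha$-singular minimal surface $M$ (with density vector $\vec{a}$) with boundary $\Gamma$ satisfies $$A(M)\leq C.$$
   Context: For a unit vector $\vec{a}\in\mathbb{R}^3$ let $\mathbb{R}^3_+(\vec{a})=\{p\in\mathbb{R}^3:\langle p,\vec{a}\rangle>0\}$. For $\alpha\in\mathbb{R}$, $\alpha\neq 0$, an $\alpha$-singular minimal surface with density vector $\vec{a}$ is a smooth immersion $\phi:M\to\mathbb{R}^3_+(\vec{a})$ of an oriented surface $M$ (possibly with smooth boundary) such that $2H=\alpha\,\langle N,\vec{a}\rangle/\langle\phi,\vec{a}\rangle$ on $M$, where $N$ is the Gauss map and $H$ the mean curvature (half the sum of the principal curvatures, with sign such that $\Delta\phi=2HN$ for the Laplace-Beltrami operator of the induced metric). A surface $M$ has boundary a closed curve $\Gamma\subset\mathbb{R}^3$ if the restriction of the immersion $\phi$ to $\partial M$ is a diffeomorphism onto $\Gamma$. $A(M)$ is the area of $M$ in the induced metric. *)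

theory Defs
  imports "HOL-Analysis.Analysis"
begin

section \<open>Smooth maps between subsets of Euclidean spaces\<close>

primrec Ck_on :: "nat \<Rightarrow> ('a::euclidean_space \<Rightarrow> 'b::euclidean_space) \<Rightarrow> 'a set \<Rightarrow> bool" where
  "Ck_on 0 f U \<longleftrightarrow> continuous_on U f"
| "Ck_on (Suc k) f U \<longleftrightarrow> (\<forall>x\<in>U. f differentiable (at x)) \<and>
     (\<forall>v. Ck_on k (\<lambda>x. frechet_derivative f (at x) v) U)"

text \<open>A map on an arbitrary subset \<open>S\<close> of a Euclidean space is smooth if, near every point of
  \<open>S\<close>, it has a \<open>C\<^sup>\<infinity>\<close> extension to an open set.  It is used for relatively open subsets of the
  half-plane, for subsets of its boundary line and for subsets of a space curve.\<close>

definition smooth_on :: "'a::euclidean_space set \<Rightarrow> ('a \<Rightarrow> 'b::euclidean_space) \<Rightarrow> bool" where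
  "smooth_on S f \<longleftrightarrow> (\<forall>p\<in>S. \<exists>U g. open U \<and> p \<in> U \<and> (\<forall>k. Ck_on k g U) \<and> (\<forall>x\<in>U \<inter> S. g x = f x))"


section \<open>Closed curves\<close>

text \<open>A closed curve is the range of a \<open>1\<close>-periodic regular smooth parametrization which is
  injective modulo the period, that is, an embedded smooth circle.\<close>

definition closed_curve_param :: "(real \<Rightarrow> real^3) \<Rightarrow> bool" where
  "closed_curve_param \<gamma> \<longleftrightarrow> smooth_on UNIV \<gamma> \<and> (\<forall>t. vector_derivative \<gamma> (at t) \<noteq> 0) \<and>
     (\<forall>s t. \<gamma> s = \<gamma> t \<longleftrightarrow> s - t \<in> \<int>)"

definition curve_length :: "(real \<Rightarrow> real^3) \<Rightarrow> real" where
  "curve_length \<gamma> = integral {0..1} (\<lambda>t. norm (vector_derivative \<gamma> (at t)))"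


section \<open>Oriented smooth surfaces with boundary\<close>

definition half_plane :: "(real^2) set" where
  "half_plane = {q. 0 \<le> q $ 2}"

text \<open>A chart is a pair of its domain and its coordinate map.  Interior charts are included, as an
  open subset of the half-plane may avoid the boundary line; hence the boundary may be empty.
  Derivatives at points of the boundary line are taken within the chart image, which determines
  them uniquely.  Surfaces need not be connected.\<close>

type_synonym 'm chart = "'m set \<times> ('m \<Rightarrow> real^2)"

locale oriented_surface =
  fixes T :: "'m topology" and A :: "'m chart set"
  assumes hausdorff: "Hausdorff_space T"
    and second_countable: "second_countable T"
    and chart_domain_open: "(U, x) \<in> A \<Longrightarrow> openin T U"
    and chart_image_open: "(U, x) \<in> A \<Longrightarrow> openin (top_of_set half_plane) (x ` U)"
    and chart_homeomorphic:
      "(U, x) \<in> A \<Longrightarrow> homeomorphic_map (subtopology T U) (top_of_set (x ` U)) x"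
    and charts_cover: "(\<Union>(U, x)\<in>A. U) = topspace T"
    and transition_smooth:
      "\<lbrakk>(U, x) \<in> A; (V, y) \<in> A\<rbrakk> \<Longrightarrow> smooth_on (x ` (U \<inter> V)) (y \<circ> inv_into U x)"
    and transition_oriented:
      "\<lbrakk>(U, x) \<in> A; (V, y) \<in> A; q \<in> x ` (U \<inter> V)\<rbrakk> \<Longrightarrow>
         det (matrix (frechet_derivative (y \<circ> inv_into U x) (at q within x ` (U \<inter> V)))) > 0"

definition surface_boundary :: "'m chart set \<Rightarrow> 'm set" where
  "surface_boundary A = {p. \<exists>(U, x)\<in>A. p \<in> U \<and> x p $ 2 = 0}"

locale immersed_surface = oriented_surface T A
  for T :: "'m topology" and A :: "'m chart set" +
  fixes \<phi> :: "'m \<Rightarrow> real^3"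
  assumes immersion_smooth: "(U, x) \<in> A \<Longrightarrow> smooth_on (x ` U) (\<phi> \<circ> inv_into U x)"
    and immersion_inj:
      "\<lbrakk>(U, x) \<in> A; q \<in> x ` U\<rbrakk> \<Longrightarrow>
         inj (frechet_derivative (\<phi> \<circ> inv_into U x) (at q within x ` U))"


section \<open>Local geometry of a parametrization \<open>X\<close> on \<open>S\<close>\<close>

definition partial :: "(real^2) set \<Rightarrow> 2 \<Rightarrow> (real^2 \<Rightarrow> real^3) \<Rightarrow> real^2 \<Rightarrow> real^3" where
  "partial S i f q = frechet_derivative f (at q within S) (axis i 1)"

definition first_form :: "(real^2) set \<Rightarrow> (real^2 \<Rightarrow> real^3) \<Rightarrow> real^2 \<Rightarrow> real^2^2" where
  "first_form S X q = (\<chi> i j. partial S i X q \<bullet> partial S j X q)"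

definition gauss_map :: "(real^2) set \<Rightarrow> (real^2 \<Rightarrow> real^3) \<Rightarrow> real^2 \<Rightarrow> real^3" where
  "gauss_map S X q = sgn (cross3 (partial S 1 X q) (partial S 2 X q))"

definition second_form :: "(real^2) set \<Rightarrow> (real^2 \<Rightarrow> real^3) \<Rightarrow> real^2 \<Rightarrow> real^2^2" where
  "second_form S X q = (\<chi> i j. partial S i (partial S j X) q \<bullet> gauss_map S X q)"

definition shape_operator :: "(real^2) set \<Rightarrow> (real^2 \<Rightarrow> real^3) \<Rightarrow> real^2 \<Rightarrow> real^2^2" where
  "shape_operator S X q = matrix_inv (first_form S X q) ** second_form S X q"

text \<open>The principal curvatures are the eigenvalues of the shape operator, counted with
  multiplicity.\<close>

definition principal_curvatures ::
    "(real^2) set \<Rightarrow> (real^2 \<Rightarrow> real^3) \<Rightarrow> real^2 \<Rightarrow> real \<Rightarrow> real \<Rightarrow> bool" where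
  "principal_curvatures S X q \<kappa>\<^sub>1 \<kappa>\<^sub>2 \<longleftrightarrow>
     (\<forall>k. det (mat k - shape_operator S X q) = (k - \<kappa>\<^sub>1) * (k - \<kappa>\<^sub>2))"

text \<open>The sign is that of \<open>\<Delta>X = 2 H N\<close>, since \<open>\<Delta>X \<bullet> N\<close> is the trace of the second fundamental form
  with respect to the first; the unit sphere with outward normal has \<open>H = -1\<close>.\<close>

definition mean_curvature :: "(real^2) set \<Rightarrow> (real^2 \<Rightarrow> real^3) \<Rightarrow> real^2 \<Rightarrow> real" where
  "mean_curvature S X q =
     (THE H. \<exists>\<kappa>\<^sub>1 \<kappa>\<^sub>2. principal_curvatures S X q \<kappa>\<^sub>1 \<kappa>\<^sub>2 \<and> H = (\<kappa>\<^sub>1 + \<kappa>\<^sub>2) / 2)"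

definition area_density :: "(real^2) set \<Rightarrow> (real^2 \<Rightarrow> real^3) \<Rightarrow> real^2 \<Rightarrow> real" where
  "area_density S X q = sqrt (det (first_form S X q))"


section \<open>Area\<close>

text \<open>Cut the surface into finitely many disjoint Borel pieces, each inside one chart, and add
  the areas of the pieces computed in these charts.  If the pieces cover the surface, the sum does
  not depend on the decomposition and attains the supremum.\<close>

definition chart_decompositions :: "'m chart set \<Rightarrow> ('m chart set \<times> ('m chart \<Rightarrow> 'm set)) set" where
  "chart_decompositions A = {(F, P). finite F \<and> F \<subseteq> A \<and> disjoint_family_on P F \<and>
     (\<forall>(U, x)\<in>F. P (U, x) \<subseteq> U \<and> x ` P (U, x) \<in> sets borel)}"

definition surface_area :: "'m chart set \<Rightarrow> ('m \<Rightarrow> real^3) \<Rightarrow> ennreal" where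
  "surface_area A \<phi> = (SUP (F, P)\<in>chart_decompositions A.
     \<Sum>(U, x)\<in>F. \<integral>\<^sup>+q\<in>x ` P (U, x). ennreal (area_density (x ` U) (\<phi> \<circ> inv_into U x) q) \<partial>lborel)"


section \<open>Singular minimal surfaces\<close>

definition open_half_space :: "real^3 \<Rightarrow> (real^3) set" where
  "open_half_space a = {p. p \<bullet> a > 0}"

text \<open>By orientedness the normal does not depend on the chart, so the equation may be
  imposed in every chart.\<close>

locale singular_minimal_surface = immersed_surface T A \<phi>
  for T :: "'m topology" and A :: "'m chart set" and \<phi> :: "'m \<Rightarrow> real^3" +
  fixes \<alpha> :: real and a :: "real^3"
  assumes \<alpha>_nonzero: "\<alpha> \<noteq> 0"
    and a_unit: "norm a = 1"
    and in_half_space: "\<phi> ` topspace T \<subseteq> open_half_space a"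
    and singular_minimal:
      "\<lbrakk>(U, x) \<in> A; p \<in> U\<rbrakk> \<Longrightarrow>
         2 * mean_curvature (x ` U) (\<phi> \<circ> inv_into U x) (x p) =
         \<alpha> * ((gauss_map (x ` U) (\<phi> \<circ> inv_into U x) (x p) \<bullet> a) / (\<phi> p \<bullet> a))"

text \<open>The restriction of \<open>\<phi>\<close> to the boundary is a diffeomorphism onto \<open>\<Gamma>\<close>: a homeomorphism which
  is smooth with smooth inverse, as seen in all charts of the surface.\<close>

definition has_boundary ::
    "'m topology \<Rightarrow> 'm chart set \<Rightarrow> ('m \<Rightarrow> real^3) \<Rightarrow> (real^3) set \<Rightarrow> bool" where
  "has_boundary T A \<phi> \<Gamma> \<longleftrightarrow>
     homeomorphic_map (subtopology T (surface_boundary A)) (top_of_set \<Gamma>) \<phi> \<and>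
     (\<forall>(U, x)\<in>A.
        smooth_on (x ` (U \<inter> surface_boundary A)) (\<phi> \<circ> inv_into U x) \<and>
        smooth_on (\<phi> ` (U \<inter> surface_boundary A)) (x \<circ> inv_into (surface_boundary A) \<phi>))"

end

theory Submission
  imports Defs
begin

text \<open>Let \<open>u = \<phi> \<bullet> a\<close> be the height and \<open>\<nu> = N \<bullet> a\<close>.  From \<open>\<Delta>\<phi> = 2 H N\<close> and the equation of singular
  minimality, \<open>u \<Delta>u = \<alpha> \<nu>\<^sup>2\<close>, while \<open>|\<nabla>u|\<^sup>2 = 1 - \<nu>\<^sup>2\<close>; hence the field \<open>u \<nabla>u\<close> has divergence
  \<open>1 + (\<alpha> - 1) \<nu>\<^sup>2 \<ge> 1\<close>.  By the divergence theorem the area is at most the flux of \<open>u \<nabla>u\<close> through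
  the boundary, and this flux is at most the integral of \<open>u\<close> along \<open>\<Gamma>\<close>, as \<open>|\<nabla>u| \<le> 1\<close>.
  The divergence theorem is applied in charts to \<open>\<rho> u \<nabla>u\<close>, with \<open>\<rho>\<close> from a partition of unity; the
  terms in \<open>d\<rho>\<close> cancel after a change of charts.  Partitions of unity and fields
  of class \<open>C\<^sup>1\<close> suffice.\<close>

section \<open>Differentiation on relatively open subsets of the half-plane\<close>

text \<open>The obstacle is that no single weighted divergence has a sign, since it contains the
  derivative of its weight \<open>\<rho> i\<close>. Only the sum over all \<open>i\<close> is
  bounded below, and that sum makes sense pointwise only in one common chart, whereas the divergence
  theorem treats the weight \<open>\<rho> i\<close> in its own chart. The partition is therefore
  used twice. Inserting the sum of all \<open>\<rho> j\<close>, which is 1, produces products of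
  \<open>\<rho> j\<close> with the divergence belonging to \<open>\<rho> i\<close>; such a product
  lives where both charts are defined, so its integral can be moved from chart \<open>i\<close> to
  chart \<open>j\<close>, and there the sum over \<open>i\<close> comes first. For this the
  divergence has to vanish wherever \<open>\<rho> i\<close> does, so the weights are built from
  bumps whose derivative vanishes together with them.

  The factor u in the field u \<nabla>u is there because the curvature equation has u in its
  denominator: it makes the divergence free of u, and \<alpha> \<ge> 1 is what keeps the remaining
  coefficient \<alpha> - 1 nonnegative.\<close>

abbreviation hp_open :: "(real^2) set \<Rightarrow> bool" where
  "hp_open S \<equiv> openin (top_of_set half_plane) S"

abbreviation dir :: "(real^2) set \<Rightarrow> real^2 \<Rightarrow> (real^2 \<Rightarrow> 'b::real_normed_vector) \<Rightarrow> real^2 \<Rightarrow> 'b" where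
  "dir S v f q \<equiv> frechet_derivative f (at q within S) v"

abbreviation e\<^sub>1 :: "real^2" where "e\<^sub>1 \<equiv> axis 1 1"
abbreviation e\<^sub>2 :: "real^2" where "e\<^sub>2 \<equiv> axis 2 1"

lemma at_within_openin:
  assumes "openin (top_of_set S) S'" "q \<in> S'"
  shows "at q within S' = at q within S"
proof -
  obtain W where W: "open W" "S' = S \<inter> W"
    using assms(1) by (auto simp: openin_open)
  then show ?thesis
    using assms(2) at_within_nhd[of q W S' S] by auto
qed

text \<open>Positive steps along either axis stay in the half-plane even from its boundary line.
  This one-sided room is what makes derivatives within \<open>S\<close> unique, at boundary points
  as at interior ones.\<close>

lemma hp_open_unique_direction:
  assumes "hp_open S" "q \<in> S" "i \<in> Basis" "e > 0"
  shows "\<exists>d. 0 < \<bar>d\<bar> \<and> \<bar>d\<bar> < e \<and> q + d *\<^sub>R i \<in> S"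
proof -
  obtain W where W: "open W" "S = half_plane \<inter> W"
    using assms(1) by (auto simp: openin_open)
  then obtain r where r: "r > 0" "ball q r \<subseteq> W"
    using assms(2) open_contains_ball by blast
  define d where "d = min r e / 2"
  have d: "0 < d" "d < r" "d < e"
    using r(1) assms(4) by (auto simp: d_def)
  have "q + d *\<^sub>R i \<in> ball q r"
    using d assms(3) by (simp add: dist_norm)
  moreover have "q + d *\<^sub>R i \<in> half_plane"
    using assms(2,3) d W(2) by (auto simp: half_plane_def Basis_vec_def axis_def)
  ultimately show ?thesis
    using r W d by (intro exI[of _ d]) auto
qed

lemma frechet_derivative_hp_open:
  assumes "hp_open S" "q \<in> S" "(f has_derivative f') (at q within S)"
  shows "frechet_derivative f (at q within S) = f'"
proof (rule frechet_derivative_unique_within[OF _ assms(3)])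
  show "(f has_derivative frechet_derivative f (at q within S)) (at q within S)"
    using assms(3) frechet_derivative_works differentiable_def by blast
  show "\<exists>d. 0 < \<bar>d\<bar> \<and> \<bar>d\<bar> < e \<and> q + d *\<^sub>R i \<in> S" if "i \<in> Basis" "e > 0" for i e
    using hp_open_unique_direction[OF assms(1,2) that] .
qed

text \<open>Continuity is imposed on each directional derivative instead of on the derivative as an
  operator. On the plane this amounts to the same, and the calculus rules can be checked one
  direction at a time.\<close>

definition C1_on :: "(real^2) set \<Rightarrow> (real^2 \<Rightarrow> 'b::real_normed_vector) \<Rightarrow> bool" where
  "C1_on S f \<longleftrightarrow> (\<forall>q\<in>S. f differentiable (at q within S)) \<and> (\<forall>v. continuous_on S (dir S v f))"

lemma C1_onI:
  assumes "hp_open S" "\<And>q. q \<in> S \<Longrightarrow> (f has_derivative f' q) (at q within S)"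
    "\<And>v. continuous_on S (\<lambda>q. f' q v)"
  shows "C1_on S f"
  unfolding C1_on_def
proof (intro conjI ballI allI)
  show "f differentiable (at q within S)" if "q \<in> S" for q
    using assms(2) that by (auto simp: differentiable_def)
  show "continuous_on S (dir S v f)" for v
    using assms(3)[of v]
    by (rule continuous_on_eq) (simp add: frechet_derivative_hp_open[OF assms(1) _ assms(2)])
qed

lemma C1_onD:
  "C1_on S f \<Longrightarrow> q \<in> S \<Longrightarrow> (f has_derivative frechet_derivative f (at q within S)) (at q within S)"
  by (simp add: C1_on_def frechet_derivative_works)

lemma C1_on_continuous_dir: "C1_on S f \<Longrightarrow> continuous_on S (dir S v f)"
  by (simp add: C1_on_def)

lemma C1_on_continuous: "C1_on S f \<Longrightarrow> continuous_on S f"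
  by (auto simp: C1_on_def continuous_on_eq_continuous_within intro: differentiable_imp_continuous_within)

lemma C1_on_linear_dir: "C1_on S f \<Longrightarrow> q \<in> S \<Longrightarrow> linear (\<lambda>v. dir S v f q)"
  using C1_onD has_derivative_linear by blast

lemma dir_openin:
  "openin (top_of_set S) S' \<Longrightarrow> q \<in> S' \<Longrightarrow> dir S' v f q = dir S v f q"
  by (simp add: at_within_openin)

lemma dir_cong:
  assumes "hp_open S" "q \<in> S" "g differentiable (at q within S)" "\<And>q. q \<in> S \<Longrightarrow> f q = g q"
  shows "dir S v f q = dir S v g q"
proof -
  have "(g has_derivative frechet_derivative g (at q within S)) (at q within S)"
    using assms(3) frechet_derivative_works by blast
  then have "(f has_derivative frechet_derivative g (at q within S)) (at q within S)"
    using assms(2,4) has_derivative_transform by blast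
  then show ?thesis
    using frechet_derivative_hp_open[OF assms(1,2)] by metis
qed

lemma C1_on_cong:
  assumes "hp_open S" "C1_on S g" "\<And>q. q \<in> S \<Longrightarrow> f q = g q"
  shows "C1_on S f"
proof (rule C1_onI[OF assms(1), where f' = "\<lambda>q. frechet_derivative g (at q within S)"])
  show "(f has_derivative frechet_derivative g (at q within S)) (at q within S)" if "q \<in> S" for q
    using C1_onD[OF assms(2) that] assms(3) that has_derivative_transform by blast
qed (use assms(2) in \<open>auto simp: C1_on_def\<close>)

text \<open>Passing to a relatively open subset leaves the filter \<open>at q within S\<close>
  unchanged, so derivatives may be computed in any such neighbourhood. Extensions by zero and bump
  functions are glued this way.\<close>

lemma C1_on_local:
  assumes "\<And>q. q \<in> S \<Longrightarrow> \<exists>S'. openin (top_of_set S) S' \<and> q \<in> S' \<and> C1_on S' f"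
  shows "C1_on S f"
  unfolding C1_on_def
proof (intro conjI ballI allI)
  show "f differentiable (at q within S)" if "q \<in> S" for q
    using assms[OF that] by (auto simp: C1_on_def at_within_openin)
  show "continuous_on S (dir S v f)" for v
    unfolding continuous_on_eq_continuous_within
  proof
    fix q assume "q \<in> S"
    then obtain S' where S': "openin (top_of_set S) S'" "q \<in> S'" "C1_on S' f"
      using assms by blast
    have "continuous_on S' (dir S v f)"
      using C1_on_continuous_dir[OF S'(3), of v]
      by (rule continuous_on_eq) (simp add: dir_openin[OF S'(1)])
    then have "continuous (at q within S') (dir S v f)"
      using S'(2) continuous_on_eq_continuous_within by blast
    then show "continuous (at q within S) (dir S v f)"
      by (simp add: at_within_openin[OF S'(1,2)])
  qed
qed

lemma C1_on_const: "hp_open S \<Longrightarrow> C1_on S (\<lambda>_. c)"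
  by (rule C1_onI[where f' = "\<lambda>_ _. 0"]) auto

text \<open>One product rule for a bounded bilinear \<open>pr\<close> serves products, inner
  products, scalar multiples and cross products alike.\<close>

lemma
  assumes "bounded_bilinear pr" "hp_open S" "C1_on S f" "C1_on S g"
  shows C1_on_bilinear: "C1_on S (\<lambda>q. pr (f q) (g q))"
    and dir_bilinear: "q \<in> S \<Longrightarrow> dir S v (\<lambda>q. pr (f q) (g q)) q = pr (f q) (dir S v g q) + pr (dir S v f q) (g q)"
proof -
  interpret bounded_bilinear "pr" by fact
  have *: "((\<lambda>q. pr (f q) (g q)) has_derivative (\<lambda>v. pr (f q) (dir S v g q) + pr (dir S v f q) (g q))) (at q within S)"
    if "q \<in> S" for q
    using FDERIV[OF C1_onD[OF assms(3) that] C1_onD[OF assms(4) that]] .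
  show "C1_on S (\<lambda>q. pr (f q) (g q))"
    using assms(3,4)
    by (intro C1_onI[OF assms(2) *] continuous_intros continuous_on C1_on_continuous C1_on_continuous_dir)
  show "q \<in> S \<Longrightarrow> dir S v (\<lambda>q. pr (f q) (g q)) q = pr (f q) (dir S v g q) + pr (dir S v f q) (g q)"
    by (simp add: frechet_derivative_hp_open[OF assms(2) _ *])
qed

lemmas C1_on_mult = C1_on_bilinear[OF bounded_bilinear_mult]
lemmas dir_mult = dir_bilinear[OF bounded_bilinear_mult]
lemmas C1_on_inner = C1_on_bilinear[OF bounded_bilinear_inner]
lemmas dir_inner = dir_bilinear[OF bounded_bilinear_inner]
lemmas C1_on_scaleR = C1_on_bilinear[OF bounded_bilinear_scaleR]
lemmas C1_on_cross = C1_on_bilinear[OF bilinear_cross[unfolded bilinear_conv_bounded_bilinear]]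
lemmas dir_cross = dir_bilinear[OF bilinear_cross[unfolded bilinear_conv_bounded_bilinear]]

lemma
  assumes "hp_open S" "\<And>i. i \<in> I \<Longrightarrow> C1_on S (f i)"
  shows C1_on_sum: "C1_on S (\<lambda>q. \<Sum>i\<in>I. f i q)"
    and dir_sum: "q \<in> S \<Longrightarrow> dir S v (\<lambda>q. \<Sum>i\<in>I. f i q) q = (\<Sum>i\<in>I. dir S v (f i) q)"
proof -
  have *: "((\<lambda>q. \<Sum>i\<in>I. f i q) has_derivative (\<lambda>v. \<Sum>i\<in>I. dir S v (f i) q)) (at q within S)"
    if "q \<in> S" for q
    using assms(2) that by (intro has_derivative_sum C1_onD)
  show "C1_on S (\<lambda>q. \<Sum>i\<in>I. f i q)"
    using assms(2) by (intro C1_onI[OF assms(1) *] continuous_on_sum C1_on_continuous_dir)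
  show "q \<in> S \<Longrightarrow> dir S v (\<lambda>q. \<Sum>i\<in>I. f i q) q = (\<Sum>i\<in>I. dir S v (f i) q)"
    by (simp add: frechet_derivative_hp_open[OF assms(1) _ *])
qed

lemma
  assumes "hp_open S" "C1_on S f" "\<And>q. q \<in> S \<Longrightarrow> (h has_real_derivative h' (f q)) (at (f q))"
    "continuous_on (f ` S) h'"
  shows C1_on_real_comp: "C1_on S (\<lambda>q. h (f q))"
proof -
  have *: "((\<lambda>q. h (f q)) has_derivative (\<lambda>v. h' (f q) * dir S v f q)) (at q within S)"
    if "q \<in> S" for q
    using has_derivative_compose[OF C1_onD[OF assms(2) that] assms(3)[OF that, unfolded has_field_derivative_def]] .
  show "C1_on S (\<lambda>q. h (f q))"
    using assms(2,4)
    by (intro C1_onI[OF assms(1) *] continuous_intros C1_on_continuous_dir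
        continuous_on_compose2[OF assms(4) C1_on_continuous]) auto
qed

lemma
  assumes "hp_open S" "C1_on S f" "\<And>q. q \<in> S \<Longrightarrow> f q > 0"
  shows C1_on_inverse: "C1_on S (\<lambda>q. inverse (f q :: real))"
    and C1_on_sqrt: "C1_on S (\<lambda>q. sqrt (f q))"
proof -
  have c: "continuous_on (f ` S) (\<lambda>t. - (inverse t ^ 2))" "continuous_on (f ` S) (\<lambda>t. inverse (sqrt t) / 2)"
    using assms(3) by (auto intro!: continuous_intros) (metis less_irrefl)+
  have d: "(inverse has_real_derivative (- (inverse (f q) ^ 2))) (at (f q))" if "q \<in> S" for q
    using assms(3)[OF that] by (auto intro!: derivative_eq_intros simp: power2_eq_square)
  show "C1_on S (\<lambda>q. inverse (f q :: real))"
    using C1_on_real_comp[OF assms(1,2) d c(1)] by simp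
  show "C1_on S (\<lambda>q. sqrt (f q))"
    using C1_on_real_comp[OF assms(1,2) DERIV_real_sqrt c(2)] assms(3) by simp
qed

lemma hp_open_subset: "hp_open S \<Longrightarrow> openin (top_of_set S) S' \<Longrightarrow> hp_open S'"
  using openin_trans by blast

section \<open>Smooth maps up to the boundary line through their local extensions\<close>

lemma smooth_on_localE:
  assumes "smooth_on S f" "p \<in> S"
  obtains W g where "open W" "p \<in> W" "\<And>k. Ck_on k g W" "\<And>x. x \<in> W \<inter> S \<Longrightarrow> f x = g x"
  using assms unfolding smooth_on_def by metis

lemma Ck_on_has_derivative:
  assumes "Ck_on (Suc k) g W" "x \<in> W"
  shows "(g has_derivative frechet_derivative g (at x)) (at x)"
  using assms frechet_derivative_works by auto

text \<open>By uniqueness of derivatives within \<open>S\<close>, every smooth local extension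
  \<open>g\<close> has the right derivative; at boundary points too the derivative of
  \<open>f\<close> is thus an ordinary derivative of \<open>g\<close>.\<close>

lemma smooth_on_dir_local:
  fixes f :: "real^2 \<Rightarrow> 'b::euclidean_space"
  assumes "hp_open S" "\<And>k. Ck_on k g W" "open W" "\<And>x. x \<in> W \<inter> S \<Longrightarrow> f x = g x" "q \<in> W \<inter> S"
  shows "(f has_derivative frechet_derivative g (at q)) (at q within S)"
    and "dir S v f q = frechet_derivative g (at q) v"
proof -
  have "(g has_derivative frechet_derivative g (at q)) (at q within S)"
    using Ck_on_has_derivative[of 0 g W q] assms by (metis IntE has_derivative_at_withinI)
  then have "(g has_derivative frechet_derivative g (at q)) (at q within S \<inter> W)"
    by (rule has_derivative_subset) auto
  then have "(f has_derivative frechet_derivative g (at q)) (at q within S \<inter> W)"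
    by (rule has_derivative_transform[rotated 2]) (use assms(4,5) in auto)
  then show *: "(f has_derivative frechet_derivative g (at q)) (at q within S)"
    using assms(3,5) at_within_openin[of S "S \<inter> W" q] by (auto simp: openin_open_Int)
  show "dir S v f q = frechet_derivative g (at q) v"
    using frechet_derivative_hp_open[OF assms(1) _ *] assms(5) by simp
qed

lemma smooth_on_imp_C1_on:
  fixes f :: "real^2 \<Rightarrow> 'b::euclidean_space"
  assumes "hp_open S" "smooth_on S f"
  shows "C1_on S f"
proof (rule C1_on_local)
  fix q assume "q \<in> S"
  then obtain W g where W: "open W" "q \<in> W" "\<And>k. Ck_on k g W" "\<And>x. x \<in> W \<inter> S \<Longrightarrow> f x = g x"
    using smooth_on_localE[OF assms(2)] by metis
  have op: "openin (top_of_set S) (S \<inter> W)"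
    using W(1) by (simp add: openin_open_Int)
  have "C1_on (S \<inter> W) f"
  proof (rule C1_onI[OF hp_open_subset[OF assms(1) op], where f' = "\<lambda>q. frechet_derivative g (at q)"])
    show "(f has_derivative frechet_derivative g (at q)) (at q within S \<inter> W)" if "q \<in> S \<inter> W" for q
      using smooth_on_dir_local(1)[OF assms(1) W(3,1,4), of q] that at_within_openin[OF op that] by auto
    show "continuous_on (S \<inter> W) (\<lambda>q. frechet_derivative g (at q) v)" for v
    proof -
      have "continuous_on W (\<lambda>q. frechet_derivative g (at q) v)"
        using W(3)[of "Suc 0"] by simp
      then show ?thesis by (rule continuous_on_subset) auto
    qed
  qed
  then show "\<exists>S'. openin (top_of_set S) S' \<and> q \<in> S' \<and> C1_on S' f"
    using op \<open>q \<in> S\<close> W(2) by blast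
qed

text \<open>Differentiating a local extension of \<open>f\<close> gives a local extension of its
  derivative, so derivatives within \<open>S\<close> can be iterated up to the boundary
  line.\<close>

lemma smooth_on_dir:
  fixes f :: "real^2 \<Rightarrow> 'b::euclidean_space"
  assumes "hp_open S" "smooth_on S f"
  shows "smooth_on S (dir S v f)"
  unfolding smooth_on_def
proof
  fix q assume "q \<in> S"
  then obtain W g where W: "open W" "q \<in> W" "\<And>k. Ck_on k g W" "\<And>x. x \<in> W \<inter> S \<Longrightarrow> f x = g x"
    using smooth_on_localE[OF assms(2)] by metis
  have "Ck_on k (\<lambda>x. frechet_derivative g (at x) v) W" for k
    using W(3)[of "Suc k"] by simp
  then show "\<exists>U g. open U \<and> q \<in> U \<and> (\<forall>k. Ck_on k g U) \<and> (\<forall>x\<in>U \<inter> S. g x = dir S v f x)"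
    using W smooth_on_dir_local(2)[OF assms(1) W(3,1,4)]
    by (intro exI[of _ W] exI[of _ "\<lambda>x. frechet_derivative g (at x) v"]) auto
qed

lemma smooth_on_dir_dir_local:
  fixes f :: "real^2 \<Rightarrow> 'b::euclidean_space"
  assumes "hp_open S" "\<And>k. Ck_on k g W" "open W" "\<And>x. x \<in> W \<inter> S \<Longrightarrow> f x = g x" "q \<in> W \<inter> S"
  shows "dir S u (dir S v f) q = frechet_derivative (\<lambda>x. frechet_derivative g (at x) v) (at q) u"
proof (rule smooth_on_dir_local(2)[OF assms(1) _ assms(3) _ assms(5)])
  show "Ck_on k (\<lambda>x. frechet_derivative g (at x) v) W" for k
    using assms(2)[of "Suc k"] by simp
qed (use smooth_on_dir_local(2)[OF assms(1-4)] in auto)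

subsection \<open>Symmetry of second derivatives\<close>

text \<open>First half of the proof of Schwarz's theorem: the mean value theorem is applied to the
  increment \<open>\<psi>\<close> in direction \<open>u\<close>, then to the derivative along
  \<open>u\<close> in direction \<open>v\<close>.\<close>

lemma second_difference_mean_value:
  fixes f :: "'a::real_normed_vector \<Rightarrow> real"
  assumes W: "\<And>s t. 0 \<le> s \<Longrightarrow> s \<le> h \<Longrightarrow> 0 \<le> t \<Longrightarrow> t \<le> h \<Longrightarrow> q + s *\<^sub>R u + t *\<^sub>R v \<in> W"
    and h: "h > 0"
    and D: "\<And>x. x \<in> W \<Longrightarrow> (f has_derivative D x) (at x)"
    and Du: "\<And>x. x \<in> W \<Longrightarrow> ((\<lambda>x. D x u) has_derivative Du x) (at x)"
  shows "\<exists>s\<in>{0<..<h}. \<exists>t\<in>{0<..<h}.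
    f (q + h *\<^sub>R u + h *\<^sub>R v) - f (q + h *\<^sub>R u) - f (q + h *\<^sub>R v) + f q = h\<^sup>2 * Du (q + s *\<^sub>R u + t *\<^sub>R v) v"
proof -
  have line: "((\<lambda>r. g (p + r *\<^sub>R w)) has_real_derivative g' (p + r *\<^sub>R w) w) (at r)"
    if "(g has_derivative g' (p + r *\<^sub>R w)) (at (p + r *\<^sub>R w))" for g :: "'a \<Rightarrow> real" and g' p w r
  proof -
    have lin: "linear (g' (p + r *\<^sub>R w))"
      using that has_derivative_linear by blast
    have "((\<lambda>r. p + r *\<^sub>R w) has_derivative (\<lambda>d. d *\<^sub>R w)) (at r)"
      by (auto intro!: derivative_eq_intros)
    from has_derivative_compose[OF this that]
    show ?thesis
      by (simp add: has_field_derivative_def linear_cmul[OF lin] mult_commute_abs)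
  qed
  define \<psi> where "\<psi> s = f (q + h *\<^sub>R v + s *\<^sub>R u) - f (q + s *\<^sub>R u)" for s
  have "(\<psi> has_real_derivative D (q + h *\<^sub>R v + s *\<^sub>R u) u - D (q + s *\<^sub>R u) u) (at s)" if "0 \<le> s" "s \<le> h" for s
    unfolding \<psi>_def using W[of s h] W[of s 0] that h
    by (intro DERIV_diff line D) (simp_all add: add_ac)
  from MVT2[OF h this] obtain s where s: "0 < s" "s < h"
    "\<psi> h - \<psi> 0 = (h - 0) * (D (q + h *\<^sub>R v + s *\<^sub>R u) u - D (q + s *\<^sub>R u) u)"
    by blast
  have "((\<lambda>t. D (q + s *\<^sub>R u + t *\<^sub>R v) u) has_real_derivative Du (q + s *\<^sub>R u + t *\<^sub>R v) v) (at t)"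
    if "0 \<le> t" "t \<le> h" for t
    using W[of s t] that s by (intro line[where g = "\<lambda>x. D x u"] Du) simp
  from MVT2[OF h this] obtain t where t: "0 < t" "t < h"
    "D (q + s *\<^sub>R u + h *\<^sub>R v) u - D (q + s *\<^sub>R u + 0 *\<^sub>R v) u = (h - 0) * Du (q + s *\<^sub>R u + t *\<^sub>R v) v"
    by blast
  have "\<psi> h - \<psi> 0 = h\<^sup>2 * Du (q + s *\<^sub>R u + t *\<^sub>R v) v"
    using s(3) t(3) by (simp add: add_ac power2_eq_square)
  then have "f (q + h *\<^sub>R u + h *\<^sub>R v) - f (q + h *\<^sub>R u) - f (q + h *\<^sub>R v) + f q = h\<^sup>2 * Du (q + s *\<^sub>R u + t *\<^sub>R v) v"
    by (simp add: \<psi>_def add_ac)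
  then show ?thesis
    using s t by (intro bexI[of _ s] bexI[of _ t]) auto
qed

text \<open>The second difference is symmetric in \<open>u\<close> and \<open>v\<close>, so
  arbitrarily near \<open>q\<close> some value of one mixed derivative equals some value of the
  other; continuity does the rest.\<close>

lemma symmetric_second_derivative_real:
  fixes f :: "'a::real_normed_vector \<Rightarrow> real"
  assumes "open W" "q \<in> W"
    and D: "\<And>x. x \<in> W \<Longrightarrow> (f has_derivative D x) (at x)"
    and Du: "\<And>x. x \<in> W \<Longrightarrow> ((\<lambda>x. D x u) has_derivative Du x) (at x)"
    and Dv: "\<And>x. x \<in> W \<Longrightarrow> ((\<lambda>x. D x v) has_derivative Dv x) (at x)"
    and cont: "continuous_on W (\<lambda>x. Du x v)" "continuous_on W (\<lambda>x. Dv x u)"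
  shows "Du q v = Dv q u"
proof (rule ccontr)
  assume ne: "Du q v \<noteq> Dv q u"
  \<comment> \<open>Half the supposed gap: one number cannot lie strictly within \<open>e\<close> of
    both mixed derivatives at \<open>q\<close>.\<close>
  define e where "e = \<bar>Du q v - Dv q u\<bar> / 2"
  have e: "e > 0" using ne by (simp add: e_def)
  obtain d1 where d1: "d1 > 0" "\<And>x. x \<in> W \<Longrightarrow> dist x q < d1 \<Longrightarrow> dist (Du x v) (Du q v) < e"
    using cont(1) assms(2) e unfolding continuous_on_iff by metis
  obtain d2 where d2: "d2 > 0" "\<And>x. x \<in> W \<Longrightarrow> dist x q < d2 \<Longrightarrow> dist (Dv x u) (Dv q u) < e"
    using cont(2) assms(2) e unfolding continuous_on_iff by metis
  obtain d3 where d3: "d3 > 0" "ball q d3 \<subseteq> W"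
    using assms(1,2) open_contains_ball by blast
  define d where "d = min d1 (min d2 d3)"
  have d: "d > 0" "d \<le> d1" "d \<le> d2" "d \<le> d3" using d1 d2 d3 by (auto simp: d_def)
  \<comment> \<open>The summand 1 keeps the denominator positive when \<open>u\<close> and
    \<open>v\<close> vanish; the halving puts the whole parallelogram strictly within
    \<open>d\<close> of \<open>q\<close>.\<close>
  define h where "h = d / 2 / (norm u + norm v + 1)"
  have pos: "norm u + norm v + 1 > 0" by (simp add: add_nonneg_pos)
  have h: "h > 0" using d pos by (simp add: h_def)
  have near: "dist (q + s *\<^sub>R u + t *\<^sub>R v) q < d" if "0 \<le> s" "s \<le> h" "0 \<le> t" "t \<le> h" for s t
  proof -
    have "dist (q + s *\<^sub>R u + t *\<^sub>R v) q = norm (s *\<^sub>R u + t *\<^sub>R v)"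
      by (simp add: dist_norm add.assoc)
    also have "\<dots> \<le> s * norm u + t * norm v"
      using that by (metis abs_of_nonneg norm_scaleR norm_triangle_ineq)
    also have "\<dots> \<le> h * norm u + h * norm v"
      using that by (intro add_mono mult_right_mono) auto
    also have "\<dots> \<le> h * (norm u + norm v + 1)"
      using h by (simp add: algebra_simps)
    also have "\<dots> = d / 2"
      unfolding h_def using pos by (intro nonzero_eq_divide_eq[THEN iffD1]) auto
    also have "\<dots> < d" using d by simp
    finally show ?thesis .
  qed
  have inW: "q + s *\<^sub>R u + t *\<^sub>R v \<in> W" if "0 \<le> s" "s \<le> h" "0 \<le> t" "t \<le> h" for s t
    using near[OF that] d d3 by (auto simp: dist_commute)
  have inW': "q + s *\<^sub>R v + t *\<^sub>R u \<in> W" if "0 \<le> s" "s \<le> h" "0 \<le> t" "t \<le> h" for s t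
    using inW[OF that(3,4,1,2)] by (simp add: add_ac)
  obtain s t where st: "s \<in> {0<..<h}" "t \<in> {0<..<h}" 
    "f (q + h *\<^sub>R u + h *\<^sub>R v) - f (q + h *\<^sub>R u) - f (q + h *\<^sub>R v) + f q = h\<^sup>2 * Du (q + s *\<^sub>R u + t *\<^sub>R v) v"
    using second_difference_mean_value[OF inW h D Du] by blast
  obtain s' t' where st': "s' \<in> {0<..<h}" "t' \<in> {0<..<h}" 
    "f (q + h *\<^sub>R v + h *\<^sub>R u) - f (q + h *\<^sub>R v) - f (q + h *\<^sub>R u) + f q = h\<^sup>2 * Dv (q + s' *\<^sub>R v + t' *\<^sub>R u) u"
    using second_difference_mean_value[OF inW' h D Dv] by blast
  have "q + h *\<^sub>R v + h *\<^sub>R u = q + h *\<^sub>R u + h *\<^sub>R v" by simp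
  then have "f (q + h *\<^sub>R v + h *\<^sub>R u) = f (q + h *\<^sub>R u + h *\<^sub>R v)" by (rule arg_cong)
  then have "h\<^sup>2 * Du (q + s *\<^sub>R u + t *\<^sub>R v) v = h\<^sup>2 * Dv (q + s' *\<^sub>R v + t' *\<^sub>R u) u"
    using st(3) st'(3) by linarith
  moreover have "q + s' *\<^sub>R v + t' *\<^sub>R u = q + t' *\<^sub>R u + s' *\<^sub>R v" by simp
  ultimately have "Du (q + s *\<^sub>R u + t *\<^sub>R v) v = Dv (q + t' *\<^sub>R u + s' *\<^sub>R v) u"
    using h by simp
  moreover have "dist (Du (q + s *\<^sub>R u + t *\<^sub>R v) v) (Du q v) < e"
    using d1(2) inW near st d by (smt (verit, best) greaterThanLessThan_iff)
  moreover have "dist (Dv (q + t' *\<^sub>R u + s' *\<^sub>R v) u) (Dv q u) < e"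
    using d2(2) inW near st' d by (smt (verit, best) greaterThanLessThan_iff)
  ultimately show False
    unfolding e_def dist_real_def by argo
qed

lemma Ck_on_symmetric:
  fixes g :: "'a::euclidean_space \<Rightarrow> 'b::euclidean_space"
  assumes "open W" "q \<in> W" "Ck_on (Suc (Suc 0)) g W"
  shows "frechet_derivative (\<lambda>x. frechet_derivative g (at x) v) (at q) u =
    frechet_derivative (\<lambda>x. frechet_derivative g (at x) u) (at q) v"
proof (rule euclidean_eqI)
  fix c :: 'b
  have 1: "((\<lambda>x. g x \<bullet> c) has_derivative (\<lambda>w. frechet_derivative g (at x) w \<bullet> c)) (at x)" if "x \<in> W" for x
    using assms(3) that by (intro has_derivative_inner_left) (simp flip: frechet_derivative_works)
  have 2: "((\<lambda>x. frechet_derivative g (at x) w \<bullet> c) has_derivative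
      (\<lambda>w'. frechet_derivative (\<lambda>x. frechet_derivative g (at x) w) (at x) w' \<bullet> c)) (at x)" if "x \<in> W" for x w
    using assms(3) that by (intro has_derivative_inner_left) (simp flip: frechet_derivative_works)
  have 3: "continuous_on W (\<lambda>x. frechet_derivative (\<lambda>x. frechet_derivative g (at x) w) (at x) w' \<bullet> c)" for w w'
    using assms(3) by (intro continuous_intros) simp
  show "frechet_derivative (\<lambda>x. frechet_derivative g (at x) v) (at q) u \<bullet> c =
    frechet_derivative (\<lambda>x. frechet_derivative g (at x) u) (at q) v \<bullet> c"
    using symmetric_second_derivative_real[OF assms(1,2) 1 2 2 3 3] by blast
qed

lemma smooth_on_dir_commute:
  fixes f :: "real^2 \<Rightarrow> 'b::euclidean_space"
  assumes "hp_open S" "smooth_on S f" "q \<in> S"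
  shows "dir S u (dir S v f) q = dir S v (dir S u f) q"
proof -
  obtain W g where W: "open W" "q \<in> W" "\<And>k. Ck_on k g W" "\<And>x. x \<in> W \<inter> S \<Longrightarrow> f x = g x"
    using smooth_on_localE[OF assms(2,3)] by metis
  then show ?thesis
    using smooth_on_dir_dir_local[OF assms(1) W(3,1,4), of q] Ck_on_symmetric[OF W(1,2,3)] assms(3) by simp
qed

section \<open>The divergence theorem on the half-plane\<close>

definition vec2 :: "real \<Rightarrow> real \<Rightarrow> real^2" where
  "vec2 t y = vector [t, y]"

lemma vec2_nth [simp]: "vec2 t y $ 1 = t" "vec2 t y $ 2 = y"
  by (simp_all add: vec2_def)

lemma vec2_eq: "vec2 t y = t *\<^sub>R e\<^sub>1 + y *\<^sub>R e\<^sub>2"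
  by (simp add: vec_eq_iff forall_2 axis_def)

lemma vec2_collapse [simp]: "vec2 (q $ 1) (q $ 2) = q"
  by (simp add: vec_eq_iff forall_2)

lemma vec2_in_half_plane [simp]: "vec2 t y \<in> half_plane \<longleftrightarrow> 0 \<le> y"
  by (simp add: half_plane_def)

lemma continuous_on_vec2 [continuous_intros]:
  "continuous_on X f \<Longrightarrow> continuous_on X g \<Longrightarrow> continuous_on X (\<lambda>x. vec2 (f x) (g x))"
  unfolding vec2_eq by (intro continuous_intros)

lemma cbox_vec2: "q \<in> cbox (vec2 a c) (vec2 b d) \<longleftrightarrow> q $ 1 \<in> {a..b} \<and> q $ 2 \<in> {c..d}"
  by (auto simp: mem_box_cart forall_2)

text \<open>Iterated integrals are taken over pairs. The coordinate map sends boxes to boxes of the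
  same content, so integrals carry over from \<open>real^2\<close> to
  \<open>real \<times> real\<close>.\<close>

lemma has_integral_vec2:
  fixes f :: "real^2 \<Rightarrow> real"
  assumes "(f has_integral I) (cbox (vec2 a c) (vec2 b d))"
  shows "((\<lambda>(t, y). f (vec2 t y)) has_integral I) (cbox (a, c) (b, d))"
proof -
  define g where "g q = (q $ 1, q $ 2)" for q :: "real^2"
  define h where "h = (\<lambda>(t, y). vec2 t y)"
  have hb: "h ` cbox (a, c) (b, d) = cbox (vec2 a c) (vec2 b d)" for a b c d
  proof (intro equalityI subsetI)
    fix q assume "q \<in> cbox (vec2 a c) (vec2 b d)"
    then show "q \<in> h ` cbox (a, c) (b, d)"
      by (intro image_eqI[of _ _ "(q $ 1, q $ 2)"]) (auto simp: h_def cbox_vec2 cbox_Pair_eq)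
  qed (auto simp: h_def cbox_vec2 cbox_Pair_eq)
  have gb: "g ` cbox (vec2 a c) (vec2 b d) = cbox (a, c) (b, d)" for a b c d
  proof -
    have "g ` cbox (vec2 a c) (vec2 b d) = (g \<circ> h) ` cbox (a, c) (b, d)"
      by (simp flip: hb add: image_comp)
    also have "g \<circ> h = id" by (auto simp: g_def h_def)
    finally show ?thesis by simp
  qed
  have "((\<lambda>p. f (h p)) has_integral (1 / 1) *\<^sub>R I) (g ` cbox (vec2 a c) (vec2 b d))"
  proof (rule has_integral_twiddle[of 1 g h, OF _ _ _ _ _ _ _ assms])
    show "continuous (at p) h" for p
      unfolding h_def case_prod_unfold vec2_eq by (intro continuous_intros)
    show "\<exists>w z. g ` cbox u v = cbox w z" for u v
      using gb[of "u $ 1" "u $ 2" "v $ 1" "v $ 2"] by auto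
    show "\<exists>w z. h ` cbox u v = cbox w z" for u v :: "real \<times> real"
      by (metis hb surj_pair)
    show "measure lborel (h ` cbox u v) = 1 * measure lborel (cbox u v)" for u v :: "real \<times> real"
    proof -
      obtain a c b d where uv: "u = (a, c)" "v = (b, d)" by fastforce
      show ?thesis
      proof (cases "a \<le> b \<and> c \<le> d")
        case True
        then have "cbox (vec2 a c) (vec2 b d) \<noteq> {}"
          by (auto simp: interval_ne_empty_cart forall_2)
        from content_cbox_cart[OF this] True show ?thesis
          by (simp add: uv hb UNIV_2 content_Pair content_real)
      next
        case False
        then have "cbox (vec2 a c) (vec2 b d) = {}"
          using interval_ne_empty_cart(1)[of "vec2 a c" "vec2 b d"] by (auto simp: forall_2)
        moreover have "cbox u v = {}"
          using False by (auto simp: uv cbox_Pair_eq)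
        ultimately show ?thesis by (simp add: uv hb)
      qed
    qed
  qed (auto simp: g_def h_def)
  then show ?thesis
    by (simp add: gb h_def case_prod_unfold)
qed

text \<open>A horizontal line stays in the half-plane, so any set of parameters is allowed; a
  vertical line leaves it below 0, hence the derivative within \<open>{0..b}\<close>, which is
  one-sided at the boundary.\<close>

lemma dir_line:
  assumes "C1_on half_plane f" "vec2 t y \<in> half_plane"
  shows "((\<lambda>t. f (vec2 t y)) has_vector_derivative dir half_plane e\<^sub>1 f (vec2 t y)) (at t within X)"
    and "((\<lambda>y. f (vec2 t y)) has_vector_derivative dir half_plane e\<^sub>2 f (vec2 t y)) (at y within {0..b})"
proof -
  have sub: "(\<lambda>t. vec2 t y) ` X \<subseteq> half_plane" "vec2 t ` {0..b} \<subseteq> half_plane"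
    using assms(2) by auto
  have lin: "linear (frechet_derivative f (at (vec2 t y) within half_plane))"
    using C1_on_linear_dir[OF assms] by (simp add: eta_contract_eq)
  have 1: "((\<lambda>t. vec2 t y) has_derivative (\<lambda>d. d *\<^sub>R e\<^sub>1)) (at t within X)"
    and 2: "((\<lambda>y. vec2 t y) has_derivative (\<lambda>d. d *\<^sub>R e\<^sub>2)) (at y within {0..b})"
    unfolding vec2_eq by (auto intro!: derivative_eq_intros)
  show "((\<lambda>t. f (vec2 t y)) has_vector_derivative dir half_plane e\<^sub>1 f (vec2 t y)) (at t within X)"
    using has_derivative_in_compose[OF 1 has_derivative_subset[OF C1_onD[OF assms] sub(1)]]
    by (simp add: has_vector_derivative_def linear_cmul[OF lin])
  show "((\<lambda>y. f (vec2 t y)) has_vector_derivative dir half_plane e\<^sub>2 f (vec2 t y)) (at y within {0..b})"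
    using has_derivative_in_compose[OF 2 has_derivative_subset[OF C1_onD[OF assms] sub(2)]]
    by (simp add: has_vector_derivative_def linear_cmul[OF lin])
qed

text \<open>\<open>S\<close> and \<open>half_plane - K\<close> are relatively open and cover the
  half-plane. On the first \<open>g\<close> is \<open>f\<close>, on the second it is zero, and being
  of class C1 is a local property.\<close>

lemma C1_on_extend_zero:
  assumes S: "hp_open S" and K: "compact K" "K \<subseteq> S" and f: "C1_on S f" and 0: "\<forall>q\<in>S - K. f q = 0"
  defines "g \<equiv> \<lambda>q. if q \<in> S then f q else 0"
  shows "C1_on half_plane g"
    and "q \<in> S \<Longrightarrow> dir half_plane v g q = dir S v f q"
    and "q \<in> half_plane - K \<Longrightarrow> dir half_plane v g q = 0"
proof -
  have gS: "C1_on S g"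
    by (rule C1_on_cong[OF S f]) (simp add: g_def)
  have op: "hp_open (half_plane - K)"
    using K(1) by (metis compact_imp_closed Diff_eq open_Compl openin_open_Int)
  have g0: "\<And>q. q \<in> half_plane - K \<Longrightarrow> g q = 0"
    using 0 by (auto simp: g_def)
  have gK: "C1_on (half_plane - K) g"
    by (rule C1_on_cong[OF op C1_on_const[OF op] g0])
  show "C1_on half_plane g"
  proof (rule C1_on_local)
    fix q assume "q \<in> half_plane"
    then show "\<exists>S'. hp_open S' \<and> q \<in> S' \<and> C1_on S' g"
      using S op gS gK K(2) by (cases "q \<in> K") blast+
  qed
  show "dir half_plane v g q = dir S v f q" if "q \<in> S"
  proof -
    have "dir S v g q = dir S v f q"
      using f that by (intro dir_cong[OF S]) (auto simp: C1_on_def g_def)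
    then show ?thesis using dir_openin[OF S that] by metis
  qed
  show "dir half_plane v g q = 0" if "q \<in> half_plane - K"
  proof -
    have "dir half_plane v g q = dir (half_plane - K) v g q"
      by (rule dir_openin[OF op that, symmetric])
    also have "\<dots> = dir (half_plane - K) v (\<lambda>_. 0) q"
      by (rule dir_cong[OF op that]) (use g0 in auto)
    also have "\<dots> = 0"
      by (simp add: frechet_derivative_hp_open[OF op that has_derivative_const])
    finally show ?thesis .
  qed
qed

lemma compact_support_absolutely_integrable:
  fixes f :: "'a::euclidean_space \<Rightarrow> real"
  assumes "compact K" "K \<subseteq> S" "continuous_on S f" "\<forall>q\<in>S - K. f q = 0"
  shows "f absolutely_integrable_on S"
proof -
  have "f absolutely_integrable_on K"
    using borel_integrable_compact[OF assms(1) continuous_on_subset[OF assms(3,2)]]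
    by (simp add: set_integrable_def integrable_completion borel_measurable_integrable)
  then have "(\<lambda>x. if x \<in> K then f x else 0) absolutely_integrable_on UNIV"
    by (simp add: absolutely_integrable_restrict_UNIV)
  moreover have "(\<lambda>x. if x \<in> K then f x else 0) = (\<lambda>x. if x \<in> S then f x else 0)"
    by (intro ext) (use assms(2,4) in auto)
  ultimately show ?thesis
    by (simp add: absolutely_integrable_restrict_UNIV)
qed

text \<open>The components are extended by zero and integrated over a box standing on the boundary
  line. By the fundamental theorem in each variable all sides but the bottom one contribute nothing;
  at the bottom the outer normal is \<open>- e\<^sub>2\<close>, which accounts for the sign.\<close>

theorem half_plane_divergence:
  fixes F\<^sub>1 F\<^sub>2 :: "real^2 \<Rightarrow> real"
  assumes S: "hp_open S" and K: "compact K" "K \<subseteq> S" and C1: "C1_on S F\<^sub>1" "C1_on S F\<^sub>2"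
    and 0: "\<forall>q\<in>S - K. F\<^sub>1 q = 0" "\<forall>q\<in>S - K. F\<^sub>2 q = 0"
  shows "integral S (\<lambda>q. dir S e\<^sub>1 F\<^sub>1 q + dir S e\<^sub>2 F\<^sub>2 q) = - integral {t. vec2 t 0 \<in> S} (\<lambda>t. F\<^sub>2 (vec2 t 0))"
proof -
  define H where "H = half_plane"
  define G\<^sub>1 where "G\<^sub>1 = (\<lambda>q. if q \<in> S then F\<^sub>1 q else 0)"
  define G\<^sub>2 where "G\<^sub>2 = (\<lambda>q. if q \<in> S then F\<^sub>2 q else 0)"
  note ext1 = C1_on_extend_zero[OF S K C1(1) 0(1), folded G\<^sub>1_def H_def]
  note ext2 = C1_on_extend_zero[OF S K C1(2) 0(2), folded G\<^sub>2_def H_def]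
  have SH: "S \<subseteq> H" using S openin_imp_subset H_def by blast
  \<comment> \<open>The bound is strict, so \<open>K\<close> misses the left, right and upper sides
    of the box \<open>Q\<close>.\<close>
  obtain R where R: "R > 0" "\<And>q. q \<in> K \<Longrightarrow> norm q < R"
    using compact_imp_bounded[OF K(1)] bounded_pos_less by metis
  define Q where "Q = cbox (vec2 (-R) 0) (vec2 R R)"
  have bound: "\<bar>q $ 1\<bar> < R" "\<bar>q $ 2\<bar> < R" if "q \<in> K" for q
    using R(2)[OF that] component_le_norm_cart[of q 1] component_le_norm_cart[of q 2] by auto
  have QH: "Q \<subseteq> H" by (auto simp: Q_def H_def half_plane_def cbox_vec2)
  have KQ: "K \<subseteq> Q"
  proof
    fix q assume "q \<in> K"
    then show "q \<in> Q" using bound[of q] K(2) SH by (auto simp: Q_def cbox_vec2 H_def half_plane_def)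
  qed
  have out: "G\<^sub>1 q = 0" "G\<^sub>2 q = 0" if "q \<notin> K" for q
    using 0 that by (auto simp: G\<^sub>1_def G\<^sub>2_def)
  define A where "A q = dir H e\<^sub>1 G\<^sub>1 q" for q
  define B where "B q = dir H e\<^sub>2 G\<^sub>2 q" for q
  have cont: "continuous_on H A" "continuous_on H B"
    using C1_on_continuous_dir[OF ext1(1)] C1_on_continuous_dir[OF ext2(1)] by (auto simp: A_def B_def)
  have contQ: "continuous_on Q A" "continuous_on Q B"
    using cont QH continuous_on_subset by blast+
  have AB0: "A q = 0" "B q = 0" if "q \<in> H - K" for q
    using ext1(3)[OF that] ext2(3)[OF that] by (auto simp: A_def B_def)
  have "integral S (\<lambda>q. dir S e\<^sub>1 F\<^sub>1 q + dir S e\<^sub>2 F\<^sub>2 q) = integral S (\<lambda>q. A q + B q)"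
    using ext1(2) ext2(2) by (intro integral_cong) (simp add: A_def B_def)
  also have "\<dots> = integral Q (\<lambda>q. A q + B q)"
  proof -
    have "integral S (\<lambda>q. A q + B q) = integral K (\<lambda>q. A q + B q)"
      by (rule integral_spike_set) (rule negligible_subset[OF negligible_empty], use AB0 SH K in force)+
    also have "\<dots> = integral Q (\<lambda>q. A q + B q)"
      by (rule integral_spike_set) (rule negligible_subset[OF negligible_empty], use AB0 QH KQ in force)+
    finally show ?thesis .
  qed
  also have "\<dots> = integral Q A + integral Q B"
    using contQ by (intro integral_add) (auto simp: Q_def intro: integrable_continuous)
  also have "integral Q A = 0"
  proof -
    have c: "continuous_on (cbox (-R, 0) (R, R)) (\<lambda>(t, y). A (vec2 t y))"
      unfolding case_prod_unfold
      by (intro continuous_on_compose2[OF cont(1)] continuous_intros) (auto simp: H_def mem_Times_iff cbox_Pair_eq)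
    have "(A has_integral integral Q A) Q"
      using contQ(1) unfolding Q_def by (intro integrable_integral integrable_continuous)
    from has_integral_vec2[OF this[unfolded Q_def]]
    have "integral Q A = integral (cbox (-R, 0) (R, R)) (\<lambda>(t, y). A (vec2 t y))"
      unfolding Q_def by (simp add: integral_unique)
    also have "\<dots> = integral (cbox (-R) R) (\<lambda>t. integral (cbox 0 R) (\<lambda>y. A (vec2 t y)))"
      using integral_prod_continuous[OF c] by simp
    also have "\<dots> = integral (cbox 0 R) (\<lambda>y. integral (cbox (-R) R) (\<lambda>t. A (vec2 t y)))"
      using integral_swap_continuous[OF c] .
    also have "\<dots> = integral (cbox 0 R) (\<lambda>y. 0)"
    proof (rule integral_cong)
      fix y assume y: "y \<in> cbox 0 R"
      have "((\<lambda>t. A (vec2 t y)) has_integral G\<^sub>1 (vec2 R y) - G\<^sub>1 (vec2 (-R) y)) {-R..R}"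
        unfolding A_def using y R(1) dir_line(1)[OF ext1(1)[unfolded H_def]]
        by (intro fundamental_theorem_of_calculus) (auto simp: H_def)
      moreover have "G\<^sub>1 (vec2 R y) = 0" "G\<^sub>1 (vec2 (-R) y) = 0"
        by (rule out(1), use bound(1) in force)+
      ultimately show "integral (cbox (-R) R) (\<lambda>t. A (vec2 t y)) = 0"
        by (simp add: integral_unique)
    qed
    finally show ?thesis by simp
  qed
  also have "integral Q B = - integral {t. vec2 t 0 \<in> S} (\<lambda>t. F\<^sub>2 (vec2 t 0))"
  proof -
    have c: "continuous_on (cbox (-R, 0) (R, R)) (\<lambda>(t, y). B (vec2 t y))"
      unfolding case_prod_unfold
      by (intro continuous_on_compose2[OF cont(2)] continuous_intros) (auto simp: H_def mem_Times_iff cbox_Pair_eq)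
    have "(B has_integral integral Q B) Q"
      using contQ(2) unfolding Q_def by (intro integrable_integral integrable_continuous)
    from has_integral_vec2[OF this[unfolded Q_def]]
    have "integral Q B = integral (cbox (-R, 0) (R, R)) (\<lambda>(t, y). B (vec2 t y))"
      unfolding Q_def by (simp add: integral_unique)
    also have "\<dots> = integral (cbox (-R) R) (\<lambda>t. integral (cbox 0 R) (\<lambda>y. B (vec2 t y)))"
      using integral_prod_continuous[OF c] by simp
    also have "\<dots> = integral (cbox (-R) R) (\<lambda>t. - G\<^sub>2 (vec2 t 0))"
    proof (rule integral_cong)
      fix t
      have "((\<lambda>y. B (vec2 t y)) has_integral G\<^sub>2 (vec2 t R) - G\<^sub>2 (vec2 t 0)) {0..R}"
        unfolding B_def using R(1) dir_line(2)[OF ext2(1)[unfolded H_def]]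
        by (intro fundamental_theorem_of_calculus) (auto simp: H_def)
      moreover have "G\<^sub>2 (vec2 t R) = 0"
        by (rule out(2), use bound(2) in force)
      ultimately show "integral (cbox 0 R) (\<lambda>y. B (vec2 t y)) = - G\<^sub>2 (vec2 t 0)"
        by (simp add: integral_unique)
    qed
    also have "\<dots> = - integral (cbox (-R) R) (\<lambda>t. G\<^sub>2 (vec2 t 0))"
      by simp
    also have "integral (cbox (-R) R) (\<lambda>t. G\<^sub>2 (vec2 t 0)) = integral {t. vec2 t 0 \<in> S} (\<lambda>t. G\<^sub>2 (vec2 t 0))"
    proof -
      have "t \<in> cbox (-R) R" if "G\<^sub>2 (vec2 t 0) \<noteq> 0" for t
        using that out(2) bound(1)[of "vec2 t 0"] by fastforce
      moreover have "vec2 t 0 \<in> S" if "G\<^sub>2 (vec2 t 0) \<noteq> 0" for t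
        using that by (auto simp: G\<^sub>2_def split: if_splits)
      ultimately show ?thesis
        by (intro integral_spike_set negligible_subset[OF negligible_empty]) auto
    qed
    also have "\<dots> = integral {t. vec2 t 0 \<in> S} (\<lambda>t. F\<^sub>2 (vec2 t 0))"
      by (rule integral_cong) (simp add: G\<^sub>2_def)
    finally show ?thesis by simp
  qed
  finally show ?thesis by simp
qed

section \<open>Geometry of a parametrized surface\<close>

lemma det_char_poly_2:
  fixes A :: "real^2^2"
  shows "det (mat k - A) = k\<^sup>2 - (A $ 1 $ 1 + A $ 2 $ 2) * k + det A"
  by (simp add: det_2 mat_def power2_eq_square algebra_simps)

lemma matrix_inv_eqI:
  fixes A B :: "real^'n^'n"
  assumes "A ** B = mat 1" "B ** A = mat 1"
  shows "matrix_inv A = B"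
proof -
  have "A ** matrix_inv A = mat 1 \<and> matrix_inv A ** A = mat 1"
    unfolding matrix_inv_def by (rule someI[of _ B]) (use assms in simp)
  then show ?thesis
    using assms by (metis matrix_mul_assoc matrix_mul_lid matrix_mul_rid)
qed

text \<open>\<open>mean_curvature\<close> is a definite description, so computing a trace is not
  enough: real principal curvatures must be shown to exist. The matrix of the shape operator is in
  general not symmetric; its eigenvalues are real because the discriminant, multiplied by a positive
  factor, is a sum of squares with nonnegative coefficients.\<close>

lemma mean_curvature_trace:
  assumes E: "(first_form S X q) $ 1 $ 1 = E" and F: "(first_form S X q) $ 1 $ 2 = F" "(first_form S X q) $ 2 $ 1 = F"
    and G: "(first_form S X q) $ 2 $ 2 = G" and pos: "E > 0" "E * G - F\<^sup>2 > 0"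
    and h: "(second_form S X q) $ 1 $ 1 = h\<^sub>1\<^sub>1" "(second_form S X q) $ 1 $ 2 = h\<^sub>1\<^sub>2"
      "(second_form S X q) $ 2 $ 1 = h\<^sub>1\<^sub>2" "(second_form S X q) $ 2 $ 2 = h\<^sub>2\<^sub>2"
  shows "2 * mean_curvature S X q = (G * h\<^sub>1\<^sub>1 - 2 * F * h\<^sub>1\<^sub>2 + E * h\<^sub>2\<^sub>2) / (E * G - F\<^sup>2)"
proof -
  define w where "w = E * G - F\<^sup>2"
  have w: "w > 0" using pos by (simp add: w_def)
  define B :: "real^2^2" where "B = (\<chi> i j. (if i = 1 then if j = 1 then G else - F else if j = 1 then - F else E) / w)"
  have B: "B $ 1 $ 1 = G / w" "B $ 1 $ 2 = - F / w" "B $ 2 $ 1 = - F / w" "B $ 2 $ 2 = E / w"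
    by (simp_all add: B_def)
  have "first_form S X q ** B = mat 1" "B ** first_form S X q = mat 1"
    using w by (auto simp: vec_eq_iff forall_2 matrix_matrix_mult_def sum_2 mat_def B E F G
        diff_divide_distrib[symmetric] power2_eq_square field_simps) (simp_all add: w_def algebra_simps power2_eq_square)
  then have inv: "matrix_inv (first_form S X q) = B"
    by (rule matrix_inv_eqI)
  define A where "A = shape_operator S X q"
  have A: "A $ 1 $ 1 = (G * h\<^sub>1\<^sub>1 - F * h\<^sub>1\<^sub>2) / w" "A $ 1 $ 2 = (G * h\<^sub>1\<^sub>2 - F * h\<^sub>2\<^sub>2) / w"
    "A $ 2 $ 1 = (E * h\<^sub>1\<^sub>2 - F * h\<^sub>1\<^sub>1) / w" "A $ 2 $ 2 = (E * h\<^sub>2\<^sub>2 - F * h\<^sub>1\<^sub>2) / w"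
    by (simp_all add: A_def shape_operator_def inv matrix_matrix_mult_def sum_2 B h diff_divide_distrib)
  define t where "t = (G * h\<^sub>1\<^sub>1 - 2 * F * h\<^sub>1\<^sub>2 + E * h\<^sub>2\<^sub>2) / w"
  define d where "d = (h\<^sub>1\<^sub>1 * h\<^sub>2\<^sub>2 - h\<^sub>1\<^sub>2\<^sup>2) / w"
  have tr: "A $ 1 $ 1 + A $ 2 $ 2 = t"
    by (simp add: A t_def add_divide_distrib[symmetric] algebra_simps)
  have "det A * w\<^sup>2 = (G * h\<^sub>1\<^sub>1 - F * h\<^sub>1\<^sub>2) * (E * h\<^sub>2\<^sub>2 - F * h\<^sub>1\<^sub>2) - (G * h\<^sub>1\<^sub>2 - F * h\<^sub>2\<^sub>2) * (E * h\<^sub>1\<^sub>2 - F * h\<^sub>1\<^sub>1)"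
    using w by (simp add: det_2 A power2_eq_square field_simps)
  also have "\<dots> = (h\<^sub>1\<^sub>1 * h\<^sub>2\<^sub>2 - h\<^sub>1\<^sub>2\<^sup>2) * w"
    by (simp add: w_def power2_eq_square algebra_simps)
  finally have "(det A * w) * w = (h\<^sub>1\<^sub>1 * h\<^sub>2\<^sub>2 - h\<^sub>1\<^sub>2\<^sup>2) * w"
    by (simp add: power2_eq_square mult_ac)
  then have "det A * w = h\<^sub>1\<^sub>1 * h\<^sub>2\<^sub>2 - h\<^sub>1\<^sub>2\<^sup>2"
    using w by simp
  then have det: "det A = d"
    using w by (simp add: d_def field_simps)
  have char: "det (mat k - A) = k\<^sup>2 - t * k + d" for k
    by (simp add: det_char_poly_2 tr det)
  \<comment> \<open>the discriminant is \<open>(l - n)\<^sup>2 + 4 m\<^sup>2\<close> for the entries \<open>l, m, n\<close> of the second form in the orthonormal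
    basis obtained by Gram-Schmidt\<close>
  have disc: "E\<^sup>2 * w * (t\<^sup>2 - 4 * d) * w =
      (w * h\<^sub>1\<^sub>1 - (E\<^sup>2 * h\<^sub>2\<^sub>2 - 2 * E * F * h\<^sub>1\<^sub>2 + F\<^sup>2 * h\<^sub>1\<^sub>1))\<^sup>2 + 4 * w * (E * h\<^sub>1\<^sub>2 - F * h\<^sub>1\<^sub>1)\<^sup>2"
  proof -
    have "E\<^sup>2 * w * (t\<^sup>2 - 4 * d) * w = E\<^sup>2 * ((t * w)\<^sup>2 - 4 * (d * w) * w)"
      by (simp add: power2_eq_square algebra_simps)
    also have "t * w = G * h\<^sub>1\<^sub>1 - 2 * F * h\<^sub>1\<^sub>2 + E * h\<^sub>2\<^sub>2"
      using w by (simp add: t_def)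
    also have "d * w = h\<^sub>1\<^sub>1 * h\<^sub>2\<^sub>2 - h\<^sub>1\<^sub>2\<^sup>2"
      using w by (simp add: d_def)
    finally show ?thesis
      unfolding w_def by (simp add: power2_eq_square algebra_simps)
  qed
  have "E\<^sup>2 * w * (t\<^sup>2 - 4 * d) * w \<ge> 0"
    unfolding disc using w by simp
  then have "(t\<^sup>2 - 4 * d) * (E\<^sup>2 * w * w) \<ge> 0"
    by (simp add: mult_ac)
  moreover have "E\<^sup>2 * w * w > 0" using w pos by simp
  ultimately have D: "t\<^sup>2 - 4 * d \<ge> 0"
    by (simp add: zero_le_mult_iff)
  define s where "s = sqrt (t\<^sup>2 - 4 * d)"
  have s2: "s\<^sup>2 = t\<^sup>2 - 4 * d" using D by (simp add: s_def)
  have ex: "principal_curvatures S X q ((t + s) / 2) ((t - s) / 2)"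
    unfolding principal_curvatures_def A_def[symmetric] char
  proof
    fix k
    have "(k - (t + s) / 2) * (k - (t - s) / 2) = k\<^sup>2 - t * k + (t\<^sup>2 - s\<^sup>2) / 4"
      by (simp add: power2_eq_square field_simps)
    then show "k\<^sup>2 - t * k + d = (k - (t + s) / 2) * (k - (t - s) / 2)"
      by (simp add: s2)
  qed
  have uniq: "\<kappa>\<^sub>1 + \<kappa>\<^sub>2 = t" if "principal_curvatures S X q \<kappa>\<^sub>1 \<kappa>\<^sub>2" for \<kappa>\<^sub>1 \<kappa>\<^sub>2
  proof -
    have *: "k\<^sup>2 - t * k + d = (k - \<kappa>\<^sub>1) * (k - \<kappa>\<^sub>2)" for k
      using that unfolding principal_curvatures_def A_def[symmetric] char by blast
    \<comment> \<open>The values at 0 and 1 determine the product and the sum of the roots.\<close>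
    show ?thesis using *[of 0] *[of 1] by (simp add: algebra_simps)
  qed
  have "mean_curvature S X q = t / 2"
    unfolding mean_curvature_def
  proof (rule the_equality)
    show "\<exists>\<kappa>\<^sub>1 \<kappa>\<^sub>2. principal_curvatures S X q \<kappa>\<^sub>1 \<kappa>\<^sub>2 \<and> t / 2 = (\<kappa>\<^sub>1 + \<kappa>\<^sub>2) / 2"
      using ex uniq by metis
  qed (use uniq in auto)
  then have "2 * mean_curvature S X q = t" by simp
  then show ?thesis by (simp add: t_def w_def)
qed

text \<open>Cramer's rule for expanding \<open>a\<close> in the frame \<open>p, q, n\<close>, with
  triple products as determinants.\<close>

lemma cramer_cross3:
  "(a \<bullet> cross3 q n) *\<^sub>R p + (a \<bullet> cross3 n p) *\<^sub>R q + (a \<bullet> cross3 p q) *\<^sub>R n = (n \<bullet> cross3 p q) *\<^sub>R a"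
  by (simp add: cross3_simps forall_3)

text \<open>For independent \<open>p, q\<close> the vectors \<open>cross3 q n\<close> and
  \<open>cross3 n p\<close> are \<open>w\<close> times the frame dual to \<open>p, q\<close> in the
  tangent plane, so their products with \<open>a\<close> are \<open>w\<close> times the coordinates
  of its tangential part.\<close>

lemma conormal_combination:
  assumes "cross3 p q = w *\<^sub>R n" "n \<bullet> n = 1"
  shows "(cross3 q n \<bullet> a) *\<^sub>R p + (cross3 n p \<bullet> a) *\<^sub>R q = w *\<^sub>R (a - (n \<bullet> a) *\<^sub>R n)"
  using cramer_cross3[of a q n p] assms by (simp add: inner_commute algebra_simps)

text \<open>Lagrange's identity twice: it shows that \<open>D\<close> is parallel to
  \<open>cross3 p q\<close>, hence to \<open>n\<close>, and expanding
  \<open>cross3 n (cross3 D n) = 0\<close> gives the coefficient.\<close>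

lemma normal_of_orthogonal:
  assumes "cross3 p q = w *\<^sub>R n" "n \<bullet> n = 1" "w \<noteq> 0" "D \<bullet> p = 0" "D \<bullet> q = 0"
  shows "D = (D \<bullet> n) *\<^sub>R n"
proof -
  have "cross3 D (cross3 p q) = 0"
    using assms(4,5) by (simp add: Lagrange)
  then have "cross3 D n = 0"
    using assms(1,3) by (simp add: cross_mult_right)
  then have "cross3 n (cross3 D n) = 0" by simp
  then show ?thesis
    using assms(2) by (simp add: Lagrange inner_commute)
qed


section \<open>Normal, area density, Laplacian and flux of one parametrization\<close>

locale param_surface =
  fixes S :: "(real^2) set" and X :: "real^2 \<Rightarrow> real^3"
  assumes S: "hp_open S"
    and X: "smooth_on S X"
    and X_inj: "q \<in> S \<Longrightarrow> inj (frechet_derivative X (at q within S))"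
begin

abbreviation "p \<equiv> dir S e\<^sub>1 X"
abbreviation "q \<equiv> dir S e\<^sub>2 X"
abbreviation "N \<equiv> gauss_map S X"
abbreviation "W \<equiv> area_density S X"

lemma C1_X: "C1_on S X"
  using smooth_on_imp_C1_on[OF S X] .

lemma C1_dir_X: "C1_on S (dir S v X)"
  using smooth_on_imp_C1_on[OF S smooth_on_dir[OF S X]] .

lemma linear_X: "z \<in> S \<Longrightarrow> linear (frechet_derivative X (at z within S))"
  using C1_on_linear_dir[OF C1_X] by (simp add: eta_contract_eq)

lemma X_vec2: "z \<in> S \<Longrightarrow> dir S (vec2 s t) X z = s *\<^sub>R p z + t *\<^sub>R q z"
  unfolding vec2_eq by (simp add: linear_add[OF linear_X] linear_cmul[OF linear_X])

lemma X_inj_zero: "z \<in> S \<Longrightarrow> dir S v X z = 0 \<Longrightarrow> v = 0"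
  using X_inj linear_X linear_injective_0 by blast

text \<open>A linear relation between the partial derivatives would be a nonzero vector in the
  kernel of an injective derivative.\<close>

lemma cross_nonzero:
  assumes "z \<in> S"
  shows "cross3 (p z) (q z) \<noteq> 0"
proof
  assume "cross3 (p z) (q z) = 0"
  then have "collinear {0, p z, q z}" by (simp add: cross_eq_0)
  then consider "p z = 0" | "q z = 0" | c where "q z = c *\<^sub>R p z"
    by (auto simp: collinear_lemma)
  then obtain s t where st: "s *\<^sub>R p z + t *\<^sub>R q z = 0" "s \<noteq> 0 \<or> t \<noteq> 0"
  proof cases
    case 1 then show ?thesis using that[of 1 0] by simp
  next
    case 2 then show ?thesis using that[of 0 1] by simp
  next
    case 3 then show ?thesis using that[of "- c" 1] by simp
  qed
  then have "vec2 s t = 0"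
    using X_inj_zero[OF assms] X_vec2[OF assms] by simp
  then show False using st(2) by (metis vec2_nth zero_index)
qed

lemma first_form_nth:
  "first_form S X z $ 1 $ 1 = p z \<bullet> p z" "first_form S X z $ 1 $ 2 = p z \<bullet> q z"
  "first_form S X z $ 2 $ 1 = p z \<bullet> q z" "first_form S X z $ 2 $ 2 = q z \<bullet> q z"
  by (simp_all add: first_form_def partial_def inner_commute)

lemma W_eq: "W z = norm (cross3 (p z) (q z))"
proof -
  have "det (first_form S X z) = (norm (cross3 (p z) (q z)))\<^sup>2"
    unfolding det_2 first_form_nth norm_cross
    by (simp add: power2_norm_eq_inner power2_eq_square[of "p z \<bullet> q z"])
  then show ?thesis by (simp add: area_density_def)
qed

lemma W_pos: "z \<in> S \<Longrightarrow> W z > 0"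
  using cross_nonzero by (simp add: W_eq)

lemma W_sq: "(W z)\<^sup>2 = (p z \<bullet> p z) * (q z \<bullet> q z) - (p z \<bullet> q z)\<^sup>2"
  unfolding W_eq norm_cross by (simp add: power2_norm_eq_inner)

lemma cross_eq: "z \<in> S \<Longrightarrow> cross3 (p z) (q z) = W z *\<^sub>R N z"
  using cross_nonzero by (simp add: W_eq gauss_map_def partial_def sgn_div_norm)

lemma N_unit: "z \<in> S \<Longrightarrow> N z \<bullet> N z = 1"
  using cross_nonzero norm_sgn[of "cross3 (p z) (q z)"]
  by (simp add: gauss_map_def partial_def flip: power2_norm_eq_inner)

lemma N_orth: "z \<in> S \<Longrightarrow> N z \<bullet> p z = 0" "z \<in> S \<Longrightarrow> N z \<bullet> q z = 0"
  by (simp_all add: gauss_map_def partial_def sgn_div_norm dot_cross_self)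

lemma C1_W: "C1_on S W"
proof -
  have "C1_on S (\<lambda>z. sqrt (cross3 (p z) (q z) \<bullet> cross3 (p z) (q z)))"
    using cross_nonzero by (intro C1_on_sqrt C1_on_inner C1_on_cross C1_dir_X S) simp
  then show ?thesis
    by (rule C1_on_cong[OF S]) (simp add: W_eq norm_eq_sqrt_inner)
qed

lemma C1_N: "C1_on S N"
proof -
  have "C1_on S (\<lambda>z. inverse (W z) *\<^sub>R cross3 (p z) (q z))"
    using W_pos by (intro C1_on_scaleR C1_on_inverse C1_W C1_on_cross C1_dir_X S) simp
  then show ?thesis
    by (rule C1_on_cong[OF S]) (use W_pos in \<open>fastforce simp: cross_eq\<close>)
qed

lemma dir_const_zero:
  assumes "z \<in> S" "\<And>z. z \<in> S \<Longrightarrow> f z = c"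
  shows "dir S v f z = 0"
proof -
  have "(f has_derivative (\<lambda>_. 0)) (at z within S)"
    using assms by (intro has_derivative_transform[OF _ _ has_derivative_const]) auto
  then show ?thesis by (simp add: frechet_derivative_hp_open[OF S assms(1)])
qed

lemma dir_N_N: "z \<in> S \<Longrightarrow> dir S v N z \<bullet> N z = 0"
  using dir_const_zero[of z "\<lambda>z. N z \<bullet> N z" 1 v] N_unit dir_inner[OF S C1_N C1_N, of z v]
  by (simp add: inner_commute)

text \<open>Weingarten's equations, from differentiating the orthogonality of \<open>N\<close> to
  \<open>p\<close> and \<open>q\<close>.\<close>

lemma dir_N_X: "z \<in> S \<Longrightarrow> dir S v N z \<bullet> p z = - (dir S v p z \<bullet> N z)"
   "z \<in> S \<Longrightarrow> dir S v N z \<bullet> q z = - (dir S v q z \<bullet> N z)"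
  using dir_const_zero[of z "\<lambda>z. N z \<bullet> p z" 0 v] dir_const_zero[of z "\<lambda>z. N z \<bullet> q z" 0 v]
    N_orth dir_inner[OF S C1_N C1_dir_X[of e\<^sub>1], of z v] dir_inner[OF S C1_N C1_dir_X[of e\<^sub>2], of z v]
  by (auto simp: inner_commute add_eq_0_iff)

lemma second_form_nth:
  "second_form S X z $ 1 $ 1 = dir S e\<^sub>1 p z \<bullet> N z" "second_form S X z $ 1 $ 2 = dir S e\<^sub>1 q z \<bullet> N z"
  "second_form S X z $ 2 $ 1 = dir S e\<^sub>2 p z \<bullet> N z" "second_form S X z $ 2 $ 2 = dir S e\<^sub>2 q z \<bullet> N z"
  by (simp_all add: second_form_def partial_def[abs_def])

text \<open>The trace formula multiplied by the determinant \<open>(W z)\<^sup>2\<close> of the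
  first form. Symmetry of second derivatives makes the second form symmetric, as
  \<open>mean_curvature_trace\<close> requires.\<close>

lemma mean_curvature_formula:
  assumes z: "z \<in> S"
  shows "2 * mean_curvature S X z * (W z)\<^sup>2 =
    (q z \<bullet> q z) * (dir S e\<^sub>1 p z \<bullet> N z) - 2 * (p z \<bullet> q z) * (dir S e\<^sub>1 q z \<bullet> N z) + (p z \<bullet> p z) * (dir S e\<^sub>2 q z \<bullet> N z)"
proof -
  have "p z \<noteq> 0" using cross_nonzero[OF z] by auto
  then have "p z \<bullet> p z > 0" by simp
  moreover have w: "(W z)\<^sup>2 > 0" using W_pos[OF z] by simp
  moreover have "dir S e\<^sub>2 p z = dir S e\<^sub>1 q z"
    by (rule smooth_on_dir_commute[OF S X z])
  ultimately show ?thesis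
    using mean_curvature_trace[of S X z, OF refl _ _ refl _ _ refl _ _ refl, of "p z \<bullet> q z" "dir S e\<^sub>1 q z \<bullet> N z"]
    by (simp add: first_form_nth second_form_nth flip: W_sq)
qed

text \<open>\<open>E\<^sub>1\<close> and \<open>E\<^sub>2\<close> are \<open>W\<close> times the
  frame dual to \<open>p, q\<close>, classically W g^(ij) X_j, so their coordinate divergence is
  \<open>W\<close> times the Laplacian of \<open>X\<close>. As cross products they avoid the inverse
  of the first form, and mixed second derivatives cancel in the divergence.\<close>

definition E\<^sub>1 :: "real^2 \<Rightarrow> real^3" where "E\<^sub>1 z = cross3 (q z) (N z)"
definition E\<^sub>2 :: "real^2 \<Rightarrow> real^3" where "E\<^sub>2 z = cross3 (N z) (p z)"

lemma C1_E: "C1_on S E\<^sub>1" "C1_on S E\<^sub>2"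
  unfolding E\<^sub>1_def[abs_def] E\<^sub>2_def[abs_def] by (intro C1_on_cross C1_dir_X C1_N S)+

text \<open>In coordinates this is the identity that the Laplacian of the position vector is \<open>2 H N\<close>.\<close>

lemma div_E:
  assumes z: "z \<in> S"
  shows "dir S e\<^sub>1 E\<^sub>1 z + dir S e\<^sub>2 E\<^sub>2 z = (2 * mean_curvature S X z * W z) *\<^sub>R N z"
proof -
  define D where "D = dir S e\<^sub>1 E\<^sub>1 z + dir S e\<^sub>2 E\<^sub>2 z"
  have pq: "dir S e\<^sub>2 p z = dir S e\<^sub>1 q z"
    by (rule smooth_on_dir_commute[OF S X z])
  define n1 where "n1 = dir S e\<^sub>1 N z"
  define n2 where "n2 = dir S e\<^sub>2 N z"
  have "dir S e\<^sub>1 E\<^sub>1 z = cross3 (q z) n1 + cross3 (dir S e\<^sub>1 q z) (N z)"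
    unfolding E\<^sub>1_def[abs_def] n1_def by (rule dir_cross[OF S C1_dir_X C1_N z])
  moreover have "dir S e\<^sub>2 E\<^sub>2 z = cross3 (N z) (dir S e\<^sub>1 q z) + cross3 n2 (p z)"
    unfolding E\<^sub>2_def[abs_def] n2_def pq[symmetric] by (rule dir_cross[OF S C1_N C1_dir_X z])
  \<comment> \<open>By antisymmetry the two terms with the mixed derivative cancel, leaving only
    derivatives of \<open>N\<close>.\<close>
  ultimately have D: "D = cross3 (q z) n1 + cross3 n2 (p z)"
    using cross_skew[of "N z" "dir S e\<^sub>1 q z"] by (simp add: D_def)
  have n: "n1 \<bullet> N z = 0" "n2 \<bullet> N z = 0" 
    "n1 \<bullet> p z = - (dir S e\<^sub>1 p z \<bullet> N z)" "n1 \<bullet> q z = - (dir S e\<^sub>1 q z \<bullet> N z)"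
    "n2 \<bullet> p z = - (dir S e\<^sub>1 q z \<bullet> N z)" "n2 \<bullet> q z = - (dir S e\<^sub>2 q z \<bullet> N z)"
    using dir_N_N[OF z] dir_N_X[OF z] by (simp_all add: n1_def n2_def pq)
  have tri: "cross3 (q z) n1 \<bullet> c = n1 \<bullet> cross3 c (q z)" "cross3 n2 (p z) \<bullet> c = n2 \<bullet> cross3 (p z) c" for c
    by (simp_all add: cross3_simps)
  have "D \<bullet> p z = 0" "D \<bullet> q z = 0"
    unfolding D inner_add_left tri using n by (simp_all add: cross_eq[OF z])
  then have "D = (D \<bullet> N z) *\<^sub>R N z"
    using normal_of_orthogonal[OF cross_eq N_unit] z W_pos by force
  \<comment> \<open>The factor \<open>W z\<close> turns \<open>N z\<close> back into
    \<open>cross3 (p z) (q z)\<close>, so that Lagrange's identity and Weingarten's equations lead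
    to the trace formula.\<close>
  moreover have "W z * (D \<bullet> N z) = 2 * mean_curvature S X z * (W z)\<^sup>2"
  proof -
    have "W z * (D \<bullet> N z) = n1 \<bullet> cross3 (W z *\<^sub>R N z) (q z) + n2 \<bullet> cross3 (p z) (W z *\<^sub>R N z)"
      unfolding D inner_add_left tri by (simp add: cross_mult_left cross_mult_right algebra_simps)
    also have "\<dots> = n1 \<bullet> ((p z \<bullet> q z) *\<^sub>R q z - (q z \<bullet> q z) *\<^sub>R p z) + n2 \<bullet> ((p z \<bullet> q z) *\<^sub>R p z - (p z \<bullet> p z) *\<^sub>R q z)"
      unfolding cross_eq[OF z, symmetric] Lagrange cross_skew[of "cross3 (p z) (q z)" "q z"]
      by (simp add: inner_commute)
    also have "\<dots> = 2 * mean_curvature S X z * (W z)\<^sup>2"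
      unfolding mean_curvature_formula[OF z] inner_diff_right inner_scaleR_right n by (simp add: algebra_simps)
    finally show ?thesis .
  qed
  then have "D \<bullet> N z = 2 * mean_curvature S X z * W z"
    using W_pos[OF z] by (simp add: power2_eq_square)
  ultimately show ?thesis unfolding D_def by simp
qed

text \<open>The coordinates of the tangential part of the constant vector field \<open>a\<close>.\<close>

definition tang :: "real^3 \<Rightarrow> real^2 \<Rightarrow> real^2" where
  "tang a z = vec2 ((E\<^sub>1 z \<bullet> a) / W z) ((E\<^sub>2 z \<bullet> a) / W z)"

lemma dir_tang:
  assumes z: "z \<in> S"
  shows "dir S (tang a z) X z = a - (N z \<bullet> a) *\<^sub>R N z"
proof -
  have "W z *\<^sub>R dir S (tang a z) X z = (E\<^sub>1 z \<bullet> a) *\<^sub>R p z + (E\<^sub>2 z \<bullet> a) *\<^sub>R q z"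
    unfolding tang_def X_vec2[OF z] using W_pos[OF z] by (simp add: scaleR_add_right)
  also have "\<dots> = W z *\<^sub>R (a - (N z \<bullet> a) *\<^sub>R N z)"
    unfolding E\<^sub>1_def E\<^sub>2_def by (rule conormal_combination[OF cross_eq[OF z] N_unit[OF z]])
  finally show ?thesis using W_pos[OF z] by simp
qed

text \<open>Injectivity of the derivative of \<open>X\<close> characterises \<open>tang\<close> by
  its image in space, a condition free of coordinates; the behaviour of \<open>tang\<close> under a
  change of charts follows from it.\<close>

lemma tang_unique:
  assumes "z \<in> S" "dir S v X z = a - (N z \<bullet> a) *\<^sub>R N z"
  shows "v = tang a z"
  using assms dir_tang X_inj by (metis injD)

lemma dir_scalar_tang:
  fixes r :: "real^2 \<Rightarrow> real"
  assumes "C1_on S r" "z \<in> S"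
  shows "W z * dir S (tang a z) r z = dir S e\<^sub>1 r z * (E\<^sub>1 z \<bullet> a) + dir S e\<^sub>2 r z * (E\<^sub>2 z \<bullet> a)"
proof -
  have lin: "linear (frechet_derivative r (at z within S))"
    using C1_on_linear_dir[OF assms] by (simp add: eta_contract_eq)
  have "dir S (tang a z) r z = (E\<^sub>1 z \<bullet> a) / W z * dir S e\<^sub>1 r z + (E\<^sub>2 z \<bullet> a) / W z * dir S e\<^sub>2 r z"
    unfolding tang_def vec2_eq by (simp add: linear_add[OF lin] linear_cmul[OF lin])
  then show ?thesis using W_pos[OF assms(2)] by (simp add: field_simps)
qed

text \<open>The direction varies with the point, so continuity is read off from the expansion in the
  fixed directions \<open>e\<^sub>1\<close> and \<open>e\<^sub>2\<close>.\<close>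

lemma continuous_tang_dir:
  assumes "C1_on S (r :: real^2 \<Rightarrow> real)"
  shows "continuous_on S (\<lambda>z. dir S (tang a z) r z)"
proof -
  have "continuous_on S (\<lambda>z. (dir S e\<^sub>1 r z * (E\<^sub>1 z \<bullet> a) + dir S e\<^sub>2 r z * (E\<^sub>2 z \<bullet> a)) / W z)"
    using W_pos assms C1_E C1_W
    by (intro continuous_intros C1_on_continuous C1_on_continuous_dir) (auto simp: less_imp_neq[symmetric])
  then show ?thesis
    by (rule continuous_on_eq) (use W_pos dir_scalar_tang[OF assms] in \<open>force simp: field_simps\<close>)
qed

text \<open>This is \<open>W\<close> times the divergence of r u \<nabla>u with the curvature
  equation already substituted: \<open>r\<close> times the sum of |\<nabla>u|^2 and u \<Delta>u,
  plus u times the derivative of \<open>r\<close> along \<nabla>u, whose coordinates are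
  \<open>tang a z\<close>. In this form no second derivatives occur, which keeps the change of
  charts simple.\<close>

definition flux_div :: "real \<Rightarrow> real^3 \<Rightarrow> (real^2 \<Rightarrow> real) \<Rightarrow> real^2 \<Rightarrow> real" where
  "flux_div \<alpha> a r z = W z * (r z * (1 + (\<alpha> - 1) * (N z \<bullet> a)\<^sup>2) + (X z \<bullet> a) * dir S (tang a z) r z)"

lemma continuous_flux_div: "C1_on S r \<Longrightarrow> continuous_on S (flux_div \<alpha> a r)"
  unfolding flux_div_def
  by (intro continuous_intros continuous_tang_dir C1_on_continuous C1_W C1_N C1_X)

text \<open>In the product rule the Laplacian comes with the factor \<open>X z \<bullet> a\<close>,
  which cancels the denominator of the curvature equation and leaves
  \<open>\<alpha> * (N z \<bullet> a)\<^sup>2\<close>; the gradient term contributes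
  \<open>1 - (N z \<bullet> a)\<^sup>2\<close>.\<close>

lemma
  fixes r :: "real^2 \<Rightarrow> real"
  assumes r: "C1_on S r" and a: "norm a = 1"
  defines "F\<^sub>1 \<equiv> \<lambda>z. r z * (X z \<bullet> a) * (E\<^sub>1 z \<bullet> a)" and "F\<^sub>2 \<equiv> \<lambda>z. r z * (X z \<bullet> a) * (E\<^sub>2 z \<bullet> a)"
  shows C1_flux: "C1_on S F\<^sub>1" "C1_on S F\<^sub>2"
    and div_flux: "\<lbrakk>z \<in> S; X z \<bullet> a > 0; 2 * mean_curvature S X z = \<alpha> * ((N z \<bullet> a) / (X z \<bullet> a))\<rbrakk> \<Longrightarrow>
      dir S e\<^sub>1 F\<^sub>1 z + dir S e\<^sub>2 F\<^sub>2 z = flux_div \<alpha> a r z"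
    and flux_bound: "\<lbrakk>z \<in> S; X z \<bullet> a > 0; r z \<ge> 0\<rbrakk> \<Longrightarrow> \<bar>F\<^sub>2 z\<bar> \<le> r z * (X z \<bullet> a) * norm (p z)"
proof -
  have ca: "C1_on S (\<lambda>z. f z \<bullet> a)" and da: "\<And>z v. z \<in> S \<Longrightarrow> dir S v (\<lambda>z. f z \<bullet> a) z = dir S v f z \<bullet> a"
    if "C1_on S f" for f :: "real^2 \<Rightarrow> real^3"
  proof -
    have *: "((\<lambda>z. f z \<bullet> a) has_derivative (\<lambda>v. dir S v f z \<bullet> a)) (at z within S)" if "z \<in> S" for z
      using C1_onD[OF \<open>C1_on S f\<close> that] by (rule has_derivative_inner_left)
    show "C1_on S (\<lambda>z. f z \<bullet> a)"
      using that by (intro C1_onI[OF S *] continuous_intros C1_on_continuous_dir)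
    show "dir S v (\<lambda>z. f z \<bullet> a) z = dir S v f z \<bullet> a" if "z \<in> S" for z v
      by (simp add: frechet_derivative_hp_open[OF S that *[OF that]])
  qed
  have cu: "C1_on S (\<lambda>z. r z * (X z \<bullet> a))"
    by (intro C1_on_mult S r ca C1_X)
  show "C1_on S F\<^sub>1" "C1_on S F\<^sub>2"
    unfolding F\<^sub>1_def F\<^sub>2_def by (intro C1_on_mult S cu ca C1_E)+
  show "dir S e\<^sub>1 F\<^sub>1 z + dir S e\<^sub>2 F\<^sub>2 z = flux_div \<alpha> a r z"
    if z: "z \<in> S" and u: "X z \<bullet> a > 0" and H: "2 * mean_curvature S X z = \<alpha> * ((N z \<bullet> a) / (X z \<bullet> a))"
  proof -
    have du: "dir S v (\<lambda>z. r z * (X z \<bullet> a)) z = r z * (dir S v X z \<bullet> a) + dir S v r z * (X z \<bullet> a)" for v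
      by (simp add: dir_mult[OF S r ca[OF C1_X] z] da[OF C1_X z])
    have "dir S e\<^sub>1 F\<^sub>1 z + dir S e\<^sub>2 F\<^sub>2 z = r z * (X z \<bullet> a) * ((dir S e\<^sub>1 E\<^sub>1 z + dir S e\<^sub>2 E\<^sub>2 z) \<bullet> a)
        + r z * (((E\<^sub>1 z \<bullet> a) *\<^sub>R p z + (E\<^sub>2 z \<bullet> a) *\<^sub>R q z) \<bullet> a)
        + (X z \<bullet> a) * (dir S e\<^sub>1 r z * (E\<^sub>1 z \<bullet> a) + dir S e\<^sub>2 r z * (E\<^sub>2 z \<bullet> a))"
      unfolding F\<^sub>1_def F\<^sub>2_def dir_mult[OF S cu ca[OF C1_E(1)] z] dir_mult[OF S cu ca[OF C1_E(2)] z]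
        du da[OF C1_E(1) z] da[OF C1_E(2) z]
      by (simp add: inner_add_left algebra_simps)
    also have "(dir S e\<^sub>1 E\<^sub>1 z + dir S e\<^sub>2 E\<^sub>2 z) \<bullet> a = W z * \<alpha> * (N z \<bullet> a)\<^sup>2 / (X z \<bullet> a)"
      unfolding div_E[OF z] H by (simp add: power2_eq_square)
    also have "((E\<^sub>1 z \<bullet> a) *\<^sub>R p z + (E\<^sub>2 z \<bullet> a) *\<^sub>R q z) = W z *\<^sub>R (a - (N z \<bullet> a) *\<^sub>R N z)"
      unfolding E\<^sub>1_def E\<^sub>2_def by (rule conormal_combination[OF cross_eq[OF z] N_unit[OF z]])
    also have "(W z *\<^sub>R (a - (N z \<bullet> a) *\<^sub>R N z)) \<bullet> a = W z * (1 - (N z \<bullet> a)\<^sup>2)"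
      using a by (simp add: inner_diff_left power2_eq_square norm_eq_1)
    also have "dir S e\<^sub>1 r z * (E\<^sub>1 z \<bullet> a) + dir S e\<^sub>2 r z * (E\<^sub>2 z \<bullet> a) = W z * dir S (tang a z) r z"
      by (rule dir_scalar_tang[OF r z, symmetric])
    finally show ?thesis
      using u by (simp add: flux_div_def algebra_simps)
  qed
  show "\<bar>F\<^sub>2 z\<bar> \<le> r z * (X z \<bullet> a) * norm (p z)" if z: "z \<in> S" and u: "X z \<bullet> a > 0" and "r z \<ge> 0"
  proof -
    \<comment> \<open>\<open>E\<^sub>2 z\<close> is \<open>p z\<close> turned by a right angle in
      the tangent plane: on the boundary line it points along the conormal, and its length is the
      line element.\<close>
    have "(norm (E\<^sub>2 z))\<^sup>2 \<le> (norm (p z))\<^sup>2"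
      unfolding E\<^sub>2_def norm_cross using N_unit[OF z] by (simp add: power2_norm_eq_inner)
    then have "norm (E\<^sub>2 z) \<le> norm (p z)"
      by (simp add: power2_le_iff_abs_le)
    then have "\<bar>E\<^sub>2 z \<bullet> a\<bar> \<le> norm (p z)"
      using Cauchy_Schwarz_ineq2[of "E\<^sub>2 z" a] a by simp
    then show ?thesis
      unfolding F\<^sub>2_def abs_mult using that by (intro mult_mono) auto
  qed
qed

end

section \<open>Change of charts\<close>

lemma change_of_variables_real_valued:
  fixes f :: "real^'m::{finite,wellorder} \<Rightarrow> real" and g :: "real^'m::_ \<Rightarrow> real^'m::_"
  assumes "S \<in> sets lebesgue" "\<And>x. x \<in> S \<Longrightarrow> (g has_derivative g' x) (at x within S)" "inj_on g S"
    "f absolutely_integrable_on (g ` S)"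
  shows "(\<lambda>x. \<bar>det (matrix (g' x))\<bar> * f (g x)) absolutely_integrable_on S"
    and "integral (g ` S) f = integral S (\<lambda>x. \<bar>det (matrix (g' x))\<bar> * f (g x))"
proof -
  have "(\<lambda>x. vec (f x) :: real^1) absolutely_integrable_on (g ` S)"
    using assms(4) by (simp add: absolutely_integrable_on_1_iff)
  note iffD1[OF absolutely_integrable_change_of_variables[OF assms(1-3)] this]
    integral_change_of_variables[OF assms(1-3) disjI1[OF this]]
  then show "(\<lambda>x. \<bar>det (matrix (g' x))\<bar> * f (g x)) absolutely_integrable_on S"
    and "integral (g ` S) f = integral S (\<lambda>x. \<bar>det (matrix (g' x))\<bar> * f (g x))"
    by (simp_all add: absolutely_integrable_on_1_iff integral_on_1_eq)
qed

section \<open>Charts, transition maps and densities on the surface\<close>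

context immersed_surface
begin

abbreviation par :: "'m chart \<Rightarrow> ('m \<Rightarrow> 'b) \<Rightarrow> real^2 \<Rightarrow> 'b" where
  "par c f \<equiv> f \<circ> inv_into (fst c) (snd c)"

abbreviation img :: "'m chart \<Rightarrow> (real^2) set" where
  "img c \<equiv> snd c ` fst c"

lemma chart_open: "c \<in> A \<Longrightarrow> openin T (fst c)"
  using chart_domain_open[of "fst c" "snd c"] by simp

lemma chart_subset: "c \<in> A \<Longrightarrow> fst c \<subseteq> topspace T"
  using chart_open openin_subset by blast

lemma topspace_chart: "c \<in> A \<Longrightarrow> topspace (subtopology T (fst c)) = fst c"
  using chart_subset by (simp add: Int_absorb1)

lemma chart_homeo: "c \<in> A \<Longrightarrow> homeomorphic_map (subtopology T (fst c)) (top_of_set (img c)) (snd c)"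
  using chart_homeomorphic[of "fst c" "snd c"] by simp

lemma chart_inj: "c \<in> A \<Longrightarrow> inj_on (snd c) (fst c)"
  using homeomorphic_imp_injective_map[OF chart_homeo] topspace_chart by metis

lemma par_apply: "c \<in> A \<Longrightarrow> m \<in> fst c \<Longrightarrow> par c f (snd c m) = f m"
  using chart_inj by simp

lemma img_hp_open: "c \<in> A \<Longrightarrow> hp_open (img c)"
  using chart_image_open[of "fst c" "snd c"] by simp

lemma img_openin:
  assumes "c \<in> A" "openin T V" "V \<subseteq> fst c"
  shows "openin (top_of_set (img c)) (snd c ` V)"
proof -
  have "open_map (subtopology T (fst c)) (top_of_set (img c)) (snd c)"
    using chart_homeo[OF assms(1)] by (rule homeomorphic_imp_open_map)
  moreover have "openin (subtopology T (fst c)) V"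
    unfolding openin_subtopology using assms(2,3) by (intro exI[of _ V]) auto
  ultimately show ?thesis by (simp add: open_map_def)
qed

lemma chart_inverse_continuous:
  assumes "c \<in> A"
  shows "continuous_map (top_of_set (img c)) T (inv_into (fst c) (snd c))"
proof -
  obtain g where "homeomorphic_maps (subtopology T (fst c)) (top_of_set (img c)) (snd c) g"
    using chart_homeo[OF assms] unfolding homeomorphic_map_maps by blast
  then have g: "continuous_map (top_of_set (img c)) (subtopology T (fst c)) g" "\<And>m. m \<in> fst c \<Longrightarrow> g (snd c m) = m"
    using topspace_chart[OF assms] by (auto simp: homeomorphic_maps_def)
  have "continuous_map (top_of_set (img c)) T g"
    using g(1) continuous_map_into_fulltopology by blast
  then show ?thesis
    by (rule continuous_map_eq) (use g(2) chart_inj[OF assms] in auto)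
qed

lemma chart_continuous:
  assumes "c \<in> A"
  shows "continuous_map (subtopology T (fst c)) euclidean (snd c)"
  using continuous_map_into_fulltopology[OF homeomorphic_imp_continuous_map[OF chart_homeo[OF assms]]] .

lemma param: "c \<in> A \<Longrightarrow> param_surface (img c) (par c \<phi>)"
  using chart_image_open[of "fst c" "snd c"] immersion_smooth[of "fst c" "snd c"] immersion_inj[of "fst c" "snd c"]
  by (intro param_surface.intro) simp_all

abbreviation trans :: "'m chart \<Rightarrow> 'm chart \<Rightarrow> real^2 \<Rightarrow> real^2" where
  "trans c d \<equiv> par c (snd d)"

abbreviation overlap :: "'m chart \<Rightarrow> 'm chart \<Rightarrow> (real^2) set" where
  "overlap c d \<equiv> snd c ` (fst c \<inter> fst d)"

abbreviation dtrans :: "'m chart \<Rightarrow> 'm chart \<Rightarrow> real^2 \<Rightarrow> real^2 \<Rightarrow> real^2" where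
  "dtrans c d z \<equiv> frechet_derivative (trans c d) (at z within overlap c d)"

lemma overlap_openin: "c \<in> A \<Longrightarrow> d \<in> A \<Longrightarrow> openin (top_of_set (img c)) (overlap c d)"
  by (intro img_openin openin_Int chart_open) auto

lemma overlap_hp_open: "c \<in> A \<Longrightarrow> d \<in> A \<Longrightarrow> hp_open (overlap c d)"
  using hp_open_subset[OF img_hp_open overlap_openin] .

lemma C1_trans: "c \<in> A \<Longrightarrow> d \<in> A \<Longrightarrow> C1_on (overlap c d) (trans c d)"
  using transition_smooth[of "fst c" "snd c" "fst d" "snd d"]
  by (intro smooth_on_imp_C1_on overlap_hp_open) auto

lemma trans_derivative:
  assumes "c \<in> A" "d \<in> A" "m \<in> fst c" "m \<in> fst d"
  shows "(trans c d has_derivative dtrans c d (snd c m)) (at (snd c m) within overlap c d)"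
  using C1_onD[OF C1_trans[OF assms(1,2)]] assms(3,4) by blast

lemma par_transition:
  fixes f :: "'m \<Rightarrow> 'b::real_normed_vector"
  assumes cd: "c \<in> A" "d \<in> A" and m: "m \<in> fst c" "m \<in> fst d" and f: "C1_on (img d) (par d f)"
  shows "(par c f has_derivative (\<lambda>v. dir (img d) (dtrans c d (snd c m) v) (par d f) (snd d m))) (at (snd c m) within img c)"
proof -
  have tm: "trans c d (snd c m) = snd d m" using par_apply[OF cd(1) m(1)] .
  have sub: "trans c d ` overlap c d \<subseteq> img d"
    using par_apply[OF cd(1)] by (auto simp del: comp_apply)
  have "(par d f has_derivative frechet_derivative (par d f) (at (snd d m) within img d)) (at (snd d m) within img d)"
    using C1_onD[OF f] m by blast
  then have "(par d f has_derivative frechet_derivative (par d f) (at (snd d m) within img d)) (at (trans c d (snd c m)) within trans c d ` overlap c d)"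
    unfolding tm using has_derivative_subset sub by blast
  from has_derivative_in_compose[OF trans_derivative[OF cd m] this]
  have "((\<lambda>z. par d f (trans c d z)) has_derivative (\<lambda>v. dir (img d) (dtrans c d (snd c m) v) (par d f) (snd d m))) (at (snd c m) within overlap c d)" .
  then have "(par c f has_derivative (\<lambda>v. dir (img d) (dtrans c d (snd c m) v) (par d f) (snd d m))) (at (snd c m) within overlap c d)"
  proof (rule has_derivative_transform[rotated 2])
    show "snd c m \<in> overlap c d" using m by blast
    show "par c f z = par d f (trans c d z)" if "z \<in> overlap c d" for z
      using that chart_inj[OF cd(1)] chart_inj[OF cd(2)] by auto
  qed
  then show ?thesis
    using at_within_openin[OF overlap_openin[OF cd], of "snd c m"] m by (metis IntI image_eqI)
qed

lemma dir_transition: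
  fixes f :: "'m \<Rightarrow> 'b::real_normed_vector"
  assumes cd: "c \<in> A" "d \<in> A" and m: "m \<in> fst c" "m \<in> fst d" and f: "C1_on (img d) (par d f)"
  shows "dir (img c) v (par c f) (snd c m) = dir (img d) (dtrans c d (snd c m) v) (par d f) (snd d m)"
  using frechet_derivative_hp_open[OF img_hp_open[OF cd(1)] _ par_transition[OF assms]] m by auto

text \<open>The cross product of the partial derivatives is multiplied by the Jacobian determinant.
  Its absolute value scales the area density; its positive sign, which is the orientation, preserves
  the normal; \<open>tang_unique\<close> then identifies the tangential field.\<close>

lemma transition_geometry:
  assumes cd: "c \<in> A" "d \<in> A" and m: "m \<in> fst c" "m \<in> fst d"
  defines "J \<equiv> \<bar>det (matrix (dtrans c d (snd c m)))\<bar>"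
  shows area_density_transition: "area_density (img c) (par c \<phi>) (snd c m) = J * area_density (img d) (par d \<phi>) (snd d m)"
    and gauss_map_transition: "gauss_map (img c) (par c \<phi>) (snd c m) = gauss_map (img d) (par d \<phi>) (snd d m)"
    and tang_transition: "dtrans c d (snd c m) (param_surface.tang (img c) (par c \<phi>) a (snd c m)) =
      param_surface.tang (img d) (par d \<phi>) a (snd d m)"
proof -
  interpret c: param_surface "img c" "par c \<phi>" using param[OF cd(1)] .
  interpret d: param_surface "img d" "par d \<phi>" using param[OF cd(2)] .
  define D where "D = dtrans c d (snd c m)"
  have zc: "snd c m \<in> img c" and zd: "snd d m \<in> img d" using m by auto
  have dX: "dir (img c) v (par c \<phi>) (snd c m) = dir (img d) (D v) (par d \<phi>) (snd d m)" for v
    unfolding D_def by (rule dir_transition[OF cd m d.C1_X])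
  have dX2: "dir (img c) v (par c \<phi>) (snd c m) = D v $ 1 *\<^sub>R d.p (snd d m) + D v $ 2 *\<^sub>R d.q (snd d m)" for v
    unfolding dX using d.X_vec2[OF zd, of "D v $ 1" "D v $ 2"] by simp
  have det: "det (matrix D) = D e\<^sub>1 $ 1 * D e\<^sub>2 $ 2 - D e\<^sub>2 $ 1 * D e\<^sub>1 $ 2"
    by (simp add: det_2 matrix_def)
  have cr: "cross3 (c.p (snd c m)) (c.q (snd c m)) = det (matrix D) *\<^sub>R cross3 (d.p (snd d m)) (d.q (snd d m))"
    unfolding dX2[of e\<^sub>1] dX2[of e\<^sub>2] det
    by (simp add: cross_add_left cross_add_right cross_mult_left cross_mult_right
        cross_skew[of "d.q (snd d m)" "d.p (snd d m)"] scaleR_left_diff_distrib mult.commute)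
  have pos: "det (matrix D) > 0"
    unfolding D_def using transition_oriented[of "fst c" "snd c" "fst d" "snd d" "snd c m"] cd m by auto
  show "c.W (snd c m) = J * d.W (snd d m)"
    unfolding c.W_eq d.W_eq cr by (simp add: J_def D_def)
  show N: "c.N (snd c m) = d.N (snd d m)"
    unfolding gauss_map_def partial_def cr using pos by (simp add: sgn_scaleR)
  show "D (c.tang a (snd c m)) = d.tang a (snd d m)"
    by (rule d.tang_unique[OF zd]) (simp only: dX[symmetric] c.dir_tang[OF zc] N)
qed

definition flux_div :: "real \<Rightarrow> real^3 \<Rightarrow> 'm chart \<Rightarrow> ('m \<Rightarrow> real) \<Rightarrow> real^2 \<Rightarrow> real" where
  "flux_div \<alpha> a c r = param_surface.flux_div (img c) (par c \<phi>) \<alpha> a (par c r)"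

text \<open>\<open>flux_div\<close> is a density: the area density supplies the Jacobian and the
  other factors do not depend on the chart, the derivative of \<open>r\<close> along
  \<open>tang\<close> because \<open>tang\<close> transforms as a vector.\<close>

lemma flux_div_transition:
  assumes cd: "c \<in> A" "d \<in> A" and m: "m \<in> fst c" "m \<in> fst d" and r: "C1_on (img d) (par d r)"
  shows "flux_div \<alpha> a c r (snd c m) = \<bar>det (matrix (dtrans c d (snd c m)))\<bar> * flux_div \<alpha> a d r (snd d m)"
proof -
  interpret c: param_surface "img c" "par c \<phi>" using param[OF cd(1)] .
  interpret d: param_surface "img d" "par d \<phi>" using param[OF cd(2)] .
  show ?thesis
    unfolding flux_div_def c.flux_div_def d.flux_div_def area_density_transition[OF cd m] gauss_map_transition[OF cd m]
      dir_transition[OF cd m r] tang_transition[OF cd m] par_apply[OF cd(1) m(1)] par_apply[OF cd(2) m(2)]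
    by (simp add: mult.assoc)
qed

text \<open>A differentiable map of the plane to itself sends null sets to null sets, hence Lebesgue
  sets to Lebesgue sets; so a piece of the surface that is measurable in one chart is measurable in
  the other.\<close>

lemma chart_image_lebesgue:
  assumes cd: "c \<in> A" "d \<in> A" and E: "E \<subseteq> fst c \<inter> fst d" "snd c ` E \<in> sets lebesgue"
  shows "snd d ` E \<in> sets lebesgue"
proof -
  have img: "trans c d ` (snd c ` E) = snd d ` E"
    unfolding image_image using E(1) by (intro image_cong refl par_apply[OF cd(1)]) auto
  have der: "(trans c d has_derivative dtrans c d z) (at z within snd c ` E)" if z: "z \<in> snd c ` E" for z
  proof -
    obtain m where m: "m \<in> E" "z = snd c m" using z by blast
    have "m \<in> fst c" "m \<in> fst d" using m(1) E(1) by auto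
    then show ?thesis
      unfolding m(2) by (rule has_derivative_subset[OF trans_derivative[OF cd] image_mono[OF E(1)]])
  qed
  show "snd d ` E \<in> sets lebesgue"
    unfolding img[symmetric]
    using der E(2) by (intro differentiable_image_in_sets_lebesgue) (auto simp: differentiable_on_def differentiable_def)
qed

lemma chart_change_of_variables:
  fixes k k' :: "real^2 \<Rightarrow> real"
  assumes cd: "c \<in> A" "d \<in> A" and E: "E \<subseteq> fst c \<inter> fst d" "snd c ` E \<in> sets lebesgue"
    and k': "k' absolutely_integrable_on (snd d ` E)"
    and k: "\<And>m. m \<in> E \<Longrightarrow> k (snd c m) = \<bar>det (matrix (dtrans c d (snd c m)))\<bar> * k' (snd d m)"
  shows "k absolutely_integrable_on (snd c ` E)"
    and "integral (snd c ` E) k = integral (snd d ` E) k'"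
proof -
  have img: "trans c d ` (snd c ` E) = snd d ` E"
    unfolding image_image using E(1) by (intro image_cong refl par_apply[OF cd(1)]) auto
  have der: "(trans c d has_derivative dtrans c d z) (at z within snd c ` E)" if z: "z \<in> snd c ` E" for z
  proof -
    obtain m where m: "m \<in> E" "z = snd c m" using z by blast
    have "m \<in> fst c" "m \<in> fst d" using m(1) E(1) by auto
    then show ?thesis
      unfolding m(2) by (rule has_derivative_subset[OF trans_derivative[OF cd] image_mono[OF E(1)]])
  qed
  have inj: "inj_on (trans c d) (snd c ` E)"
  proof (rule inj_onI)
    fix z w assume "z \<in> snd c ` E" "w \<in> snd c ` E" "trans c d z = trans c d w"
    then obtain m n where mn: "m \<in> E" "z = snd c m" "n \<in> E" "w = snd c n" by blast
    have "trans c d z = snd d m" "trans c d w = snd d n"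
      unfolding mn(2,4) using mn(1,3) E(1) by (auto intro!: par_apply[OF cd(1)] simp del: comp_apply)
    with \<open>trans c d z = trans c d w\<close> have "snd d m = snd d n" by simp
    then have "m = n" using chart_inj[OF cd(2)] E(1) mn(1,3) by (auto simp: inj_on_def)
    then show "z = w" using mn by simp
  qed
  have eq: "\<And>z. z \<in> snd c ` E \<Longrightarrow> k z = \<bar>det (matrix (dtrans c d z))\<bar> * k' (trans c d z)"
  proof (elim imageE)
    fix z m assume m: "z = snd c m" "m \<in> E"
    then have "trans c d z = snd d m" using E(1) by (auto intro!: par_apply[OF cd(1)] simp del: comp_apply)
    then show "k z = \<bar>det (matrix (dtrans c d z))\<bar> * k' (trans c d z)" using k m by simp
  qed
  note cv = change_of_variables_real_valued[of _ _ "dtrans c d", OF E(2) _ inj, unfolded img, OF _ k']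
  have "k absolutely_integrable_on (snd c ` E) \<longleftrightarrow>
      (\<lambda>z. \<bar>det (matrix (dtrans c d z))\<bar> * k' (trans c d z)) absolutely_integrable_on (snd c ` E)"
    using eq by (intro set_integrable_cong refl) auto
  then show "k absolutely_integrable_on (snd c ` E)"
    using cv(1) der by blast
  have "integral (snd d ` E) k' = integral (snd c ` E) (\<lambda>z. \<bar>det (matrix (dtrans c d z))\<bar> * k' (trans c d z))"
    using der by (rule cv(2))
  also have "\<dots> = integral (snd c ` E) k"
    using eq by (intro integral_cong) simp
  finally show "integral (snd c ` E) k = integral (snd d ` E) k'" by simp
qed

end

section \<open>The boundary curve\<close>

lemma differentiable_transform_open:
  assumes "f differentiable (at x)" "open W" "x \<in> W" "\<And>y. y \<in> W \<Longrightarrow> f y = g y"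
  shows "g differentiable (at x)"
  using assms has_derivative_transform_within_open unfolding differentiable_def by blast

lemma closed_curve_local:
  assumes "closed_curve_param \<gamma>"
  obtains W g where "open W" "s \<in> W" "\<And>k. Ck_on k g W" "\<And>x. x \<in> W \<Longrightarrow> \<gamma> x = g x"
  using assms smooth_on_localE[of UNIV \<gamma> s] unfolding closed_curve_param_def by auto

lemma closed_curve_has_vector_derivative:
  assumes "closed_curve_param \<gamma>"
  shows "(\<gamma> has_vector_derivative vector_derivative \<gamma> (at s)) (at s)"
proof -
  obtain W g where W: "open W" "s \<in> W" "\<And>k. Ck_on k g W" "\<And>x. x \<in> W \<Longrightarrow> \<gamma> x = g x"
    using closed_curve_local[OF assms] by metis
  have "g differentiable (at s)" using W(2) W(3)[of "Suc 0"] by simp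
  then have "\<gamma> differentiable (at s)"
    by (rule differentiable_transform_open[OF _ W(1,2)]) (simp add: W(4))
  then show ?thesis by (simp add: vector_derivative_works)
qed

lemma closed_curve_continuous: "closed_curve_param \<gamma> \<Longrightarrow> continuous_on X \<gamma>"
  by (intro continuous_at_imp_continuous_on ballI has_vector_derivative_continuous[OF closed_curve_has_vector_derivative])

lemma closed_curve_derivative_continuous:
  assumes "closed_curve_param \<gamma>"
  shows "continuous_on X (\<lambda>s. vector_derivative \<gamma> (at s))"
proof (intro continuous_at_imp_continuous_on ballI)
  fix s
  obtain W g where W: "open W" "s \<in> W" "\<And>k. Ck_on k g W" "\<And>x. x \<in> W \<Longrightarrow> \<gamma> x = g x"
    using closed_curve_local[OF assms] by metis
  have eq: "vector_derivative \<gamma> (at x) = frechet_derivative g (at x) 1" if "x \<in> W" for x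
  proof -
    have g: "(g has_derivative frechet_derivative g (at x)) (at x)"
      using Ck_on_has_derivative[OF W(3) that] .
    then have "(\<gamma> has_derivative frechet_derivative g (at x)) (at x)"
      by (rule has_derivative_transform_within_open[OF _ W(1) that]) (simp add: W(4))
    moreover have "frechet_derivative g (at x) = (\<lambda>r. r *\<^sub>R frechet_derivative g (at x) 1)"
    proof
      fix r :: real
      show "frechet_derivative g (at x) r = r *\<^sub>R frechet_derivative g (at x) 1"
        using linear_cmul[OF has_derivative_linear[OF g], of r 1] by simp
    qed
    ultimately show ?thesis
      using vector_derivative_at unfolding has_vector_derivative_def by metis
  qed
  have "continuous_on W (\<lambda>x. frechet_derivative g (at x) 1)"
    using W(3)[of "Suc 0"] by simp
  then have "continuous_on W (\<lambda>s. vector_derivative \<gamma> (at s))"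
    by (rule continuous_on_eq) (simp add: eq)
  then show "isCont (\<lambda>s. vector_derivative \<gamma> (at s)) s"
    using W(1,2) continuous_on_eq_continuous_at by blast
qed

context immersed_surface
begin

text \<open>A transition map that sent an interior point to the boundary line would contradict invariance of domain.\<close>

lemma boundary_in_chart:
  assumes c: "c \<in> A" "m \<in> fst c" and m: "m \<in> surface_boundary A"
  shows "snd c m $ 2 = 0"
proof (rule ccontr)
  assume ne: "snd c m $ 2 \<noteq> 0"
  obtain d where d: "d \<in> A" "m \<in> fst d" "snd d m $ 2 = 0"
    using m unfolding surface_boundary_def by force
  have "snd c m \<in> half_plane" using img_hp_open[OF c(1)] c(2) openin_imp_subset by blast
  then have pos: "snd c m $ 2 > 0" using ne by (simp add: half_plane_def)
  obtain W where W: "open W" "overlap c d = half_plane \<inter> W"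
    using overlap_hp_open[OF c(1) d(1)] by (auto simp: openin_open)
  \<comment> \<open>Cutting off the boundary line leaves a set that is open in the plane itself, as
    invariance of domain demands.\<close>
  define P where "P = W \<inter> {z :: real^2. z $ 2 > 0}"
  have P: "P \<subseteq> overlap c d" unfolding W(2) P_def half_plane_def by auto
  have "open P" unfolding P_def using W(1) by (intro open_Int open_halfspace_component_gt_cart)
  moreover have "continuous_on P (trans c d)"
    using C1_on_continuous[OF C1_trans[OF c(1) d(1)]] P continuous_on_subset by blast
  moreover have "inj_on (trans c d) P"
  proof (rule inj_onI)
    fix z w assume "z \<in> P" "w \<in> P" and eq: "trans c d z = trans c d w"
    then obtain m n where mn: "m \<in> fst c \<inter> fst d" "z = snd c m" "n \<in> fst c \<inter> fst d" "w = snd c n" using P by blast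
    have "trans c d z = snd d m" "trans c d w = snd d n"
      unfolding mn(2,4) using mn(1,3) by (auto intro!: par_apply[OF c(1)] simp del: comp_apply)
    with eq have "snd d m = snd d n" by simp
    then have "m = n" using chart_inj[OF d(1)] mn(1,3) by (auto simp: inj_on_def)
    then show "z = w" using mn by simp
  qed
  ultimately have op: "open (trans c d ` P)" by (intro invariance_of_domain)
  have "snd c m \<in> P" using W(2) c(2) d(2) pos by (auto simp: P_def)
  then have "snd d m \<in> trans c d ` P"
    using par_apply[OF c, of "snd d"] by (intro image_eqI[of _ _ "snd c m"]) auto
  then obtain e where e: "e > 0" "ball (snd d m) e \<subseteq> trans c d ` P"
    using op open_contains_ball by blast
  have "trans c d ` P \<subseteq> half_plane"
  proof (rule image_subsetI)
    fix z assume "z \<in> P"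
    then obtain n where n: "n \<in> fst c" "n \<in> fst d" "z = snd c n" using P by blast
    have "trans c d z = snd d n" unfolding n(3) by (rule par_apply[OF c(1) n(1)])
    then show "trans c d z \<in> half_plane"
      using n(2) img_hp_open[OF d(1)] openin_imp_subset by fastforce
  qed
  \<comment> \<open>A point strictly below the boundary line, yet inside the ball that should lie in
    the half-plane.\<close>
  moreover have "snd d m - (e / 2) *\<^sub>R e\<^sub>2 \<in> ball (snd d m) e"
    using e(1) by (simp add: dist_norm norm_axis_1)
  ultimately have "snd d m - (e / 2) *\<^sub>R e\<^sub>2 \<in> half_plane" using e(2) by blast
  then show False using d(3) e(1) by (simp add: half_plane_def axis_def)
qed

lemma boundary_subset: "surface_boundary A \<subseteq> topspace T"
  unfolding surface_boundary_def using chart_subset by fastforce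

end

section \<open>The curve lifted to the boundary of the surface\<close>

locale bounded_surface = immersed_surface T A \<phi>
  for T :: "'m topology" and A :: "'m chart set" and \<phi> :: "'m \<Rightarrow> real^3" +
  fixes \<gamma> :: "real \<Rightarrow> real^3"
  assumes \<gamma>: "closed_curve_param \<gamma>"
    and boundary: "has_boundary T A \<phi> (range \<gamma>)"
begin

abbreviation "B \<equiv> surface_boundary A"
abbreviation "\<gamma>' s \<equiv> vector_derivative \<gamma> (at s)"

text \<open>\<open>\<phi>\<close> is an immersion and may take a value on the curve at interior
  points as well, so its inverse is restricted to the boundary.\<close>

definition lift :: "real \<Rightarrow> 'm" where
  "lift s = inv_into B \<phi> (\<gamma> s)"

lemma boundary_homeo: "homeomorphic_map (subtopology T B) (top_of_set (range \<gamma>)) \<phi>"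
  using boundary by (simp add: has_boundary_def)

lemma boundary_topspace: "topspace (subtopology T B) = B"
  using boundary_subset by auto

lemma boundary_inj: "inj_on \<phi> B"
  using homeomorphic_imp_injective_map[OF boundary_homeo] by (simp only: boundary_topspace)

lemma boundary_image: "\<phi> ` B = range \<gamma>"
  using homeomorphic_imp_surjective_map[OF boundary_homeo] by (simp only: boundary_topspace topspace_euclidean_subtopology)

lemma lift_in: "lift s \<in> B" and \<phi>_lift: "\<phi> (lift s) = \<gamma> s"
  unfolding lift_def using boundary_image by (auto intro: inv_into_into f_inv_into_f)

lemma lift_eq: "m \<in> B \<Longrightarrow> \<phi> m = \<gamma> s \<Longrightarrow> lift s = m"
  unfolding lift_def using boundary_inj inv_into_f_f by metis

lemma lift_mem_iff: "lift s \<in> fst c \<longleftrightarrow> \<gamma> s \<in> \<phi> ` (fst c \<inter> B)"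
proof
  assume "lift s \<in> fst c"
  then show "\<gamma> s \<in> \<phi> ` (fst c \<inter> B)"
    using imageI[of "lift s" "fst c \<inter> B" \<phi>] lift_in by (simp add: \<phi>_lift)
qed (use lift_eq in force)

text \<open>\<open>\<phi>\<close> is an open map from the boundary onto the curve, and
  \<open>\<gamma>\<close> is continuous.\<close>

lemma open_lift_preimage:
  assumes "c \<in> A"
  shows "open {s. lift s \<in> fst c}"
proof -
  have "openin (subtopology T B) (fst c \<inter> B)"
    unfolding openin_subtopology using chart_open[OF assms] by blast
  then have "openin (top_of_set (range \<gamma>)) (\<phi> ` (fst c \<inter> B))"
    using homeomorphic_imp_open_map[OF boundary_homeo] by (simp add: open_map_def)
  then have "openin (top_of_set UNIV) (UNIV \<inter> \<gamma> -` (\<phi> ` (fst c \<inter> B)))"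
    by (intro continuous_openin_preimage[OF closed_curve_continuous[OF \<gamma>]]) auto
  then show ?thesis
    by (simp add: lift_mem_iff vimage_def)
qed

text \<open>Differentiability comes from the smoothness of the inverse of \<open>\<phi>\<close> on the boundary curve, so no
  inverse function theorem is needed.\<close>

definition coord :: "'m chart \<Rightarrow> real \<Rightarrow> real" where
  "coord c s = snd c (lift s) $ 1"

lemma coord_eq: "c \<in> A \<Longrightarrow> lift s \<in> fst c \<Longrightarrow> snd c (lift s) = vec2 (coord c s) 0"
  using boundary_in_chart[OF _ _ lift_in] by (simp add: coord_def vec_eq_iff forall_2)

lemma coord_differentiable:
  assumes c: "c \<in> A" and s: "lift s \<in> fst c"
  shows "(coord c has_vector_derivative vector_derivative (coord c) (at s)) (at s)"
proof -
  have "smooth_on (\<phi> ` (fst c \<inter> B)) (snd c \<circ> inv_into B \<phi>)"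
    using boundary c unfolding has_boundary_def by force
  then obtain W g where W: "open W" "\<gamma> s \<in> W" "\<And>k. Ck_on k g W"
    "\<And>x. x \<in> W \<inter> \<phi> ` (fst c \<inter> B) \<Longrightarrow> (snd c \<circ> inv_into B \<phi>) x = g x"
    using smooth_on_localE s[unfolded lift_mem_iff] by metis
  \<comment> \<open>On this open set \<open>coord c\<close> is the first component of
    \<open>g \<circ> \<gamma>\<close>.\<close>
  define \<Omega> where "\<Omega> = {s. lift s \<in> fst c} \<inter> \<gamma> -` W"
  have "open (\<gamma> -` W)"
    using closed_curve_continuous[OF \<gamma>, of UNIV] W(1) by (simp add: open_vimage)
  then have \<Omega>: "open \<Omega>" "s \<in> \<Omega>"
    using open_lift_preimage[OF c] s W(2) by (auto simp: \<Omega>_def)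
  have "g differentiable (at (\<gamma> s))" using W(2) W(3)[of "Suc 0"] by simp
  moreover have "\<gamma> differentiable (at s)"
    using closed_curve_has_vector_derivative[OF \<gamma>] by (simp add: vector_derivative_works)
  ultimately have "(g \<circ> \<gamma>) differentiable (at s)"
    by (intro differentiable_chain_at)
  then obtain D where "((\<lambda>s. g (\<gamma> s)) has_derivative D) (at s)"
    unfolding differentiable_def comp_def by blast
  then have "((\<lambda>s. g (\<gamma> s) $ 1) has_derivative (\<lambda>r. D r $ 1)) (at s)"
    by (rule bounded_linear.has_derivative[OF bounded_linear_vec_nth])
  then have "(\<lambda>s. g (\<gamma> s) $ 1) differentiable (at s)"
    unfolding differentiable_def by blast
  then have "coord c differentiable (at s)"
  proof (rule differentiable_transform_open[OF _ \<Omega>])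
    fix r assume "r \<in> \<Omega>"
    then show "g (\<gamma> r) $ 1 = coord c r"
      using W(4)[of "\<gamma> r"] lift_mem_iff[of r c] by (simp add: \<Omega>_def coord_def lift_def)
  qed
  then show ?thesis by (simp add: vector_derivative_works)
qed

abbreviation "coord' c s \<equiv> vector_derivative (coord c) (at s)"

text \<open>Near \<open>s\<close> the curve is \<open>par c \<phi>\<close> along the boundary line
  at abscissa \<open>coord c\<close>. By the chain rule its speed is the Jacobian of
  \<open>coord c\<close> times the length of the partial derivative, which is the form needed for
  substitution.\<close>

lemma curve_velocity:
  assumes c: "c \<in> A" and s: "lift s \<in> fst c"
  shows "\<gamma>' s = coord' c s *\<^sub>R dir (img c) e\<^sub>1 (par c \<phi>) (vec2 (coord c s) 0)"
proof -
  interpret c: param_surface "img c" "par c \<phi>" using param[OF c] .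
  define \<Omega> where "\<Omega> = {s. lift s \<in> fst c}"
  have \<Omega>: "open \<Omega>" "s \<in> \<Omega>" using open_lift_preimage[OF c] s by (auto simp: \<Omega>_def)
  have mem: "vec2 (coord c r) 0 \<in> img c" if "r \<in> \<Omega>" for r
    using coord_eq[OF c, of r] that unfolding \<Omega>_def by (metis image_eqI mem_Collect_eq)
  have lin: "linear (frechet_derivative (par c \<phi>) (at (vec2 (coord c s) 0) within img c))"
    using c.linear_X mem \<Omega>(2) by blast
  have "(coord c has_derivative (\<lambda>r. r *\<^sub>R coord' c s)) (at s within \<Omega>)"
    using coord_differentiable[OF c s] unfolding has_vector_derivative_def by (rule has_derivative_at_withinI)
  then have "((\<lambda>r. coord c r *\<^sub>R e\<^sub>1 + 0 *\<^sub>R e\<^sub>2) has_derivative (\<lambda>r. (r *\<^sub>R coord' c s) *\<^sub>R e\<^sub>1 + 0)) (at s within \<Omega>)"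
    by (intro has_derivative_add has_derivative_scaleR_left has_derivative_const)
  then have curve: "((\<lambda>r. vec2 (coord c r) 0) has_derivative (\<lambda>r. (r *\<^sub>R coord' c s) *\<^sub>R e\<^sub>1)) (at s within \<Omega>)"
    unfolding vec2_eq by simp
  have "(par c \<phi> has_derivative frechet_derivative (par c \<phi>) (at (vec2 (coord c s) 0) within img c))
    (at (vec2 (coord c s) 0) within (\<lambda>r. vec2 (coord c r) 0) ` \<Omega>)"
    by (rule has_derivative_subset[OF C1_onD[OF c.C1_X]]) (use mem \<Omega>(2) in auto)
  from has_derivative_in_compose[OF curve this]
  have "((\<lambda>r. par c \<phi> (vec2 (coord c r) 0)) has_derivative (\<lambda>r. (r *\<^sub>R coord' c s) *\<^sub>R dir (img c) e\<^sub>1 (par c \<phi>) (vec2 (coord c s) 0))) (at s within \<Omega>)"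
    unfolding linear_cmul[OF lin] .
  then have "((\<lambda>r. par c \<phi> (vec2 (coord c r) 0)) has_vector_derivative (coord' c s *\<^sub>R dir (img c) e\<^sub>1 (par c \<phi>) (vec2 (coord c s) 0))) (at s)"
    by (simp only: has_vector_derivative_def at_within_open[OF \<Omega>(2,1)] real_scaleR_def scaleR_scaleR)
  then have "(\<gamma> has_vector_derivative (coord' c s *\<^sub>R dir (img c) e\<^sub>1 (par c \<phi>) (vec2 (coord c s) 0))) (at s)"
  proof (rule has_vector_derivative_transform_within_open[OF _ \<Omega>])
    fix r assume r: "r \<in> \<Omega>"
    then have "par c \<phi> (snd c (lift r)) = \<gamma> r"
      using par_apply[OF c, of "lift r" \<phi>] by (simp add: \<Omega>_def \<phi>_lift)
    then show "par c \<phi> (vec2 (coord c r) 0) = \<gamma> r"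
      using coord_eq[OF c, of r] r by (simp add: \<Omega>_def)
  qed
  then show ?thesis by (rule vector_derivative_at)
qed

text \<open>Substitution by \<open>coord c\<close>. The curve may run along the boundary in either
  direction relative to the chart; the absolute value of the Jacobian takes care of this, as both
  sides involve only lengths.\<close>

lemma boundary_change_of_variables:
  fixes f :: "'m \<Rightarrow> real"
  assumes c: "c \<in> A"
  defines "k \<equiv> \<lambda>t. par c f (vec2 t 0) * norm (dir (img c) e\<^sub>1 (par c \<phi>) (vec2 t 0))"
  assumes k: "k absolutely_integrable_on {t. vec2 t 0 \<in> img c}"
  shows "(\<lambda>s. f (lift s) * norm (\<gamma>' s)) absolutely_integrable_on {s\<in>{0..<1}. lift s \<in> fst c}"
    and "integral {t. vec2 t 0 \<in> img c} k = integral {s\<in>{0..<1}. lift s \<in> fst c} (\<lambda>s. f (lift s) * norm (\<gamma>' s))"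
proof -
  \<comment> \<open>A half-open period meets each boundary point exactly once, so
    \<open>coord c\<close> is injective on \<open>S\<close> and still reaches every boundary
    abscissa of the chart image.\<close>
  define S where "S = {s\<in>{0..<1}. lift s \<in> fst c}"
  have "S = {0..<1} \<inter> {s. lift s \<in> fst c}" by (auto simp: S_def)
  then have leb: "S \<in> sets lebesgue"
    using open_lift_preimage[OF c] by (simp add: borel_open sets.Int)
  have der: "(coord c has_real_derivative coord' c s) (at s within S)" if "s \<in> S" for s
    using coord_differentiable[OF c] that
    by (auto simp: S_def has_real_derivative_iff_has_vector_derivative intro: has_vector_derivative_at_within)
  have inj: "inj_on (coord c) S"
  proof (rule inj_onI)
    fix s t assume st: "s \<in> S" "t \<in> S" "coord c s = coord c t"
    then have "snd c (lift s) = snd c (lift t)"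
      using coord_eq[OF c] by (simp add: S_def)
    then have "lift s = lift t" using chart_inj[OF c] st(1,2) by (auto simp: S_def inj_on_def)
    then have "\<gamma> s = \<gamma> t" using \<phi>_lift by metis
    then have "s - t \<in> \<int>" using \<gamma> by (simp add: closed_curve_param_def)
    then obtain n :: int where n: "s - t = of_int n" by (auto elim: Ints_cases)
    then have "\<bar>real_of_int n\<bar> < 1" using st(1,2) by (auto simp: S_def)
    then have "\<bar>n\<bar> < 1" by (metis of_int_abs of_int_less_1_iff)
    then show "s = t" using n by simp
  qed
  have img: "coord c ` S = {t. vec2 t 0 \<in> img c}"
  proof (intro equalityI subsetI)
    fix t assume "t \<in> coord c ` S"
    then obtain s where "s \<in> S" "t = coord c s" by blast
    then show "t \<in> {t. vec2 t 0 \<in> img c}"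
      using coord_eq[OF c, of s] by (auto simp: S_def) (metis image_eqI)
  next
    fix t assume "t \<in> {t. vec2 t 0 \<in> img c}"
    then obtain m where m: "m \<in> fst c" "vec2 t 0 = snd c m" by blast
    have mB: "m \<in> B"
      unfolding surface_boundary_def using c m vec2_nth(2)[of t 0]
      by (intro CollectI bexI[OF _ c]) (simp add: case_prod_unfold)
    then obtain s where "\<phi> m = \<gamma> s" using boundary_image by blast
    moreover have "\<gamma> (frac s) = \<gamma> s"
      using \<gamma> by (auto simp: closed_curve_param_def frac_def)
    ultimately have l: "lift (frac s) = m" by (intro lift_eq mB) simp
    have "frac s \<in> S" using l m(1) frac_ge_0[of s] frac_lt_1[of s] by (simp add: S_def)
    moreover have "coord c (frac s) = t"
      using vec2_nth(1)[of t 0] by (simp add: coord_def l flip: m(2))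
    ultimately show "t \<in> coord c ` S" by blast
  qed
  have eq: "f (lift s) * norm (\<gamma>' s) = \<bar>coord' c s\<bar> * k (coord c s)" if "s \<in> S" for s
  proof -
    have l: "lift s \<in> fst c" using that by (simp add: S_def)
    have "par c f (vec2 (coord c s) 0) = f (lift s)"
      unfolding coord_eq[OF c l, symmetric] by (rule par_apply[OF c l])
    then show ?thesis unfolding curve_velocity[OF c l] k_def by simp
  qed
  have cv: "(\<lambda>s. \<bar>coord' c s\<bar> * k (coord c s)) absolutely_integrable_on S"
    "integral S (\<lambda>s. \<bar>coord' c s\<bar> * k (coord c s)) = integral {t. vec2 t 0 \<in> img c} k"
    using has_absolute_integral_change_of_variables_1'[OF leb der inj, of k "integral {t. vec2 t 0 \<in> img c} k"] k img by auto
  have "(\<lambda>s. f (lift s) * norm (\<gamma>' s)) absolutely_integrable_on S"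
    using cv(1) eq by (subst set_integrable_cong[OF refl refl]) auto
  moreover have "integral {t. vec2 t 0 \<in> img c} k = integral S (\<lambda>s. f (lift s) * norm (\<gamma>' s))"
    unfolding cv(2)[symmetric] using eq by (intro integral_cong) simp
  ultimately show "(\<lambda>s. f (lift s) * norm (\<gamma>' s)) absolutely_integrable_on {s\<in>{0..<1}. lift s \<in> fst c}"
    and "integral {t. vec2 t 0 \<in> img c} k = integral {s\<in>{0..<1}. lift s \<in> fst c} (\<lambda>s. f (lift s) * norm (\<gamma>' s))"
    unfolding S_def by blast+
qed

end

section \<open>A partition of unity subordinate to charts\<close>

text \<open>Squaring makes the positive part C1 across 0, where the difference quotient is bounded
  by the increment. The derivative vanishes wherever the function does, a property that the weights
  inherit.\<close>

lemma max_square_has_derivative: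
  "((\<lambda>t::real. (max 0 t)\<^sup>2) has_real_derivative 2 * max 0 t) (at t)"
proof -
  consider "t > 0" | "t < 0" | "t = 0" by linarith
  then show ?thesis
  proof cases
    case 1
    have "((\<lambda>t::real. t\<^sup>2) has_real_derivative 2 * t) (at t)"
      by (auto intro!: derivative_eq_intros)
    then have "((\<lambda>t::real. (max 0 t)\<^sup>2) has_real_derivative 2 * t) (at t)"
      by (rule DERIV_cong_ev[THEN iffD1, rotated -1])
        (use 1 eventually_nhds_in_open[of "{0<..}" t] in \<open>auto elim!: eventually_mono\<close>)
    then show ?thesis using 1 by simp
  next
    case 2
    have "((\<lambda>t::real. 0) has_real_derivative 0) (at t)" by simp
    then have "((\<lambda>t::real. (max 0 t)\<^sup>2) has_real_derivative 0) (at t)"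
      by (rule DERIV_cong_ev[THEN iffD1, rotated -1])
        (use 2 eventually_nhds_in_open[of "{..<0}" t] in \<open>auto elim!: eventually_mono\<close>)
    then show ?thesis using 2 by simp
  next
    case 3
    have "(\<lambda>h::real. (max 0 h)\<^sup>2 / h) \<midarrow>0\<rightarrow> 0"
    proof (rule tendsto_0_le[where K = 1])
      show "(\<lambda>h::real. h) \<midarrow>0\<rightarrow> 0" by simp
      show "\<forall>\<^sub>F h::real in at 0. norm ((max 0 h)\<^sup>2 / h) \<le> norm h * 1"
        by (rule always_eventually) (auto simp: max_def power2_eq_square)
    qed
    then show ?thesis using 3 by (simp add: DERIV_def)
  qed
qed

definition disc_bump :: "real^2 \<Rightarrow> real \<Rightarrow> real^2 \<Rightarrow> real" where
  "disc_bump q r z = (max 0 (r\<^sup>2 - (z - q) \<bullet> (z - q)))\<^sup>2"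

lemma disc_bump_has_derivative:
  "(disc_bump q r has_derivative (\<lambda>v. 2 * max 0 (r\<^sup>2 - (z - q) \<bullet> (z - q)) * (- (2 * ((z - q) \<bullet> v))))) (at z)"
proof -
  have "((\<lambda>z. r\<^sup>2 - (z - q) \<bullet> (z - q)) has_derivative (\<lambda>v. - (2 * ((z - q) \<bullet> v)))) (at z)"
    by (auto intro!: derivative_eq_intros simp: inner_commute)
  from has_derivative_compose[OF this max_square_has_derivative[unfolded has_field_derivative_def]]
  show ?thesis unfolding disc_bump_def[abs_def] .
qed

lemma disc_bump_eq_0: "r > 0 \<Longrightarrow> disc_bump q r z = 0 \<longleftrightarrow> z \<notin> ball q r"
proof -
  assume "r > 0"
  have "(z - q) \<bullet> (z - q) < r\<^sup>2 \<longleftrightarrow> norm (z - q) < r"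
    using \<open>r > 0\<close> by (auto simp flip: power2_norm_eq_inner intro: power_strict_mono power2_less_imp_less)
  then show ?thesis
    by (auto simp: disc_bump_def max_def dist_norm norm_minus_commute)
qed

section \<open>Bump functions on the surface\<close>

context immersed_surface
begin

definition chart_bump :: "'m chart \<Rightarrow> real^2 \<Rightarrow> real \<Rightarrow> 'm \<Rightarrow> real" where
  "chart_bump c q r m = (if m \<in> fst c then disc_bump q r (snd c m) else 0)"

lemma chart_bump_nonneg: "chart_bump c q r m \<ge> 0"
  by (simp add: chart_bump_def disc_bump_def)

lemma chart_bump_support:
  assumes c: "c \<in> A" and r: "r > 0" and m: "chart_bump c q r m \<noteq> 0"
  shows "m \<in> fst c" "snd c m \<in> cball q r \<inter> half_plane"
proof -
  show "m \<in> fst c" using m by (auto simp: chart_bump_def split: if_splits)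
  moreover have "img c \<subseteq> half_plane" using img_hp_open[OF c] openin_imp_subset by blast
  ultimately show "snd c m \<in> cball q r \<inter> half_plane"
    using m disc_bump_eq_0[OF r] by (auto simp: chart_bump_def less_imp_le)
qed

text \<open>Near a point of the chart \<open>c\<close> the bump is \<open>disc_bump\<close> composed
  with the transition map, and its derivative contains the factor \<open>max 0\<close>, hence
  vanishes with the bump. Near a point outside \<open>c\<close> the bump is zero: its support lies
  in the preimage of a closed disc, which is compact and therefore closed in the Hausdorff space
  \<open>T\<close>.\<close>

lemma chart_bump_local:
  assumes c: "c \<in> A" and r: "r > 0" "cball q r \<inter> half_plane \<subseteq> img c"
    and d: "d \<in> A" "m \<in> fst d"
  obtains S' h where "openin (top_of_set (img d)) S'" "snd d m \<in> S'"
    "\<And>z. z \<in> S' \<Longrightarrow> (par d (chart_bump c q r) has_derivative h z) (at z within S')"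
    "\<And>v. continuous_on S' (\<lambda>z. h z v)"
    "\<And>v. chart_bump c q r m = 0 \<Longrightarrow> h (snd d m) v = 0"
proof (cases "m \<in> fst c")
  case True
  define S' where "S' = overlap d c"
  define h where "h z v = 2 * max 0 (r\<^sup>2 - (trans d c z - q) \<bullet> (trans d c z - q)) * (- (2 * ((trans d c z - q) \<bullet> dtrans d c z v)))" for z v
  have op: "openin (top_of_set (img d)) S'" unfolding S'_def by (rule overlap_openin[OF d(1) c])
  have hp: "hp_open S'" unfolding S'_def by (rule overlap_hp_open[OF d(1) c])
  have C1: "C1_on S' (trans d c)" unfolding S'_def by (rule C1_trans[OF d(1) c])
  have eq: "par d (chart_bump c q r) z = disc_bump q r (trans d c z)" if z: "z \<in> S'" for z
  proof -
    obtain n where n: "n \<in> fst d" "n \<in> fst c" "z = snd d n" using z unfolding S'_def by blast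
    show ?thesis unfolding n(3) par_apply[OF d(1) n(1)] using n(2) by (simp add: chart_bump_def)
  qed
  have der: "(par d (chart_bump c q r) has_derivative h z) (at z within S')" if z: "z \<in> S'" for z
  proof -
    have "((\<lambda>z. disc_bump q r (trans d c z)) has_derivative h z) (at z within S')"
      unfolding h_def S'_def by (rule has_derivative_compose[OF C1_onD[OF C1[unfolded S'_def]] disc_bump_has_derivative])
        (use z in \<open>simp add: S'_def\<close>)
    then show ?thesis
      by (rule has_derivative_transform[rotated 2]) (use z eq in auto)
  qed
  have cont: "continuous_on S' (\<lambda>z. h z v)" for v
    using C1_on_continuous[OF C1] C1_on_continuous_dir[OF C1, of v] unfolding h_def S'_def
    by (intro continuous_intros)
  have zero: "h (snd d m) v = 0" if b: "chart_bump c q r m = 0" for v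
  proof -
    have "trans d c (snd d m) = snd c m" by (rule par_apply[OF d])
    moreover have "max 0 (r\<^sup>2 - (snd c m - q) \<bullet> (snd c m - q)) = 0"
      using b True by (simp add: chart_bump_def disc_bump_def)
    ultimately show ?thesis unfolding h_def by simp
  qed
  have "snd d m \<in> S'" using d(2) True by (auto simp: S'_def)
  from that[OF op this der cont zero] show ?thesis .
next
  case False
  define K where "K = inv_into (fst c) (snd c) ` (cball q r \<inter> half_plane)"
  have "closed half_plane" unfolding half_plane_def by (rule closed_halfspace_component_ge_cart)
  then have "compactin (top_of_set (img c)) (cball q r \<inter> half_plane)"
    using r(2) by (simp add: compactin_subtopology compact_Int_closed)
  then have "compactin T K"
    unfolding K_def by (rule image_compactin[OF _ chart_inverse_continuous[OF c]])
  then have K: "closedin T K" using hausdorff compactin_imp_closedin by blast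
  have Kc: "K \<subseteq> fst c"
    unfolding K_def using r(2) inv_into_into by (metis image_subsetI subset_iff)
  define O' where "O' = fst d - K"
  have "openin T O'" unfolding O'_def using chart_open[OF d(1)] K by (rule openin_diff)
  then have op: "openin (top_of_set (img d)) (snd d ` O')"
    using img_openin[OF d(1)] by (simp add: O'_def)
  have 0: "chart_bump c q r n = 0" if "n \<in> O'" for n
  proof (rule ccontr)
    assume "chart_bump c q r n \<noteq> 0"
    from chart_bump_support[OF c r(1) this] have "n \<in> K"
      unfolding K_def using inv_into_f_f[OF chart_inj[OF c]] by (metis image_eqI)
    then show False using that by (simp add: O'_def)
  qed
  have der: "(par d (chart_bump c q r) has_derivative (\<lambda>_. 0)) (at z within snd d ` O')" if z: "z \<in> snd d ` O'" for z
  proof (rule has_derivative_transform[OF z _ has_derivative_const])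
    fix w assume "w \<in> snd d ` O'"
    then obtain n where n: "n \<in> O'" "w = snd d n" by blast
    then have "n \<in> fst d" by (simp add: O'_def)
    from par_apply[OF d(1) this] show "par d (chart_bump c q r) w = 0" using 0 n by metis
  qed
  have "snd d m \<in> snd d ` O'" using d(2) False Kc by (auto simp: O'_def)
  from that[OF op this der] show ?thesis by simp
qed

lemma
  assumes c: "c \<in> A" and r: "r > 0" "cball q r \<inter> half_plane \<subseteq> img c" and d: "d \<in> A"
  shows C1_chart_bump: "C1_on (img d) (par d (chart_bump c q r))"
    and dir_chart_bump: "m \<in> fst d \<Longrightarrow> chart_bump c q r m = 0 \<Longrightarrow> dir (img d) v (par d (chart_bump c q r)) (snd d m) = 0"
proof -
  show "C1_on (img d) (par d (chart_bump c q r))"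
  proof (rule C1_on_local)
    fix z assume "z \<in> img d"
    then obtain m where m: "m \<in> fst d" "z = snd d m" by blast
    obtain S' h where S': "openin (top_of_set (img d)) S'" "snd d m \<in> S'"
      and h: "\<And>z. z \<in> S' \<Longrightarrow> (par d (chart_bump c q r) has_derivative h z) (at z within S')"
        "\<And>v. continuous_on S' (\<lambda>z. h z v)"
      using chart_bump_local[OF c r d m(1)] by metis
    have "C1_on S' (par d (chart_bump c q r))"
      by (rule C1_onI[OF hp_open_subset[OF img_hp_open[OF d] S'(1)] h])
    then show "\<exists>S'. openin (top_of_set (img d)) S' \<and> z \<in> S' \<and> C1_on S' (par d (chart_bump c q r))"
      using S' m by blast
  qed
  show "dir (img d) v (par d (chart_bump c q r)) (snd d m) = 0" if m: "m \<in> fst d" and 0: "chart_bump c q r m = 0"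
  proof -
    obtain S' h where S': "openin (top_of_set (img d)) S'" "snd d m \<in> S'"
      and h: "\<And>z. z \<in> S' \<Longrightarrow> (par d (chart_bump c q r) has_derivative h z) (at z within S')"
        "\<And>v. h (snd d m) v = 0"
      using chart_bump_local[OF c r d m] 0 by metis
    have "frechet_derivative (par d (chart_bump c q r)) (at (snd d m) within S') = h (snd d m)"
      by (rule frechet_derivative_hp_open[OF hp_open_subset[OF img_hp_open[OF d] S'(1)] S'(2) h(1)[OF S'(2)]])
    then show ?thesis using dir_openin[OF S'] h(2) by metis
  qed
qed

lemma chart_bump_open: 
  assumes c: "c \<in> A" and r: "r > 0"
  shows "openin T {m. chart_bump c q r m \<noteq> 0}"
proof -
  have "openin (subtopology T (fst c)) {m \<in> topspace (subtopology T (fst c)). snd c m \<in> ball q r}"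
    by (rule openin_continuous_map_preimage[OF chart_continuous[OF c]]) simp
  moreover have "{m \<in> topspace (subtopology T (fst c)). snd c m \<in> ball q r} = {m. chart_bump c q r m \<noteq> 0}"
    unfolding topspace_chart[OF c] by (auto simp: chart_bump_def disc_bump_eq_0[OF r])
  ultimately show ?thesis
    using openin_open_subtopology[OF chart_open[OF c]] by metis
qed

text \<open>Finitely many bumps are divided by their sum. The vanishing of the derivative at every
  zero of a weight is recorded because it makes the weighted divergence vanish there too, in every
  chart.\<close>

theorem partition_of_unity:
  assumes "compact_space T"
  obtains I :: "'m set" and c :: "'m \<Rightarrow> 'm chart" and K :: "'m \<Rightarrow> (real^2) set" and \<rho> :: "'m \<Rightarrow> 'm \<Rightarrow> real"
  where "finite I" "\<And>i. i \<in> I \<Longrightarrow> c i \<in> A" "\<And>i. i \<in> I \<Longrightarrow> compact (K i)" "\<And>i. i \<in> I \<Longrightarrow> K i \<subseteq> img (c i)"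
    "\<And>i m. i \<in> I \<Longrightarrow> \<rho> i m \<ge> 0"
    "\<And>i m. i \<in> I \<Longrightarrow> \<rho> i m \<noteq> 0 \<Longrightarrow> m \<in> fst (c i) \<and> snd (c i) m \<in> K i"
    "\<And>i d. i \<in> I \<Longrightarrow> d \<in> A \<Longrightarrow> C1_on (img d) (par d (\<rho> i))"
    "\<And>i d m v. i \<in> I \<Longrightarrow> d \<in> A \<Longrightarrow> m \<in> fst d \<Longrightarrow> \<rho> i m = 0 \<Longrightarrow> dir (img d) v (par d (\<rho> i)) (snd d m) = 0"
    "\<And>m. m \<in> topspace T \<Longrightarrow> (\<Sum>i\<in>I. \<rho> i m) = 1"
proof -
  have "\<exists>c q r. c \<in> A \<and> r > 0 \<and> cball q r \<inter> half_plane \<subseteq> img c \<and> chart_bump c q r m \<noteq> 0" if m: "m \<in> topspace T" for m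
  proof -
    obtain c where c: "c \<in> A" "m \<in> fst c" using m charts_cover by fastforce
    obtain V where V: "open V" "img c = half_plane \<inter> V"
      using img_hp_open[OF c(1)] by (auto simp: openin_open)
    have "snd c m \<in> V" using V(2) c(2) by blast
    then obtain r where r: "r > 0" "cball (snd c m) r \<subseteq> V"
      using V(1) open_contains_cball by blast
    then have "chart_bump c (snd c m) r m \<noteq> 0"
      using c(2) by (simp add: chart_bump_def disc_bump_eq_0)
    then show ?thesis using c r V by blast
  qed
  then obtain c q r where cqr: "\<And>m. m \<in> topspace T \<Longrightarrow> c m \<in> A" "\<And>m. m \<in> topspace T \<Longrightarrow> r m > 0"
    "\<And>m. m \<in> topspace T \<Longrightarrow> cball (q m) (r m) \<inter> half_plane \<subseteq> img (c m)"
    "\<And>m. m \<in> topspace T \<Longrightarrow> chart_bump (c m) (q m) (r m) m \<noteq> 0"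
    by metis
  define b where "b i = chart_bump (c i) (q i) (r i)" for i
  define \<U> where "\<U> = (\<lambda>i. {m. b i m \<noteq> 0}) ` topspace T"
  have "compactin T (topspace T)" using assms by (simp add: compact_space_def)
  moreover have "openin T U" if "U \<in> \<U>" for U
    using that chart_bump_open cqr unfolding \<U>_def b_def by blast
  moreover have "topspace T \<subseteq> \<Union>\<U>"
    using cqr(4) unfolding \<U>_def b_def by blast
  ultimately obtain \<F> where \<F>: "finite \<F>" "\<F> \<subseteq> \<U>" "topspace T \<subseteq> \<Union>\<F>"
    using compactinD by metis
  then obtain I where I: "finite I" "I \<subseteq> topspace T" "topspace T \<subseteq> (\<Union>i\<in>I. {m. b i m \<noteq> 0})"
    using finite_subset_image[OF \<F>(1) \<F>(2)[unfolded \<U>_def]] by auto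
  have iT: "i \<in> topspace T" if "i \<in> I" for i using that I(2) by blast
  define \<sigma> where "\<sigma> m = (\<Sum>i\<in>I. b i m)" for m
  have b0: "b i m \<ge> 0" for i m unfolding b_def by (rule chart_bump_nonneg)
  have \<sigma>: "\<sigma> m > 0" if m: "m \<in> topspace T" for m
  proof -
    obtain i where "i \<in> I" "b i m \<noteq> 0" using I(3) m by blast
    then show ?thesis unfolding \<sigma>_def using b0[of i m] by (intro sum_pos2[OF I(1)] b0) auto
  qed
  have C1b: "C1_on (img d) (par d (b i))" if "i \<in> I" "d \<in> A" for i d
    unfolding b_def using C1_chart_bump cqr(1-3)[OF iT[OF that(1)]] that(2) by blast
  have par\<sigma>: "par d \<sigma> = (\<lambda>z. \<Sum>i\<in>I. par d (b i) z)" for d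
    by (simp add: fun_eq_iff \<sigma>_def)
  have C1\<sigma>: "C1_on (img d) (par d \<sigma>)" if "d \<in> A" for d
    unfolding par\<sigma> using C1b that by (intro C1_on_sum img_hp_open)
  have \<sigma>img: "par d \<sigma> z > 0" if d: "d \<in> A" and z: "z \<in> img d" for d z
  proof -
    obtain m where m: "m \<in> fst d" "z = snd d m" using z by blast
    show ?thesis unfolding m(2) par_apply[OF d m(1)] using \<sigma> chart_subset[OF d] m(1) by blast
  qed
  define \<rho> where "\<rho> i m = b i m * inverse (\<sigma> m)" for i m
  have par\<rho>: "par d (\<rho> i) = (\<lambda>z. par d (b i) z * inverse (par d \<sigma> z))" for d i
    by (simp add: fun_eq_iff \<rho>_def)
  show ?thesis
  proof (rule that[of I c "\<lambda>i. cball (q i) (r i) \<inter> half_plane" \<rho>])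
    show "finite I" by fact
    show "c i \<in> A" "cball (q i) (r i) \<inter> half_plane \<subseteq> img (c i)" if "i \<in> I" for i
      using cqr(1,3) iT[OF that] by auto
    have "closed half_plane" unfolding half_plane_def by (rule closed_halfspace_component_ge_cart)
    then show "compact (cball (q i) (r i) \<inter> half_plane)" for i by (simp add: compact_Int_closed)
    show "m \<in> fst (c i) \<and> snd (c i) m \<in> cball (q i) (r i) \<inter> half_plane" if "i \<in> I" "\<rho> i m \<noteq> 0" for i m
      using chart_bump_support[OF cqr(1,2)[OF iT[OF that(1)]], of "q i" m] that(2) unfolding \<rho>_def b_def by auto
    show "0 \<le> \<rho> i m" for i m
      unfolding \<rho>_def using b0 sum_nonneg[of I "\<lambda>i. b i m"] by (simp add: \<sigma>_def)
    show "C1_on (img d) (par d (\<rho> i))" if "i \<in> I" "d \<in> A" for i d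
      unfolding par\<rho> using that \<sigma>img[OF that(2)] by (intro C1_on_mult C1_on_inverse C1b C1\<sigma> img_hp_open) auto
    show "dir (img d) v (par d (\<rho> i)) (snd d m) = 0" if i: "i \<in> I" and d: "d \<in> A" "m \<in> fst d" and 0: "\<rho> i m = 0" for i d m v
    proof -
      have "\<sigma> m > 0" using \<sigma> chart_subset[OF d(1)] d(2) by blast
      \<comment> \<open>As \<open>\<sigma>\<close> is positive, \<open>\<rho> i\<close> and
        \<open>b i\<close> have the same zeros, and each summand of the product rule contains the
        value or the derivative of \<open>b i\<close>.\<close>
      then have b: "b i m = 0" using 0 by (simp add: \<rho>_def)
      then have "dir (img d) v (par d (b i)) (snd d m) = 0"
        unfolding b_def using dir_chart_bump cqr(1-3)[OF iT[OF i]] d by blast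
      moreover have "par d (b i) (snd d m) = 0" unfolding par_apply[OF d] by fact
      ultimately show ?thesis
        unfolding par\<rho> using d(2)
        by (subst dir_mult[OF img_hp_open[OF d(1)] C1b[OF i d(1)] C1_on_inverse[OF img_hp_open[OF d(1)] C1\<sigma>[OF d(1)] \<sigma>img[OF d(1)]]]) auto
    qed
    show "(\<Sum>i\<in>I. \<rho> i m) = 1" if "m \<in> topspace T" for m
    proof -
      have "(\<Sum>i\<in>I. \<rho> i m) = \<sigma> m * inverse (\<sigma> m)"
        unfolding \<rho>_def \<sigma>_def[of m] by (simp add: sum_distrib_right)
      then show ?thesis using \<sigma>[OF that] by simp
    qed
  qed
qed

end

section \<open>The area estimate\<close>

lemma integral_support_cong:
  fixes f :: "'a::euclidean_space \<Rightarrow> real"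
  assumes "\<And>x. x \<in> S - S' \<Longrightarrow> f x = 0" "\<And>x. x \<in> S' - S \<Longrightarrow> f x = 0"
  shows "integral S f = integral S' f"
  by (rule integral_spike_set; rule negligible_subset[OF negligible_empty]) (use assms in auto)

lemma absolutely_integrable_nn_integral:
  fixes f :: "'a::euclidean_space \<Rightarrow> real"
  assumes "f absolutely_integrable_on S" "\<And>x. x \<in> S \<Longrightarrow> f x \<ge> 0"
  shows "(\<integral>\<^sup>+x\<in>S. ennreal (f x) \<partial>lebesgue) = ennreal (integral S f)"
    and "(\<lambda>x. ennreal (f x) * indicator S x) \<in> borel_measurable lebesgue"
proof -
  have int: "integrable lebesgue (\<lambda>x. indicator S x *\<^sub>R f x)"
    using assms(1) by (simp add: set_integrable_def)
  have eq: "ennreal (f x) * indicator S x = ennreal (indicator S x *\<^sub>R f x)" for x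
    by (simp add: indicator_def)
  have "(\<integral>\<^sup>+x. ennreal (indicator S x *\<^sub>R f x) \<partial>lebesgue) = ennreal (LINT x|lebesgue. indicator S x *\<^sub>R f x)"
    using assms(2) by (intro nn_integral_eq_integral[OF int]) (auto simp: indicator_def)
  then show "(\<integral>\<^sup>+x\<in>S. ennreal (f x) \<partial>lebesgue) = ennreal (integral S f)"
    unfolding eq using set_lebesgue_integral_eq_integral(2)[OF assms(1)] by (simp add: set_lebesgue_integral_def)
  show "(\<lambda>x. ennreal (f x) * indicator S x) \<in> borel_measurable lebesgue"
    unfolding eq using int by (intro measurable_compose[OF _ measurable_ennreal] borel_measurable_integrable)
qed

lemma hp_open_lebesgue: "hp_open S \<Longrightarrow> S \<in> sets lebesgue"
proof -
  assume "hp_open S"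
  then obtain W where W: "open W" "S = half_plane \<inter> W" by (auto simp: openin_open)
  have "closed half_plane" unfolding half_plane_def by (rule closed_halfspace_component_ge_cart)
  then show ?thesis unfolding W(2) using W(1) by (intro sets.Int) (simp_all add: borel_closed borel_open)
qed

lemma closed_curve_range_compact:
  assumes "closed_curve_param \<gamma>"
  shows "compact (range \<gamma>)"
proof -
  have "range \<gamma> = \<gamma> ` {0..1}"
  proof (intro equalityI subsetI)
    fix x assume "x \<in> range \<gamma>"
    then obtain s where "x = \<gamma> s" by blast
    moreover have "\<gamma> (frac s) = \<gamma> s"
      using assms by (auto simp: closed_curve_param_def frac_def)
    ultimately show "x \<in> \<gamma> ` {0..1}"
      using frac_ge_0[of s] frac_lt_1[of s] by (intro image_eqI[of _ _ "frac s"]) auto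
  qed auto
  then show ?thesis
    using compact_continuous_image[OF closed_curve_continuous[OF assms]] by (metis compact_Icc)
qed

section \<open>Area against a partition of unity\<close>

context immersed_surface
begin

text \<open>Both integrands vanish off the overlap of the charts, so both integrals reduce to it,
  where the Jacobian rule applies.\<close>

lemma integral_transfer:
  fixes k k' :: "real^2 \<Rightarrow> real"
  assumes cd: "c \<in> A" "d \<in> A"
    and k': "k' absolutely_integrable_on img d"
    and 0: "\<And>m. m \<in> fst c - fst d \<Longrightarrow> k (snd c m) = 0" "\<And>m. m \<in> fst d - fst c \<Longrightarrow> k' (snd d m) = 0"
    and k: "\<And>m. m \<in> fst c \<inter> fst d \<Longrightarrow> k (snd c m) = \<bar>det (matrix (dtrans c d (snd c m)))\<bar> * k' (snd d m)"
  shows "integral (img c) k = integral (img d) k'"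
proof -
  have com: "overlap d c = snd d ` (fst c \<inter> fst d)" by (simp add: Int_commute)
  have "integral (img c) k = integral (overlap c d) k"
    by (rule integral_support_cong) (use 0(1) in auto)
  also have "\<dots> = integral (snd d ` (fst c \<inter> fst d)) k'"
  proof (rule chart_change_of_variables(2)[OF cd order_refl hp_open_lebesgue[OF overlap_hp_open[OF cd]] _ k])
    show "k' absolutely_integrable_on snd d ` (fst c \<inter> fst d)"
      using hp_open_lebesgue[OF overlap_hp_open[OF cd(2,1)]]
      unfolding com by (rule set_integrable_subset[OF k']) blast
  qed
  also have "\<dots> = integral (img d) k'"
    by (rule integral_support_cong) (use 0(2) in auto)
  finally show ?thesis .
qed

text \<open>The area is a supremum, so it is enough to bound every decomposition. A piece in chart
  \<open>d\<close> is split by the weights and its share of \<open>\<rho> i\<close> is moved to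
  chart \<open>c i\<close>; there the pieces are still disjoint, so their total is at most the
  integral over the whole image.\<close>

lemma surface_area_le:
  assumes I: "finite I" "\<And>i. i \<in> I \<Longrightarrow> c i \<in> A"
    and \<rho>: "\<And>i m. i \<in> I \<Longrightarrow> \<rho> i m \<ge> 0" "\<And>i m. i \<in> I \<Longrightarrow> m \<notin> fst (c i) \<Longrightarrow> \<rho> i m = 0"
      "\<And>m. m \<in> topspace T \<Longrightarrow> (\<Sum>i\<in>I. \<rho> i m) = 1"
    and int: "\<And>i. i \<in> I \<Longrightarrow>
      (\<lambda>z. par (c i) (\<rho> i) z * area_density (img (c i)) (par (c i) \<phi>) z) absolutely_integrable_on img (c i)"
  shows "surface_area A \<phi> \<le> ennreal (\<Sum>i\<in>I. integral (img (c i)) (\<lambda>z. par (c i) (\<rho> i) z * area_density (img (c i)) (par (c i) \<phi>) z))"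
proof -
  define w where "w i d z = par d (\<rho> i) z * area_density (img d) (par d \<phi>) z" for i d z
  have W0: "area_density (img d) (par d \<phi>) z \<ge> 0" if "d \<in> A" "z \<in> img d" for d z
    using param_surface.W_pos[OF param[OF that(1)] that(2)] by simp
  have w0: "w i d z \<ge> 0" if "i \<in> I" "d \<in> A" "z \<in> img d" for i d z
    using \<rho>(1)[OF that(1)] W0[OF that(2,3)] unfolding w_def by simp
  have change: "(\<integral>\<^sup>+z\<in>snd d ` E. ennreal (w i d z) \<partial>lebesgue) = (\<integral>\<^sup>+z\<in>snd (c i) ` E. ennreal (w i (c i) z) \<partial>lebesgue)"
    "(\<lambda>z. ennreal (w i d z) * indicator (snd d ` E) z) \<in> borel_measurable lebesgue"
    "(\<lambda>z. ennreal (w i (c i) z) * indicator (snd (c i) ` E) z) \<in> borel_measurable lebesgue"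
    if i: "i \<in> I" and d: "d \<in> A" and E: "E \<subseteq> fst d \<inter> fst (c i)" "snd d ` E \<in> sets lebesgue" for i d E
  proof -
    have c: "c i \<in> A" using I(2)[OF i] .
    have "snd (c i) ` E \<in> sets lebesgue" by (rule chart_image_lebesgue[OF d c E])
    then have int': "w i (c i) absolutely_integrable_on snd (c i) ` E"
      using set_integrable_subset[OF int[OF i, folded w_def]] E(1) by blast
    have k: "w i d (snd d m) = \<bar>det (matrix (dtrans d (c i) (snd d m)))\<bar> * w i (c i) (snd (c i) m)" if "m \<in> E" for m
    proof -
      have m: "m \<in> fst d" "m \<in> fst (c i)" using that E(1) by auto
      show ?thesis
        unfolding w_def area_density_transition[OF d c m] par_apply[OF d m(1)] par_apply[OF c m(2)] by simp
    qed
    note cv = chart_change_of_variables[OF d c E int' k]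
    have nn: "w i d z \<ge> 0" if "z \<in> snd d ` E" for z using that w0[OF i d] E(1) by auto
    have nn': "w i (c i) z \<ge> 0" if "z \<in> snd (c i) ` E" for z using that w0[OF i c] E(1) by auto
    show "(\<integral>\<^sup>+z\<in>snd d ` E. ennreal (w i d z) \<partial>lebesgue) = (\<integral>\<^sup>+z\<in>snd (c i) ` E. ennreal (w i (c i) z) \<partial>lebesgue)"
      using absolutely_integrable_nn_integral(1)[OF cv(1) nn] absolutely_integrable_nn_integral(1)[OF int' nn'] cv(2)
      by simp
    show "(\<lambda>z. ennreal (w i d z) * indicator (snd d ` E) z) \<in> borel_measurable lebesgue"
      by (rule absolutely_integrable_nn_integral(2)[OF cv(1) nn])
    show "(\<lambda>z. ennreal (w i (c i) z) * indicator (snd (c i) ` E) z) \<in> borel_measurable lebesgue"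
      by (rule absolutely_integrable_nn_integral(2)[OF int' nn'])
  qed
  have bound: "(\<Sum>(U, x)\<in>F. \<integral>\<^sup>+q\<in>x ` P (U, x). ennreal (area_density (x ` U) (\<phi> \<circ> inv_into U x) q) \<partial>lborel)
      \<le> (\<Sum>i\<in>I. ennreal (integral (img (c i)) (w i (c i))))"
    if FP: "(F, P) \<in> chart_decompositions A" for F P
  proof -
    have F: "finite F" "F \<subseteq> A" "disjoint_family_on P F"
      using FP by (auto simp: chart_decompositions_def)
    have P: "P d \<subseteq> fst d" "snd d ` P d \<in> sets borel" if "d \<in> F" for d
      using FP that by (auto simp: chart_decompositions_def case_prod_unfold)
    \<comment> \<open>The part of the piece that chart \<open>c i\<close> sees;
      \<open>\<rho> i\<close> vanishes on the rest.\<close>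
    define E where "E i d = P d \<inter> fst (c i)" for i d
    have E: "E i d \<subseteq> fst d \<inter> fst (c i)" "snd d ` E i d \<in> sets lebesgue" if "d \<in> F" "i \<in> I" for i d
    proof -
      have d: "d \<in> A" "c i \<in> A" using that F(2) I(2) by auto
      show "E i d \<subseteq> fst d \<inter> fst (c i)" using P(1)[OF that(1)] by (auto simp: E_def)
      have "snd d ` E i d = snd d ` P d \<inter> overlap d (c i)"
        unfolding E_def using chart_inj[OF d(1)] P(1)[OF that(1)] by (auto simp: inj_on_def)
      moreover have "snd d ` P d \<in> sets lebesgue"
        using P(2)[OF that(1)] by (intro sets_completionI_sets) simp
      ultimately show "snd d ` E i d \<in> sets lebesgue"
        using hp_open_lebesgue[OF overlap_hp_open[OF d]] by (metis sets.Int)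
    qed
    have piece: "(\<integral>\<^sup>+q\<in>snd d ` P d. ennreal (area_density (img d) (par d \<phi>) q) \<partial>lborel) =
        (\<Sum>i\<in>I. \<integral>\<^sup>+z\<in>snd (c i) ` E i d. ennreal (w i (c i) z) \<partial>lebesgue)" if d: "d \<in> F" for d
    proof -
      have dA: "d \<in> A" using d F(2) by blast
      have pt: "ennreal (area_density (img d) (par d \<phi>) q) * indicator (snd d ` P d) q =
          (\<Sum>i\<in>I. ennreal (w i d q) * indicator (snd d ` E i d) q)" for q
      proof (cases "q \<in> snd d ` P d")
        case True
        then obtain m where m: "m \<in> P d" "q = snd d m" by blast
        have md: "m \<in> fst d" using P(1)[OF d] m(1) by blast
        have "ennreal (w i d q) * indicator (snd d ` E i d) q = ennreal (\<rho> i m * area_density (img d) (par d \<phi>) q)" if i: "i \<in> I" for i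
        proof -
          have w: "w i d q = \<rho> i m * area_density (img d) (par d \<phi>) q"
            unfolding w_def m(2) par_apply[OF dA md] ..
          show ?thesis
          proof (cases "m \<in> fst (c i)")
            case True
            then have "q \<in> snd d ` E i d" using m by (auto simp: E_def)
            then show ?thesis using w by simp
          next
            case False
            then show ?thesis using \<rho>(2)[OF i] w by simp
          qed
        qed
        then have "(\<Sum>i\<in>I. ennreal (w i d q) * indicator (snd d ` E i d) q) = (\<Sum>i\<in>I. ennreal (\<rho> i m * area_density (img d) (par d \<phi>) q))"
          by (intro sum.cong) auto
        also have "\<dots> = ennreal (\<Sum>i\<in>I. \<rho> i m * area_density (img d) (par d \<phi>) q)"
          by (rule sum_ennreal) (use \<rho>(1) W0[OF dA] md m(2) in simp)
        also have "(\<Sum>i\<in>I. \<rho> i m * area_density (img d) (par d \<phi>) q) = area_density (img d) (par d \<phi>) q"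
          using \<rho>(3)[of m] chart_subset[OF dA] md by (auto simp flip: sum_distrib_right)
        finally show ?thesis using True by simp
      next
        case False
        then have "q \<notin> snd d ` E i d" for i by (auto simp: E_def)
        then show ?thesis using False by simp
      qed
      have "(\<integral>\<^sup>+q\<in>snd d ` P d. ennreal (area_density (img d) (par d \<phi>) q) \<partial>lborel) =
          (\<integral>\<^sup>+q. (\<Sum>i\<in>I. ennreal (w i d q) * indicator (snd d ` E i d) q) \<partial>lebesgue)"
        unfolding pt by (simp add: nn_integral_completion)
      also have "\<dots> = (\<Sum>i\<in>I. \<integral>\<^sup>+z\<in>snd d ` E i d. ennreal (w i d z) \<partial>lebesgue)"
        by (rule nn_integral_sum) (rule change(2)[OF _ dA E[OF d]])
      also have "\<dots> = (\<Sum>i\<in>I. \<integral>\<^sup>+z\<in>snd (c i) ` E i d. ennreal (w i (c i) z) \<partial>lebesgue)"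
        by (rule sum.cong[OF refl]) (rule change(1)[OF _ dA E[OF d]])
      finally show ?thesis .
    qed
    have "(\<Sum>(U, x)\<in>F. \<integral>\<^sup>+q\<in>x ` P (U, x). ennreal (area_density (x ` U) (\<phi> \<circ> inv_into U x) q) \<partial>lborel) =
        (\<Sum>d\<in>F. \<integral>\<^sup>+q\<in>snd d ` P d. ennreal (area_density (img d) (par d \<phi>) q) \<partial>lborel)"
      by (simp add: case_prod_unfold)
    also have "\<dots> = (\<Sum>d\<in>F. \<Sum>i\<in>I. \<integral>\<^sup>+z\<in>snd (c i) ` E i d. ennreal (w i (c i) z) \<partial>lebesgue)"
      using piece by (intro sum.cong) auto
    also have "\<dots> = (\<Sum>i\<in>I. \<Sum>d\<in>F. \<integral>\<^sup>+z\<in>snd (c i) ` E i d. ennreal (w i (c i) z) \<partial>lebesgue)"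
      by (rule sum.swap)
    also have "\<dots> \<le> (\<Sum>i\<in>I. ennreal (integral (img (c i)) (w i (c i))))"
    proof (rule sum_mono)
      fix i assume i: "i \<in> I"
      have ci: "c i \<in> A" using I(2)[OF i] .
      \<comment> \<open>Chart maps are injective, so pieces that are disjoint on the surface stay
        disjoint in the image.\<close>
      have disj: "disjoint_family_on (\<lambda>d. snd (c i) ` E i d) F"
        unfolding disjoint_family_on_def
      proof (intro ballI impI)
        fix d d' assume dd: "d \<in> F" "d' \<in> F" "d \<noteq> d'"
        have "E i d \<inter> E i d' = {}" using F(3) dd by (auto simp: disjoint_family_on_def E_def)
        moreover have "snd (c i) ` (E i d \<inter> E i d') = snd (c i) ` E i d \<inter> snd (c i) ` E i d'"
          by (rule inj_on_image_Int[OF chart_inj[OF ci]]) (auto simp: E_def)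
        ultimately show "snd (c i) ` E i d \<inter> snd (c i) ` E i d' = {}" by simp
      qed
      have "(\<Sum>d\<in>F. \<integral>\<^sup>+z\<in>snd (c i) ` E i d. ennreal (w i (c i) z) \<partial>lebesgue) =
          (\<integral>\<^sup>+z. (\<Sum>d\<in>F. ennreal (w i (c i) z) * indicator (snd (c i) ` E i d) z) \<partial>lebesgue)"
        using F(2) by (intro nn_integral_sum[symmetric] change(3)[OF i _ E[OF _ i]]) auto
      also have "\<dots> = (\<integral>\<^sup>+z\<in>(\<Union>d\<in>F. snd (c i) ` E i d). ennreal (w i (c i) z) \<partial>lebesgue)"
        by (simp add: indicator_UN_disjoint[OF F(1) disj] flip: sum_distrib_left)
      also have "\<dots> \<le> (\<integral>\<^sup>+z\<in>img (c i). ennreal (w i (c i) z) \<partial>lebesgue)"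
        by (rule nn_set_integral_set_mono) (auto simp: E_def)
      also have "\<dots> = ennreal (integral (img (c i)) (w i (c i)))"
        by (rule absolutely_integrable_nn_integral(1)[OF int[OF i, folded w_def] w0[OF i ci]])
      finally show "(\<Sum>d\<in>F. \<integral>\<^sup>+z\<in>snd (c i) ` E i d. ennreal (w i (c i) z) \<partial>lebesgue) \<le> ennreal (integral (img (c i)) (w i (c i)))" .
    qed
    finally show ?thesis .
  qed
  have "surface_area A \<phi> \<le> (\<Sum>i\<in>I. ennreal (integral (img (c i)) (w i (c i))))"
    unfolding surface_area_def by (rule SUP_least) (use bound in auto)
  also have "\<dots> = ennreal (\<Sum>i\<in>I. integral (img (c i)) (w i (c i)))"
  proof (rule sum_ennreal)
    fix i assume "i \<in> I"
    then show "0 \<le> integral (img (c i)) (w i (c i))"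
      using w0 I(2) int[folded w_def] by (intro integral_nonneg) (auto simp: absolutely_integrable_on_def)
  qed
  finally show ?thesis unfolding w_def[abs_def] .
qed

end

section \<open>Flux through the boundary and the final estimate\<close>

locale bounded_singular_surface =
  bounded_surface T A \<phi> \<gamma> + singular_minimal_surface T A \<phi> \<alpha> a
  for T :: "'m topology" and A :: "'m chart set" and \<phi> :: "'m \<Rightarrow> real^3" and \<gamma> and \<alpha> a
begin

lemma height_pos: "m \<in> topspace T \<Longrightarrow> \<phi> m \<bullet> a > 0"
  using in_half_space by (auto simp: open_half_space_def)

text \<open>The divergence theorem in one chart for r u \<nabla>u, whose only boundary term sits on
  the boundary line. There the flux density is at most r u times the line element, and substitution
  turns the result into an integral along the curve.\<close>

lemma chart_flux_le:
  assumes c: "c \<in> A" and r: "C1_on (img c) (par c r)" "\<And>m. r m \<ge> 0"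
    and K: "compact K" "K \<subseteq> img c" "\<And>m. r m \<noteq> 0 \<Longrightarrow> m \<in> fst c \<and> snd c m \<in> K"
  shows "integral (img c) (flux_div \<alpha> a c r) \<le> integral {s\<in>{0..<1}. lift s \<in> fst c} (\<lambda>s. r (lift s) * (\<phi> (lift s) \<bullet> a) * norm (\<gamma>' s))"
    and "(\<lambda>s. r (lift s) * (\<phi> (lift s) \<bullet> a) * norm (\<gamma>' s)) absolutely_integrable_on {s\<in>{0..<1}. lift s \<in> fst c}"
proof -
  interpret c: param_surface "img c" "par c \<phi>" using param[OF c] .
  define F\<^sub>1 where "F\<^sub>1 z = par c r z * (par c \<phi> z \<bullet> a) * (c.E\<^sub>1 z \<bullet> a)" for z
  define F\<^sub>2 where "F\<^sub>2 z = par c r z * (par c \<phi> z \<bullet> a) * (c.E\<^sub>2 z \<bullet> a)" for z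
  define f where "f m = r m * (\<phi> m \<bullet> a)" for m
  define k where "k t = par c f (vec2 t 0) * norm (c.p (vec2 t 0))" for t
  define J where "J = {t. vec2 t 0 \<in> img c}"
  have F: "C1_on (img c) F\<^sub>1" "C1_on (img c) F\<^sub>2"
    unfolding F\<^sub>1_def[abs_def] F\<^sub>2_def[abs_def] by (intro c.C1_flux r(1) a_unit)+
  have off: "par c r z = 0" if z: "z \<in> img c - K" for z
  proof -
    obtain m where m: "m \<in> fst c" "z = snd c m" using z by blast
    then show ?thesis using K(3)[of m] z par_apply[OF c m(1), of r] by (metis DiffD2)
  qed
  have u: "par c \<phi> z \<bullet> a > 0" if z: "z \<in> img c" for z
  proof -
    obtain m where m: "m \<in> fst c" "z = snd c m" using z by blast
    show ?thesis unfolding m(2) par_apply[OF c m(1)] using height_pos chart_subset[OF c] m(1) by blast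
  qed
  have H: "2 * mean_curvature (img c) (par c \<phi>) z = \<alpha> * ((c.N z \<bullet> a) / (par c \<phi> z \<bullet> a))" if z: "z \<in> img c" for z
  proof -
    obtain m where m: "m \<in> fst c" "z = snd c m" using z by blast
    have "2 * mean_curvature (img c) (par c \<phi>) (snd c m) = \<alpha> * ((c.N (snd c m) \<bullet> a) / (\<phi> m \<bullet> a))"
      by (rule singular_minimal[of "fst c" "snd c" m]) (use c m(1) in simp_all)
    then show ?thesis unfolding m(2) par_apply[OF c m(1)] .
  qed
  have div: "dir (img c) e\<^sub>1 F\<^sub>1 z + dir (img c) e\<^sub>2 F\<^sub>2 z = flux_div \<alpha> a c r z" if z: "z \<in> img c" for z
    unfolding F\<^sub>1_def[abs_def] F\<^sub>2_def[abs_def] flux_div_def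
    by (rule c.div_flux[OF r(1) a_unit z u[OF z] H[OF z]])
  \<comment> \<open>The trace of \<open>K\<close> on the boundary line: a compact set of abscissas
    outside which the boundary integrands vanish, which makes them integrable over the possibly
    unbounded set \<open>J\<close>.\<close>
  define K' where "K' = (\<lambda>z. z $ 1) ` (K \<inter> {z. z $ 2 = 0})"
  have "closed {z::real^2. z $ 2 = 0}"
    by (intro closed_Collect_eq continuous_intros)
  then have K': "compact K'"
    unfolding K'_def using K(1) by (intro compact_continuous_image compact_Int_closed continuous_intros)
  have K'J: "K' \<subseteq> J"
  proof
    fix t assume "t \<in> K'"
    then obtain z where "z \<in> K" "z $ 2 = 0" "t = z $ 1" by (auto simp: K'_def)
    then show "t \<in> J" using K(2) vec2_collapse[of z] by (auto simp: J_def)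
  qed
  have notK: "vec2 t 0 \<in> img c - K" if "t \<in> J - K'" for t
    using that vec2_nth[of t 0] unfolding J_def K'_def by (metis (mono_tags, lifting) DiffD1 DiffD2 DiffI IntI image_eqI mem_Collect_eq)
  have cJ: "continuous_on J (\<lambda>t. g (vec2 t 0))" if "continuous_on (img c) g" for g :: "real^2 \<Rightarrow> 'z::topological_space"
    by (rule continuous_on_compose2[OF that]) (auto intro!: continuous_intros simp: J_def)
  have parf: "par c f z = par c r z * (par c \<phi> z \<bullet> a)" for z by (simp add: f_def)
  have "continuous_on J (\<lambda>t. F\<^sub>2 (vec2 t 0))"
    by (rule cJ[OF C1_on_continuous[OF F(2)]])
  then have intF: "(\<lambda>t. F\<^sub>2 (vec2 t 0)) absolutely_integrable_on J"
    by (rule compact_support_absolutely_integrable[OF K' K'J]) (use notK off in \<open>simp add: F\<^sub>2_def\<close>)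
  have "continuous_on (img c) (\<lambda>z. par c r z * (par c \<phi> z \<bullet> a) * norm (c.p z))"
    by (intro continuous_intros C1_on_continuous[OF r(1)] C1_on_continuous[OF c.C1_X] C1_on_continuous[OF c.C1_dir_X])
  from cJ[OF this] have "continuous_on J k"
    unfolding k_def parf .
  then have intk: "k absolutely_integrable_on J"
    by (rule compact_support_absolutely_integrable[OF K' K'J]) (auto simp: k_def parf off[OF notK] simp del: comp_apply)
  have bd: "- F\<^sub>2 (vec2 t 0) \<le> k t" if t: "t \<in> J" for t
  proof -
    have z: "vec2 t 0 \<in> img c" using t by (simp add: J_def)
    have "\<bar>F\<^sub>2 (vec2 t 0)\<bar> \<le> par c r (vec2 t 0) * (par c \<phi> (vec2 t 0) \<bullet> a) * norm (c.p (vec2 t 0))"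
      unfolding F\<^sub>2_def by (rule c.flux_bound[OF r(1) a_unit z u[OF z]]) (simp add: r(2))
    then show ?thesis unfolding k_def parf by linarith
  qed
  have "integral (img c) (flux_div \<alpha> a c r) = integral (img c) (\<lambda>z. dir (img c) e\<^sub>1 F\<^sub>1 z + dir (img c) e\<^sub>2 F\<^sub>2 z)"
    using div by (intro integral_cong) simp
  also have "\<dots> = - integral J (\<lambda>t. F\<^sub>2 (vec2 t 0))"
    unfolding J_def by (rule half_plane_divergence[OF img_hp_open[OF c] K(1,2) F]) (use off in \<open>simp_all add: F\<^sub>1_def F\<^sub>2_def\<close>)
  also have "\<dots> = integral J (\<lambda>t. - F\<^sub>2 (vec2 t 0))" by simp
  also have "\<dots> \<le> integral J k"
    using intF intk bd by (intro integral_le integrable_neg) (auto simp: absolutely_integrable_on_def)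
  also have "\<dots> = integral {s\<in>{0..<1}. lift s \<in> fst c} (\<lambda>s. f (lift s) * norm (\<gamma>' s))"
    unfolding J_def k_def[abs_def]
    by (rule boundary_change_of_variables(2)[OF c]) (use intk in \<open>simp add: J_def k_def[abs_def]\<close>)
  finally show "integral (img c) (flux_div \<alpha> a c r) \<le> integral {s\<in>{0..<1}. lift s \<in> fst c} (\<lambda>s. r (lift s) * (\<phi> (lift s) \<bullet> a) * norm (\<gamma>' s))"
    unfolding f_def .
  have "(\<lambda>s. f (lift s) * norm (\<gamma>' s)) absolutely_integrable_on {s\<in>{0..<1}. lift s \<in> fst c}"
    by (rule boundary_change_of_variables(1)[OF c]) (use intk in \<open>simp add: J_def k_def[abs_def]\<close>)
  then show "(\<lambda>s. r (lift s) * (\<phi> (lift s) \<bullet> a) * norm (\<gamma>' s)) absolutely_integrable_on {s\<in>{0..<1}. lift s \<in> fst c}"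
    unfolding f_def .
qed

lemma curve_height_integral_le:
  "(\<lambda>s. (\<gamma> s \<bullet> a) * norm (\<gamma>' s)) integrable_on {0..<1}"
  "integral {0..<1} (\<lambda>s. (\<gamma> s \<bullet> a) * norm (\<gamma>' s)) \<le> curve_length \<gamma> * (SUP p\<in>range \<gamma>. p \<bullet> a)"
proof -
  \<comment> \<open>The two intervals differ by the point 1: the half-open one covers the boundary
    once, the closed one occurs in \<open>curve_length\<close>.\<close>
  have neg: "negligible {x \<in> {0..1} - {0..<1}. h x \<noteq> 0}" "negligible {x \<in> {0..<1} - {0..1}. h x \<noteq> 0}" for h :: "real \<Rightarrow> real"
    by (rule negligible_subset[OF negligible_sing[of 1]]; force)+
  have int: "(\<lambda>s. (\<gamma> s \<bullet> a) * norm (\<gamma>' s)) integrable_on {0..1}" "(\<lambda>s. norm (\<gamma>' s)) integrable_on {0..1}"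
    by (intro integrable_continuous_interval continuous_intros closed_curve_continuous[OF \<gamma>]
        closed_curve_derivative_continuous[OF \<gamma>])+
  show "(\<lambda>s. (\<gamma> s \<bullet> a) * norm (\<gamma>' s)) integrable_on {0..<1}"
    by (rule integrable_spike_set[OF int(1)]) (rule neg)+
  have "bounded ((\<lambda>p. p \<bullet> a) ` range \<gamma>)"
    by (intro compact_imp_bounded compact_continuous_image closed_curve_range_compact[OF \<gamma>] continuous_intros)
  then have "bdd_above ((\<lambda>p. p \<bullet> a) ` range \<gamma>)" by (rule bounded_imp_bdd_above)
  then have sup: "\<gamma> s \<bullet> a \<le> (SUP p\<in>range \<gamma>. p \<bullet> a)" for s
    by (rule cSUP_upper[rotated]) simp
  have "integral {0..<1} (\<lambda>s. (\<gamma> s \<bullet> a) * norm (\<gamma>' s)) = integral {0..1} (\<lambda>s. (\<gamma> s \<bullet> a) * norm (\<gamma>' s))"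
    by (rule integral_spike_set) (rule neg)+
  also have "\<dots> \<le> integral {0..1} (\<lambda>s. norm (\<gamma>' s) * (SUP p\<in>range \<gamma>. p \<bullet> a))"
  proof (rule integral_le[OF int(1)])
    show "(\<lambda>s. norm (\<gamma>' s) * (SUP p\<in>range \<gamma>. p \<bullet> a)) integrable_on {0..1}"
      using int(2) by (rule integrable_on_mult_left)
    show "(\<gamma> s \<bullet> a) * norm (\<gamma>' s) \<le> norm (\<gamma>' s) * (SUP p\<in>range \<gamma>. p \<bullet> a)" for s
      using mult_left_mono[OF sup[of s] norm_ge_zero[of "\<gamma>' s"]] by (simp add: mult.commute)
  qed
  also have "\<dots> = curve_length \<gamma> * (SUP p\<in>range \<gamma>. p \<bullet> a)"
    by (simp add: curve_length_def)
  finally show "integral {0..<1} (\<lambda>s. (\<gamma> s \<bullet> a) * norm (\<gamma>' s)) \<le> curve_length \<gamma> * (SUP p\<in>range \<gamma>. p \<bullet> a)" .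
qed

theorem area_le:
  assumes \<alpha>: "\<alpha> \<ge> 1" and compact: "compact_space T"
  shows "surface_area A \<phi> \<le> ennreal (curve_length \<gamma> * (SUP p\<in>range \<gamma>. p \<bullet> a))"
proof -
  obtain I :: "'m set" and c :: "'m \<Rightarrow> 'm chart" and K :: "'m \<Rightarrow> (real^2) set" and \<rho> :: "'m \<Rightarrow> 'm \<Rightarrow> real"
    where I: "finite I" and c: "\<And>i. i \<in> I \<Longrightarrow> c i \<in> A"
      and K: "\<And>i. i \<in> I \<Longrightarrow> compact (K i)" "\<And>i. i \<in> I \<Longrightarrow> K i \<subseteq> img (c i)"
      and \<rho>0: "\<And>i m. i \<in> I \<Longrightarrow> \<rho> i m \<ge> 0"
      and supp: "\<And>i m. i \<in> I \<Longrightarrow> \<rho> i m \<noteq> 0 \<Longrightarrow> m \<in> fst (c i) \<and> snd (c i) m \<in> K i"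
      and C1: "\<And>i d. i \<in> I \<Longrightarrow> d \<in> A \<Longrightarrow> C1_on (img d) (par d (\<rho> i))"
      and dir0: "\<And>i d m v. i \<in> I \<Longrightarrow> d \<in> A \<Longrightarrow> m \<in> fst d \<Longrightarrow> \<rho> i m = 0 \<Longrightarrow> dir (img d) v (par d (\<rho> i)) (snd d m) = 0"
      and sum1: "\<And>m. m \<in> topspace T \<Longrightarrow> (\<Sum>i\<in>I. \<rho> i m) = 1"
    by (rule partition_of_unity[OF compact]) (rule that)
  \<comment> \<open>The weight \<open>\<rho> i\<close> belongs to chart \<open>c i\<close>, but its
    divergence density is needed in every chart \<open>d\<close>.\<close>
  define G where "G i d = flux_div \<alpha> a d (\<rho> i)" for i d
  define R where "R i d = par d (\<rho> i)" for i d
  define W where "W d = area_density (img d) (par d \<phi>)" for d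
  \<comment> \<open>Both the value and the derivative of the weight vanish at such a point.\<close>
  have G0: "G i d (snd d m) = 0" if "i \<in> I" "d \<in> A" "m \<in> fst d" "\<rho> i m = 0" for i d m
    unfolding G_def flux_div_def param_surface.flux_div_def[OF param[OF that(2)]] par_apply[OF that(2,3)]
    using dir0[OF that] that(4) by simp
  have contG: "continuous_on (img d) (G i d)" if "i \<in> I" "d \<in> A" for i d
    unfolding G_def flux_div_def by (rule param_surface.continuous_flux_div[OF param[OF that(2)] C1[OF that]])
  have contR: "continuous_on (img d) (R i d)" if "i \<in> I" "d \<in> A" for i d
    unfolding R_def by (rule C1_on_continuous[OF C1[OF that]])
  have contW: "continuous_on (img d) (W d)" if "d \<in> A" for d
    unfolding W_def by (rule C1_on_continuous[OF param_surface.C1_W[OF param[OF that]]])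
  have off: "\<rho> i m = 0" if "i \<in> I" "m \<in> fst (c i)" "snd (c i) m \<notin> K i" for i m
    using supp that by blast
  have Goff: "G i (c i) z = 0" if i: "i \<in> I" and z: "z \<in> img (c i) - K i" for i z
  proof -
    obtain m where m: "m \<in> fst (c i)" "z = snd (c i) m" using z by blast
    show ?thesis unfolding m(2) by (rule G0[OF i c[OF i] m(1) off[OF i m(1)]]) (use z m in simp)
  qed
  have Roff: "R i (c i) z = 0" if i: "i \<in> I" and z: "z \<in> img (c i) - K i" for i z
  proof -
    obtain m where m: "m \<in> fst (c i)" "z = snd (c i) m" using z by blast
    show ?thesis unfolding m(2) R_def par_apply[OF c[OF i] m(1)] by (rule off[OF i m(1)]) (use z m in simp)
  qed
  have int1: "(\<lambda>z. R j (c i) z * G i (c i) z) absolutely_integrable_on img (c i)" if "i \<in> I" "j \<in> I" for i j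
    by (rule compact_support_absolutely_integrable[OF K[OF that(1)]])
      (use that Goff in \<open>auto intro!: continuous_on_mult contR contG c\<close>)
  have int2: "(\<lambda>z. R j (c j) z * G i (c j) z) absolutely_integrable_on img (c j)" if "i \<in> I" "j \<in> I" for i j
    by (rule compact_support_absolutely_integrable[OF K[OF that(2)]])
      (use that Roff in \<open>auto intro!: continuous_on_mult contR contG c\<close>)
  have intW: "(\<lambda>z. R j (c j) z * W (c j) z) absolutely_integrable_on img (c j)" if "j \<in> I" for j
    by (rule compact_support_absolutely_integrable[OF K[OF that]])
      (use that Roff in \<open>auto intro!: continuous_on_mult contR contW c\<close>)
  have R1: "(\<Sum>j\<in>I. R j d z) = 1" if d: "d \<in> A" and z: "z \<in> img d" for d z
  proof -
    obtain m where m: "m \<in> fst d" "z = snd d m" using z by blast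
    show ?thesis unfolding m(2) R_def par_apply[OF d m(1)] using sum1 chart_subset[OF d] m(1) by blast
  qed
  \<comment> \<open>The factor \<open>R j\<close> vanishes off the chart \<open>c j\<close> and
    \<open>G i\<close> off the chart \<open>c i\<close>, so the product lives on the overlap; since
    \<open>R j\<close> is a scalar, the product is a density like \<open>G i\<close>.\<close>
  have transfer: "integral (img (c i)) (\<lambda>z. R j (c i) z * G i (c i) z) = integral (img (c j)) (\<lambda>z. R j (c j) z * G i (c j) z)"
    if i: "i \<in> I" and j: "j \<in> I" for i j
  proof (rule integral_transfer[OF c[OF i] c[OF j] int2[OF i j]])
    fix m assume m: "m \<in> fst (c i) - fst (c j)"
    then have "\<rho> j m = 0" using supp[OF j] by blast
    then show "R j (c i) (snd (c i) m) * G i (c i) (snd (c i) m) = 0"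
      using m unfolding R_def by (subst par_apply[OF c[OF i]]) auto
  next
    fix m assume m: "m \<in> fst (c j) - fst (c i)"
    then have "\<rho> i m = 0" using supp[OF i] by blast
    then show "R j (c j) (snd (c j) m) * G i (c j) (snd (c j) m) = 0"
      using G0[OF i c[OF j]] m by simp
  next
    fix m assume "m \<in> fst (c i) \<inter> fst (c j)"
    then have m: "m \<in> fst (c i)" "m \<in> fst (c j)" by auto
    show "R j (c i) (snd (c i) m) * G i (c i) (snd (c i) m) =
        \<bar>det (matrix (dtrans (c i) (c j) (snd (c i) m)))\<bar> * (R j (c j) (snd (c j) m) * G i (c j) (snd (c j) m))"
      unfolding G_def flux_div_transition[OF c[OF i] c[OF j] m C1[OF i c[OF j]]] R_def par_apply[OF c[OF i] m(1)] par_apply[OF c[OF j] m(2)]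
      by simp
  qed
  \<comment> \<open>In a fixed chart the derivatives of the weights add up to the derivative of the
    constant 1, so the term with \<open>tang\<close> drops out; then \<open>\<alpha> \<ge> 1\<close>
    leaves at least \<open>W d z\<close>.\<close>
  have sumG: "(\<Sum>i\<in>I. G i d z) \<ge> W d z" if d: "d \<in> A" and z: "z \<in> img d" for d z
  proof -
    interpret d: param_surface "img d" "par d \<phi>" using param[OF d] .
    have Rd: "(\<Sum>i\<in>I. R i d z) = 1" if "z \<in> img d" for z using R1[OF d that] .
    have "(\<Sum>i\<in>I. dir (img d) v (R i d) z) = 0" for v
      using d.dir_const_zero[OF z, of "\<lambda>z. \<Sum>i\<in>I. R i d z" 1 v] Rd
        dir_sum[OF img_hp_open[OF d] C1[OF _ d] z, of I "\<lambda>i. i" v] by (simp add: R_def)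
    moreover have "(\<Sum>i\<in>I. G i d z) =
        W d z * ((\<Sum>i\<in>I. R i d z) * (1 + (\<alpha> - 1) * (d.N z \<bullet> a)\<^sup>2) + (par d \<phi> z \<bullet> a) * (\<Sum>i\<in>I. dir (img d) (d.tang a z) (R i d) z))"
      unfolding G_def flux_div_def d.flux_div_def W_def R_def
      by (simp only: sum_distrib_left sum_distrib_right sum.distrib distrib_left)
    ultimately have "(\<Sum>i\<in>I. G i d z) = W d z * (1 + (\<alpha> - 1) * (d.N z \<bullet> a)\<^sup>2)"
      using Rd[OF z] by simp
    moreover have "W d z * (1 + (\<alpha> - 1) * (d.N z \<bullet> a)\<^sup>2) \<ge> W d z * 1"
      using d.W_pos[OF z] \<alpha> unfolding W_def by (intro mult_left_mono) auto
    ultimately show ?thesis by simp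
  qed
  \<comment> \<open>The pointwise bound \<open>sumG\<close> is applied in chart \<open>c j\<close>
    under the nonnegative weight \<open>R j\<close>.\<close>
  have "(\<Sum>j\<in>I. integral (img (c j)) (\<lambda>z. R j (c j) z * W (c j) z)) \<le> (\<Sum>j\<in>I. \<Sum>i\<in>I. integral (img (c j)) (\<lambda>z. R j (c j) z * G i (c j) z))"
  proof (rule sum_mono)
    fix j assume j: "j \<in> I"
    have "integral (img (c j)) (\<lambda>z. R j (c j) z * W (c j) z) \<le> integral (img (c j)) (\<lambda>z. \<Sum>i\<in>I. R j (c j) z * G i (c j) z)"
    proof (rule integral_le)
      show "(\<lambda>z. R j (c j) z * W (c j) z) integrable_on img (c j)"
        using intW[OF j] by (simp add: absolutely_integrable_on_def)
      show "(\<lambda>z. \<Sum>i\<in>I. R j (c j) z * G i (c j) z) integrable_on img (c j)"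
        using int2[OF _ j] I by (intro integrable_sum) (auto simp: absolutely_integrable_on_def)
      show "R j (c j) z * W (c j) z \<le> (\<Sum>i\<in>I. R j (c j) z * G i (c j) z)" if "z \<in> img (c j)" for z
        unfolding sum_distrib_left[symmetric] using sumG[OF c[OF j] that] \<rho>0[OF j] by (intro mult_left_mono) (auto simp: R_def)
    qed
    also have "\<dots> = (\<Sum>i\<in>I. integral (img (c j)) (\<lambda>z. R j (c j) z * G i (c j) z))"
      using int2[OF _ j] I by (intro Henstock_Kurzweil_Integration.integral_sum) (auto simp: absolutely_integrable_on_def)
    finally show "integral (img (c j)) (\<lambda>z. R j (c j) z * W (c j) z) \<le> (\<Sum>i\<in>I. integral (img (c j)) (\<lambda>z. R j (c j) z * G i (c j) z))" .
  qed
  \<comment> \<open>After the move to chart \<open>c i\<close> and the exchange of sums the weights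
    \<open>R j\<close> add up to 1, leaving for each \<open>i\<close> the full divergence in its own
    chart.\<close>
  also have "\<dots> = (\<Sum>j\<in>I. \<Sum>i\<in>I. integral (img (c i)) (\<lambda>z. R j (c i) z * G i (c i) z))"
    using transfer by (intro sum.cong refl) simp
  also have "\<dots> = (\<Sum>i\<in>I. \<Sum>j\<in>I. integral (img (c i)) (\<lambda>z. R j (c i) z * G i (c i) z))"
    by (rule sum.swap)
  also have "\<dots> = (\<Sum>i\<in>I. integral (img (c i)) (G i (c i)))"
  proof (rule sum.cong[OF refl])
    fix i assume i: "i \<in> I"
    have "(\<Sum>j\<in>I. integral (img (c i)) (\<lambda>z. R j (c i) z * G i (c i) z)) = integral (img (c i)) (\<lambda>z. \<Sum>j\<in>I. R j (c i) z * G i (c i) z)"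
      using int1[OF i] I by (intro Henstock_Kurzweil_Integration.integral_sum[symmetric]) (auto simp: absolutely_integrable_on_def)
    also have "\<dots> = integral (img (c i)) (G i (c i))"
      using R1[OF c[OF i]] by (intro integral_cong) (simp flip: sum_distrib_right)
    finally show "(\<Sum>j\<in>I. integral (img (c i)) (\<lambda>z. R j (c i) z * G i (c i) z)) = integral (img (c i)) (G i (c i))" .
  qed
  also have "\<dots> \<le> (\<Sum>i\<in>I. integral {s\<in>{0..<1}. lift s \<in> fst (c i)} (\<lambda>s. \<rho> i (lift s) * (\<phi> (lift s) \<bullet> a) * norm (\<gamma>' s)))"
    unfolding G_def using \<rho>0 by (intro sum_mono chart_flux_le(1)[OF c C1[OF _ c] _ K supp]) auto
  \<comment> \<open>Where the lifted point lies outside the chart \<open>c i\<close> its weight is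
    zero, so all integrals extend to the common period.\<close>
  also have "\<dots> = (\<Sum>i\<in>I. integral {0..<1} (\<lambda>s. \<rho> i (lift s) * (\<gamma> s \<bullet> a) * norm (\<gamma>' s)))"
    unfolding \<phi>_lift by (intro sum.cong refl integral_support_cong) (use supp in auto)
  also have "\<dots> = integral {0..<1} (\<lambda>s. \<Sum>i\<in>I. \<rho> i (lift s) * (\<gamma> s \<bullet> a) * norm (\<gamma>' s))"
  proof (rule Henstock_Kurzweil_Integration.integral_sum[OF I, symmetric])
    fix i assume i: "i \<in> I"
    have "(\<lambda>s. \<rho> i (lift s) * (\<gamma> s \<bullet> a) * norm (\<gamma>' s)) absolutely_integrable_on {s\<in>{0..<1}. lift s \<in> fst (c i)}"
      using chart_flux_le(2)[OF c[OF i] C1[OF i c[OF i]] \<rho>0[OF i] K(1,2)[OF i] supp[OF i]] by (simp add: \<phi>_lift)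
    moreover have "(\<lambda>s. indicator {s\<in>{0..<1}. lift s \<in> fst (c i)} s *\<^sub>R (\<rho> i (lift s) * (\<gamma> s \<bullet> a) * norm (\<gamma>' s))) =
        (\<lambda>s. indicator {0..<1} s *\<^sub>R (\<rho> i (lift s) * (\<gamma> s \<bullet> a) * norm (\<gamma>' s)))"
      by (rule ext) (use supp[OF i] in \<open>auto simp: indicator_def\<close>)
    ultimately have "(\<lambda>s. \<rho> i (lift s) * (\<gamma> s \<bullet> a) * norm (\<gamma>' s)) absolutely_integrable_on {0..<1}"
      unfolding set_integrable_def by (simp only:)
    then show "(\<lambda>s. \<rho> i (lift s) * (\<gamma> s \<bullet> a) * norm (\<gamma>' s)) integrable_on {0..<1}"
      by (rule set_lebesgue_integral_eq_integral(1))
  qed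
  \<comment> \<open>The weights sum to 1 at boundary points of the surface as well, so the cutoffs
    disappear and the integral of the height along the curve remains.\<close>
  also have "\<dots> = integral {0..<1} (\<lambda>s. (\<gamma> s \<bullet> a) * norm (\<gamma>' s))"
    using sum1 lift_in boundary_subset by (intro integral_cong) (auto simp flip: sum_distrib_right)
  also have "\<dots> \<le> curve_length \<gamma> * (SUP p\<in>range \<gamma>. p \<bullet> a)"
    by (rule curve_height_integral_le(2))
  finally have "(\<Sum>j\<in>I. integral (img (c j)) (\<lambda>z. R j (c j) z * W (c j) z)) \<le> curve_length \<gamma> * (SUP p\<in>range \<gamma>. p \<bullet> a)" .
  moreover have "surface_area A \<phi> \<le> ennreal (\<Sum>j\<in>I. integral (img (c j)) (\<lambda>z. R j (c j) z * W (c j) z))"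
    unfolding R_def W_def
  proof (rule surface_area_le[OF I c \<rho>0 _ sum1])
    show "\<rho> i m = 0" if "i \<in> I" "m \<notin> fst (c i)" for i m using supp that by blast
    show "(\<lambda>z. par (c i) (\<rho> i) z * area_density (img (c i)) (par (c i) \<phi>) z) absolutely_integrable_on img (c i)" if "i \<in> I" for i
      using intW[OF that] unfolding R_def W_def .
  qed
  ultimately show ?thesis
    using ennreal_leI order_trans by blast
qed

end

theorem proposition3p1:
  fixes \<alpha> :: real and a :: "real^3" and \<gamma> :: "real \<Rightarrow> real^3" and \<Gamma> :: "(real^3) set"
    and T :: "'m topology" and A :: "'m chart set" and \<phi> :: "'m \<Rightarrow> real^3"
  assumes "\<alpha> \<ge> 1"
    and "norm a = 1"
    and "closed_curve_param \<gamma>" and "\<Gamma> = range \<gamma>"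
    and "\<Gamma> \<subseteq> open_half_space a"
    and "singular_minimal_surface T A \<phi> \<alpha> a"
    and "compact_space T"
    and "has_boundary T A \<phi> \<Gamma>"
  shows "surface_area A \<phi> \<le> ennreal (curve_length \<gamma> * (SUP p\<in>\<Gamma>. p \<bullet> a))"
proof -
  interpret singular_minimal_surface T A \<phi> \<alpha> a by fact
  interpret bounded_singular_surface T A \<phi> \<gamma> \<alpha> a
    by unfold_locales (use assms(3,4,8) in auto)
  show ?thesis
    unfolding assms(4) by (rule area_le[OF assms(1,7)])
qed

end
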